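(* Fix $\beta\ge 2$ and a sequence of positive reals $a_j$ decreasing to $0$. For each $j$ let $d_j$ be the Riemannian distance on $\mathbb{S}^2\times\mathbb{S}^1$ of the warped product metric $$g_j=dr^2+\sin^2(r)\,d\theta^2+f_j^2(r)\,d\varphi^2,\qquad f_j(r)=\ln\left(\frac{1+a_j}{\sin^2 r+a_j}\right)+\beta .$$ Let $S=r^{-1}(0)\cup r^{-1}(\pi)$ and, on $(\mathbb{S}^2\times\mathbb{S}^1)\setminus S$, let $d_{g_\infty}$ be the Riemannian distance (infimum of lengths of curves staying in $(\mathbb{S}^2\times\mathbb{S}^1)\setminus S$) of the smooth metric $$g_\infty=dr^2+\sin^2(r)\,d\theta^2+f_\infty^2(r)\,d\varphi^2,\qquad f_\infty(r)=-2\ln(\sin r)+\beta .$$ Then there is a metric $d_\infty$ on $\mathbb{S}^2\times\mathbb{S}^1$ such that: (1) $d_j\to d_\infty$ uniformly on $(\mathbb{S}^2\times\mathbb{S}^1)\times(\mathbb{S}^2\times\mathbb{S}^1)$, and $(\mathbb{S}^2\times\mathbb{S}^1,d_j)$ converges to $(\mathbb{S}^2\times\mathbb{S}^1,d_\infty)$ in the Gromov-Hausdorff sense; (2) $(\mathbb{S}^2\times\mathbb{S}^1,d_\infty)$ is the metric completion of $((\mathbb{S}^2\times\mathbb{S}^1)\setminus S,\,d_{g_\infty})$; (3) $(\mathbb{S}^2\times\mathbb{S}^1,d_\infty)$ is a compact metric space homeomorphic to the isometric product space $(\mathbb{S}^2\times\mathbb{S}^1,d_0)$; (4) the singular set $S\subset(\mathbb{S}^2\times\mathbb{S}^1,d_\infty)$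 has Hausdorff dimension $1$, but the singular fibres $r^{-1}(0)$ and $r^{-1}(\pi)$ are unrectifiable, and $\mathcal{H}^1_{d_\infty}(S)=\infty$; (5) $\mathcal{H}^3_{d_\infty}(\mathbb{S}^2\times\mathbb{S}^1)=(2\pi)^2(2\beta+4-2\ln 4)$.
   Context: Coordinates: $(r,\theta)$ are the standard polar coordinates on the unit sphere $\mathbb{S}^2$, $r\in[0,\pi]$ being the distance to a fixed pole and $\theta\in\mathbb{S}^1$, with $g_{\mathbb{S}^2}=dr^2+\sin^2(r)\,d\theta^2$; $\varphi$ is the angular coordinate on $\mathbb{S}^1$ (circumference $2\pi$). Each $g_j$ is a smooth Riemannian metric on $\mathbb{S}^2\times\mathbb{S}^1$. The length of a continuously differentiable curve $c$ with respect to $g$ is $L_g(c)=\int\sqrt{g(\dot c,\dot c)}\,dt$, and the Riemannian distance is the infimum of lengths of continuously differentiable curves between two points. $d_0$ is the Riemannian distance of the product metric $g_0=dr^2+\sin^2(r)\,d\theta^2+d\varphi^2$ on $\mathbb{S}^2\times\mathbb{S}^1$. $\mathcal{H}^p_{d_\infty}$ is the $p$-dimensional Hausdorff measure of the metric $d_\infty$, normalized so that on a smooth Riemannian $3$-manifold $\mathcal{H}^3$ agrees with Riemannian volume. The singular fibres being unrectifiable means that the fibre curves $t\mapsto(r,0,t)$, $t\in[0,2\pi]$, with $r=0$ and $r=\pi$, have infinite $d_\infty$-length (length being the supremum over partitions of the sums of $d_\infty$-distances). The metric completion of $(X,d)$ is the unique (up to isometry) complete metric space $Y$ admitting a distance preserving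 map $X\to Y$ with dense image. *)

theory Defs
  imports "HOL-Analysis.Analysis"
begin

section \<open>The manifold and its warped product metrics\<close>

text \<open>
  The manifold is embedded in \<open>(real^3) \<times> complex\<close>. A tangent vector at a point is
  a pair \<open>(v, w)\<close> in the same space; a Riemannian metric is a function
  sending a point and two tangent vectors to a real number.
\<close>

definition S2xS1 :: "((real^3) \<times> complex) set" where
  "S2xS1 = sphere 0 1 \<times> sphere 0 1"

definition polar_r :: "(real^3) \<times> complex \<Rightarrow> real" where
  "polar_r p = arccos (fst p $ 3)"

definition polar_point :: "real \<Rightarrow> real \<Rightarrow> real \<Rightarrow> (real^3) \<times> complex" where
  "polar_point r \<theta> \<phi> = (vector [sin r * cos \<theta>, sin r * sin \<theta>, cos r], cis \<phi>)"

definition singular_set :: "((real^3) \<times> complex) set" where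
  "singular_set = {p \<in> S2xS1. polar_r p = 0 \<or> polar_r p = pi}"

text \<open>
  The metric \<open>dr\<^sup>2 + sin\<^sup>2(r) d\<theta>\<^sup>2 + f\<^sup>2(r) d\<phi>\<^sup>2\<close>: the first two summands are the
  round metric, i.e. the restriction of the inner product of \<open>real^3\<close> to the sphere, and
  \<open>d\<phi>\<^sup>2\<close> is the restriction of the inner product of \<open>complex\<close> to the
  circle; see \<open>warped_metric_polar\<close> below for the expression in coordinates.
\<close>

definition warped_metric ::
    "(real \<Rightarrow> real) \<Rightarrow> (real^3) \<times> complex \<Rightarrow> (real^3) \<times> complex \<Rightarrow> (real^3) \<times> complex \<Rightarrow> real" where
  "warped_metric f p X Y = fst X \<bullet> fst Y + (f (polar_r p))\<^sup>2 * (snd X \<bullet> snd Y)"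

definition f_reg :: "real \<Rightarrow> real \<Rightarrow> real \<Rightarrow> real" where
  "f_reg \<beta> \<alpha> r = ln ((1 + \<alpha>) / ((sin r)\<^sup>2 + \<alpha>)) + \<beta>"

definition f_inf :: "real \<Rightarrow> real \<Rightarrow> real" where
  "f_inf \<beta> r = - 2 * ln (sin r) + \<beta>"

lemma polar_r_polar_point: "0 \<le> r \<Longrightarrow> r \<le> pi \<Longrightarrow> polar_r (polar_point r \<theta> \<phi>) = r"
  by (simp add: polar_r_def polar_point_def arccos_cos)

lemma polar_point_in: "polar_point r \<theta> \<phi> \<in> S2xS1"
proof -
  have "(sin r * cos \<theta>)\<^sup>2 + (sin r * sin \<theta>)\<^sup>2 + (cos r)\<^sup>2
      = (sin r)\<^sup>2 * ((sin \<theta>)\<^sup>2 + (cos \<theta>)\<^sup>2) + (cos r)\<^sup>2"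
    by algebra
  then have "(sin r * cos \<theta>)\<^sup>2 + (sin r * sin \<theta>)\<^sup>2 + (cos r)\<^sup>2 = 1"
    by simp
  then show ?thesis
    by (simp add: polar_point_def S2xS1_def norm_vec_def L2_set_def sum_3)
qed

lemma S2xS1_polar: "S2xS1 = {polar_point r \<theta> \<phi> | r \<theta> \<phi>. 0 \<le> r \<and> r \<le> pi}"
proof (rule set_eqI, rule iffI)
  fix p assume "p \<in> S2xS1"
  then obtain x u where p: "p = (x, u)" "norm x = 1" "norm u = 1"
    by (auto simp: S2xS1_def)
  have n: "(x$1)\<^sup>2 + (x$2)\<^sup>2 + (x$3)\<^sup>2 = 1"
    using p(2) by (simp add: norm_vec_def L2_set_def sum_3)
  define r where "r = arccos (x$3)"
  have x3: "\<bar>x$3\<bar> \<le> 1"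
    using n zero_le_power2[of "x$1"] zero_le_power2[of "x$2"]
    by (subst abs_square_le_1[symmetric]) linarith
  have r: "0 \<le> r" "r \<le> pi" "cos r = x$3"
    unfolding r_def using x3 by (auto simp: arccos_lbound arccos_ubound cos_arccos_abs)
  have s: "sin r \<ge> 0" using r sin_ge_zero by blast
  have "(sin r)\<^sup>2 = (norm (Complex (x$1) (x$2)))\<^sup>2"
    using n r(3) by (simp add: cmod_power2 sin_squared_eq)
  then have sr: "sin r = norm (Complex (x$1) (x$2))"
    using s by (simp add: power2_eq_iff_nonneg)
  have "Complex (x$1) (x$2) = of_real (sin r) * cis (Arg (Complex (x$1) (x$2)))"
    unfolding sr using rcis_cmod_Arg[of "Complex (x$1) (x$2)"] by (simp add: rcis_def)
  then have "x$1 = sin r * cos (Arg (Complex (x$1) (x$2)))"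
      "x$2 = sin r * sin (Arg (Complex (x$1) (x$2)))"
    by (simp_all add: complex_eq_iff)
  then have "x = vector [sin r * cos (Arg (Complex (x$1) (x$2))),
      sin r * sin (Arg (Complex (x$1) (x$2))), cos r]"
    by (simp add: vec_eq_iff forall_3 r(3))
  moreover have "u = cis (Arg u)"
    using rcis_cmod_Arg[of u] p(3) by (simp add: rcis_def)
  ultimately show "p \<in> {polar_point r \<theta> \<phi> | r \<theta> \<phi>. 0 \<le> r \<and> r \<le> pi}"
    using r(1,2) p(1) unfolding polar_point_def by blast
qed (auto simp: polar_point_in)

lemma warped_metric_polar:
  fixes R T P :: "real \<Rightarrow> real"
  assumes R: "(R has_real_derivative R') (at t)" "0 \<le> R t" "R t \<le> pi"
    and T: "(T has_real_derivative T') (at t)"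
    and P: "(P has_real_derivative P') (at t)"
  defines "c \<equiv> \<lambda>t. polar_point (R t) (T t) (P t)"
  obtains c' where "(c has_vector_derivative c') (at t)"
    "warped_metric f (c t) c' c' = R'\<^sup>2 + (sin (R t))\<^sup>2 * T'\<^sup>2 + (f (R t))\<^sup>2 * P'\<^sup>2"
proof -
  define v1 where "v1 = cos (R t) * R' * cos (T t) - sin (R t) * (sin (T t) * T')"
  define v2 where "v2 = cos (R t) * R' * sin (T t) + sin (R t) * (cos (T t) * T')"
  define v3 where "v3 = - (sin (R t) * R')"
  define v :: "real^3" where "v = vector [v1, v2, v3]"
  define w where "w = P' *\<^sub>R (\<i> * cis (P t))"
  have 1: "((\<lambda>t. sin (R t) * cos (T t)) has_vector_derivative v1) (at t)"
    "((\<lambda>t. sin (R t) * sin (T t)) has_vector_derivative v2) (at t)"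
    "((\<lambda>t. cos (R t)) has_vector_derivative v3) (at t)"
    unfolding v1_def v2_def v3_def has_real_derivative_iff_has_vector_derivative[symmetric]
    by (auto intro!: derivative_eq_intros R(1) T simp: algebra_simps)
  have vec: "(vector [a, b, d] :: real^3) = a *\<^sub>R axis 1 1 + b *\<^sub>R axis 2 1 + d *\<^sub>R axis 3 1"
    for a b d :: real
    by (simp add: vec_eq_iff forall_3 axis_def)
  have x: "((\<lambda>t. vector [sin (R t) * cos (T t), sin (R t) * sin (T t), cos (R t)] :: real^3)
      has_vector_derivative v) (at t)"
    unfolding vec v_def
    by (intro has_vector_derivative_add
        bounded_linear.has_vector_derivative[OF bounded_linear_scaleR_left] 1)
  have u: "((\<lambda>t. cis (P t)) has_vector_derivative w) (at t)"
  proof -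
    have "((\<lambda>t. cos (P t)) has_vector_derivative - sin (P t) * P') (at t)"
      "((\<lambda>t. sin (P t)) has_vector_derivative cos (P t) * P') (at t)"
      unfolding has_real_derivative_iff_has_vector_derivative[symmetric]
      by (auto intro!: derivative_eq_intros P)
    then have "((\<lambda>t. cos (P t) *\<^sub>R 1 + sin (P t) *\<^sub>R \<i>) has_vector_derivative
        (- sin (P t) * P') *\<^sub>R 1 + (cos (P t) * P') *\<^sub>R \<i>) (at t)"
      by (intro has_vector_derivative_add
          bounded_linear.has_vector_derivative[OF bounded_linear_scaleR_left])
    moreover have "cos y *\<^sub>R 1 + sin y *\<^sub>R \<i> = cis y" for y
      by (simp add: complex_eq_iff)
    moreover have "(- sin (P t) * P') *\<^sub>R 1 + (cos (P t) * P') *\<^sub>R \<i> = w"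
      by (simp add: w_def complex_eq_iff)
    ultimately show ?thesis by simp
  qed
  have "(c has_vector_derivative (v, w)) (at t)"
    unfolding c_def polar_point_def by (rule has_vector_derivative_Pair[OF x u])
  moreover have "v \<bullet> v = R'\<^sup>2 + (sin (R t))\<^sup>2 * T'\<^sup>2"
  proof -
    have "v \<bullet> v = v1\<^sup>2 + v2\<^sup>2 + v3\<^sup>2"
      by (simp add: v_def inner_vec_def sum_3 power2_eq_square)
    also have "v1\<^sup>2 + v2\<^sup>2 =
        ((sin (T t))\<^sup>2 + (cos (T t))\<^sup>2) * ((cos (R t) * R')\<^sup>2 + (sin (R t) * T')\<^sup>2)"
      unfolding v1_def v2_def by algebra
    also have "\<dots> = (cos (R t) * R')\<^sup>2 + (sin (R t) * T')\<^sup>2"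
      by simp
    also have "\<dots> + v3\<^sup>2 =
        ((sin (R t))\<^sup>2 + (cos (R t))\<^sup>2) * R'\<^sup>2 + (sin (R t))\<^sup>2 * T'\<^sup>2"
      unfolding v3_def by algebra
    finally show ?thesis by simp
  qed
  moreover have "w \<bullet> w = P'\<^sup>2"
    by (simp add: w_def dot_square_norm norm_mult)
  moreover have "polar_r (c t) = R t"
    by (simp add: c_def polar_r_polar_point R)
  ultimately show thesis
    by (intro that[of "(v, w)"]) (simp_all add: warped_metric_def)
qed


section \<open>Riemannian length and distance\<close>

definition riem_length :: "('a::real_normed_vector \<Rightarrow> 'a \<Rightarrow> 'a \<Rightarrow> real) \<Rightarrow> (real \<Rightarrow> 'a) \<Rightarrow> real" where
  "riem_length g c = integral {0..1}
     (\<lambda>t. sqrt (g (c t) (vector_derivative c (at t)) (vector_derivative c (at t))))"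

text \<open>
  The value 0 off \<open>M\<close> is a convention: the locale \<open>Metric_space\<close> asks for
  nonnegativity and symmetry on the whole type, while the infimum of the empty set is an
  unspecified real.
\<close>

definition riem_dist :: "'a::real_normed_vector set \<Rightarrow> ('a \<Rightarrow> 'a \<Rightarrow> 'a \<Rightarrow> real) \<Rightarrow> 'a \<Rightarrow> 'a \<Rightarrow> real" where
  "riem_dist M g p q = (if p \<in> M \<and> q \<in> M
     then Inf {riem_length g c | c. c C1_differentiable_on {0..1} \<and> c ` {0..1} \<subseteq> M \<and> c 0 = p \<and> c 1 = q}
     else 0)"


section \<open>Gromov-Hausdorff distance and metric completion\<close>

definition isometric_embedding :: "'a set \<Rightarrow> ('a \<Rightarrow> 'a \<Rightarrow> real) \<Rightarrow> 'b set \<Rightarrow> ('b \<Rightarrow> 'b \<Rightarrow> real) \<Rightarrow> ('a \<Rightarrow> 'b) \<Rightarrow> bool" where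
  "isometric_embedding X d Y e h \<longleftrightarrow> h ` X \<subseteq> Y \<and> (\<forall>x\<in>X. \<forall>y\<in>X. e (h x) (h y) = d x y)"

definition hausdorff_dist :: "('a \<Rightarrow> 'a \<Rightarrow> real) \<Rightarrow> 'a set \<Rightarrow> 'a set \<Rightarrow> ennreal" where
  "hausdorff_dist d A B =
     max (SUP a\<in>A. INF b\<in>B. ennreal (d a b)) (SUP b\<in>B. INF a\<in>A. ennreal (d a b))"

text \<open>
  The infimum is over all metric spaces \<open>Z\<close> receiving both spaces isometrically.
  Only the union of the two images matters, and this union fits into the sum type, so letting
  \<open>Z\<close> range over subsets of the sum type is no restriction.
\<close>

definition GH_dist :: "'a set \<Rightarrow> ('a \<Rightarrow> 'a \<Rightarrow> real) \<Rightarrow> 'b set \<Rightarrow> ('b \<Rightarrow> 'b \<Rightarrow> real) \<Rightarrow> ennreal" where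
  "GH_dist X d Y e = Inf {hausdorff_dist \<delta> (h ` X) (k ` Y) | (Z :: ('a + 'b) set) \<delta> h k.
     Metric_space Z \<delta> \<and> isometric_embedding X d Z \<delta> h \<and> isometric_embedding Y e Z \<delta> k}"

definition is_metric_completion :: "'b set \<Rightarrow> ('b \<Rightarrow> 'b \<Rightarrow> real) \<Rightarrow> 'a set \<Rightarrow> ('a \<Rightarrow> 'a \<Rightarrow> real) \<Rightarrow> bool" where
  "is_metric_completion Y e X d \<longleftrightarrow>
     Metric_space X d \<and> Metric_space Y e \<and> Metric_space.mcomplete Y e \<and>
     (\<exists>h. isometric_embedding X d Y e h \<and> Metric_space.mtopology Y e closure_of (h ` X) = Y)"


section \<open>Hausdorff measure and dimension, length of curves\<close>

definition ediam :: "('a \<Rightarrow> 'a \<Rightarrow> real) \<Rightarrow> 'a set \<Rightarrow> ennreal" where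
  "ediam d U = (SUP x\<in>U. SUP y\<in>U. ennreal (d x y))"

text \<open>
  The factor is the volume of the \<open>p\<close>-dimensional Euclidean ball of diameter 1, which makes
  the measure agree with Lebesgue measure on Euclidean spaces and with the Riemannian volume.
  The case \<open>p = 0\<close> is separate since \<open>0 powr 0 = 0\<close> in HOL.
\<close>

definition hausdorff_weight :: "('a \<Rightarrow> 'a \<Rightarrow> real) \<Rightarrow> real \<Rightarrow> 'a set \<Rightarrow> ennreal" where
  "hausdorff_weight d p U =
     (if U = {} then 0 else if p = 0 then 1
      else ennreal (unit_ball_vol p / 2 powr p * enn2real (ediam d U) powr p))"

definition hausdorff_premeasure ::
    "'a set \<Rightarrow> ('a \<Rightarrow> 'a \<Rightarrow> real) \<Rightarrow> real \<Rightarrow> real \<Rightarrow> 'a set \<Rightarrow> ennreal" where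
  "hausdorff_premeasure M d p \<delta> A = Inf {(\<Sum>i. hausdorff_weight d p (U i)) | U :: nat \<Rightarrow> 'a set.
     A \<subseteq> (\<Union>i. U i) \<and> (\<forall>i. U i \<subseteq> M \<and> ediam d (U i) \<le> ennreal \<delta>)}"

definition hausdorff_measure ::
    "'a set \<Rightarrow> ('a \<Rightarrow> 'a \<Rightarrow> real) \<Rightarrow> real \<Rightarrow> 'a set \<Rightarrow> ennreal" where
  "hausdorff_measure M d p A = (SUP \<delta>\<in>{0<..}. hausdorff_premeasure M d p \<delta> A)"

definition hausdorff_dim :: "'a set \<Rightarrow> ('a \<Rightarrow> 'a \<Rightarrow> real) \<Rightarrow> 'a set \<Rightarrow> ennreal" where
  "hausdorff_dim M d A = Inf {ennreal p | p. 0 \<le> p \<and> hausdorff_measure M d p A = 0}"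

definition curve_length :: "('a \<Rightarrow> 'a \<Rightarrow> real) \<Rightarrow> real \<Rightarrow> real \<Rightarrow> (real \<Rightarrow> 'a) \<Rightarrow> ennreal" where
  "curve_length d a b c = Sup {(\<Sum>i<n. ennreal (d (c (t i)) (c (t (Suc i))))) | n (t :: nat \<Rightarrow> real).
     t 0 = a \<and> t n = b \<and> (\<forall>i<n. t i \<le> t (Suc i))}"

end

theory Submission
  imports Defs "HOL-Real_Asymp.Real_Asymp"
begin

text \<open>
  Write \<open>s = sin r\<close> for the distance to the polar axis (\<open>axis_dist\<close>). Both warping functions are
  functions of \<open>s\<close> alone, namely \<open>profile \<beta> a s\<close> with \<open>a = a\<^sub>j\<close> and \<open>a = 0\<close>, and they increase as
  \<open>a\<close> decreases. The distance \<open>dreg a\<close> of the smooth metric therefore increases as \<open>a\<close> decreases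
  and stays below the distance \<open>dsing\<close> of the singular metric; the limit metric is
  \<open>dlim = SUP a. dreg a\<close>. Everything rests on a converse that is uniform in the points:
  \<open>dsing \<le> dreg a + e\<close> for all small \<open>a\<close> (\<open>uniform_comparison\<close>).

  The converse is first proved at a small scale \<open>l\<close> (\<open>local_comparison\<close>). A path of length at most \<open>l\<close>
  either keeps distance at least \<open>l\<close> from the axis, where the two profiles are uniformly close, or
  stays within \<open>3 * l\<close> of the axis. In the second case its length is at least that of the chord with the circle
  factor rescaled by \<open>profile \<beta> a (3 * l)\<close>, whereas the end points can be joined at distance
  \<open>\<delta> * l\<close> from the axis by a path whose length is the chord rescaled by \<open>profile \<beta> 0 (\<delta> * l)\<close>, up to a
  small error (\<open>dsing_near\<close>). The pole of the profile is only logarithmic, so the quotient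
  \<open>profile \<beta> 0 (\<delta> * l) / profile \<beta> 0 (3 * l)\<close> tends to 1 with \<open>l\<close> for fixed \<open>\<delta>\<close>: near
  the axis a fixed change of scale does not affect lengths to leading order. Cutting
  an almost shortest path into pieces of length \<open>l\<close> gives the global comparison. Hence \<open>dreg a\<close> converges
  uniformly to \<open>dlim\<close>, which equals \<open>dsing\<close> on the regular part (\<open>dlim_eq_dsing\<close>) and induces the
  Euclidean topology (\<open>mtopology_dlim\<close>). This gives the convergence, the completion and the
  topology of the limit space.

  Two points of a singular fibre at angle \<open>t\<close> have distance at most
  \<open>2 * \<rho> + profile \<beta> 0 (sin \<rho>) * t\<close> for every \<open>\<rho>\<close> (\<open>fibre_dist_le\<close>). So \<open>n\<close> equal arcs have diameter
  of order \<open>ln n / n\<close>, and the sum of their \<open>p\<close>-th powers vanishes in the limit when \<open>p > 1\<close>. Conversely a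
  distance below \<open>l\<close> is at least \<open>profile \<beta> 0 l\<close> times the Euclidean chord (\<open>fibre_dist_ge\<close>), and
  this factor is unbounded, so length and one-dimensional measure of a fibre are infinite.

  For the volume of the limit space, the density \<open>sin r * profile \<beta> 0 (sin r)\<close> has an elementary
  primitive. On a thin slab \<open>r1 \<le> r \<le> r2\<close> the polar chart is 1-Lipschitz after rescaling its
  axes, and a 1-Lipschitz image of a Euclidean set has Hausdorff measure at most its Lebesgue
  measure (\<open>hausdorff_premeasure_lipschitz_image\<close>, by Vitali covering); this bounds the
  measure from above. From below, a set of small diameter is in the chart nearly a
  Euclidean set with rescaled axes, so the isodiametric inequality (\<open>isodiametric_diag3\<close>) bounds its Riemannian
  volume by its Hausdorff weight. The isodiametric inequality is derived from the Brunn-Minkowski inequality,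
  which passes from the line to products by the one-dimensional Prekopa-Leindler inequality.
\<close>

section \<open>The Brunn-Minkowski and isodiametric inequalities\<close>

lemma measure_scaled_translate:
  fixes X :: "real set"
  assumes "compact X"
  shows "measure lebesgue ((\<lambda>x. (x + c) / 2) ` X) = measure lebesgue X / 2"
    "(\<lambda>x. (x + c) / 2) ` X \<in> lmeasurable"
proof -
  have eq: "(\<lambda>x. (x + c) / 2) ` X = (\<lambda>x. (1/2) *\<^sub>R x + c/2) ` X"
    by (intro image_cong) (auto simp: field_simps)
  show "measure lebesgue ((\<lambda>x. (x + c) / 2) ` X) = measure lebesgue X / 2"
    unfolding eq using measure_lebesgue_affine[of "1/2::real" "c/2" X] by (simp add: add.commute)
  show "(\<lambda>x. (x + c) / 2) ` X \<in> lmeasurable"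
    by (intro lmeasurable_compact compact_continuous_image continuous_intros assms) auto
qed

text \<open>The one-dimensional Brunn-Minkowski inequality: the translates of \<open>A\<close> by the
  smallest element of \<open>B\<close> and of \<open>B\<close> by the largest element of
  \<open>A\<close> meet in a single point, and both lie in \<open>C\<close> after scaling by one
  half.\<close>

lemma midpoint_measure_compact:
  fixes A B C :: "real set"
  assumes A: "compact A" "A \<noteq> {}" and B: "compact B" "B \<noteq> {}" and C: "C \<in> lmeasurable"
    and mid: "\<And>a b. a \<in> A \<Longrightarrow> b \<in> B \<Longrightarrow> (a + b) / 2 \<in> C"
  shows "measure lebesgue A + measure lebesgue B \<le> 2 * measure lebesgue C"
proof -
  obtain a1 where a1: "a1 \<in> A" "\<And>a. a \<in> A \<Longrightarrow> a \<le> a1"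
    using compact_attains_sup[OF A] by blast
  obtain b0 where b0: "b0 \<in> B" "\<And>b. b \<in> B \<Longrightarrow> b0 \<le> b"
    using compact_attains_inf[OF B] by blast
  define X where "X = (\<lambda>x. (x + b0) / 2) ` A"
  define Y where "Y = (\<lambda>x. (x + a1) / 2) ` B"
  have X: "X \<in> lmeasurable" "measure lebesgue X = measure lebesgue A / 2"
    and Y: "Y \<in> lmeasurable" "measure lebesgue Y = measure lebesgue B / 2"
    unfolding X_def Y_def using measure_scaled_translate A B by auto
  have "X \<inter> Y \<subseteq> {(a1 + b0) / 2}"
  proof
    fix x assume "x \<in> X \<inter> Y"
    then obtain a b where "a \<in> A" "b \<in> B" "x = (a + b0) / 2" "x = (b + a1) / 2"
      by (auto simp: X_def Y_def)
    then show "x \<in> {(a1 + b0) / 2}" using a1(2)[of a] b0(2)[of b] by (auto simp: field_simps)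
  qed
  then have "negligible (X \<inter> Y)" by (rule negligible_subset[rotated]) simp
  then have "measure lebesgue (X \<union> Y) = measure lebesgue X + measure lebesgue Y"
    using measure_Un3[OF X(1) Y(1)] negligible_imp_measure0 by auto
  moreover have "X \<union> Y \<subseteq> C"
    using mid[OF a1(1)] mid[OF _ b0(1)] by (auto simp: X_def Y_def add.commute)
  then have "measure lebesgue (X \<union> Y) \<le> measure lebesgue C"
    using X Y C by (intro measure_mono_fmeasurable) auto
  ultimately show ?thesis using X Y by linarith
qed

lemma compact_inner_approx:
  fixes A :: "real set"
  assumes "A \<in> lmeasurable" "bounded A" "A \<noteq> {}" "e > 0"
  obtains K where "compact K" "K \<noteq> {}" "K \<subseteq> A" "measure lebesgue A \<le> measure lebesgue K + e"
proof -
  obtain T where T: "closed T" "T \<subseteq> A" "A - T \<in> lmeasurable" "emeasure lebesgue (A - T) < ennreal e"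
    using sets_lebesgue_inner_closed[OF fmeasurableD[OF assms(1)] assms(4)] by metis
  obtain x where x: "x \<in> A" using assms by auto
  have cT: "compact T" using T assms bounded_subset compact_eq_bounded_closed by blast
  have "measure lebesgue (A - T) < e"
    using T(3,4) assms(4) by (simp add: emeasure_eq_measure2 ennreal_less_iff)
  moreover have "measure lebesgue (A - T) = measure lebesgue A - measure lebesgue T"
    using measurable_measure_Diff[OF assms(1) fmeasurableD[OF lmeasurable_compact[OF cT]] T(2)] .
  moreover have "measure lebesgue T \<le> measure lebesgue (insert x T)"
    using cT by (intro measure_mono_fmeasurable) (auto intro: lmeasurable_compact fmeasurableD)
  ultimately have "measure lebesgue A \<le> measure lebesgue (insert x T) + e" by simp
  then show thesis using that[of "insert x T"] T(2) x cT by auto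
qed

text \<open>Compactness is removed by inner approximation, because the lemma is applied to superlevel
  sets of merely measurable functions.\<close>

lemma midpoint_measure:
  fixes A B C :: "real set"
  assumes A: "A \<in> lmeasurable" "bounded A" "A \<noteq> {}" and B: "B \<in> lmeasurable" "bounded B" "B \<noteq> {}"
    and C: "C \<in> lmeasurable"
    and mid: "\<And>a b. a \<in> A \<Longrightarrow> b \<in> B \<Longrightarrow> (a + b) / 2 \<in> C"
  shows "measure lebesgue A + measure lebesgue B \<le> 2 * measure lebesgue C"
proof (rule field_le_epsilon)
  fix e :: real assume "e > 0"
  then have e: "e / 2 > 0" by simp
  obtain K where K: "compact K" "K \<noteq> {}" "K \<subseteq> A" "measure lebesgue A \<le> measure lebesgue K + e / 2"
    using compact_inner_approx[OF A e] .
  obtain L where L: "compact L" "L \<noteq> {}" "L \<subseteq> B" "measure lebesgue B \<le> measure lebesgue L + e / 2"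
    using compact_inner_approx[OF B e] .
  show "measure lebesgue A + measure lebesgue B \<le> 2 * measure lebesgue C + e"
    using midpoint_measure_compact[OF K(1,2) L(1,2) C] mid K L by (auto simp: subset_iff)
qed

text \<open>Levels are measured relative to \<open>F\<close>. When \<open>F\<close> is the supremum
  of \<open>f\<close> the truncation at 1 has no effect; it is needed for the third function of
  the Prekopa-Leindler inequality, whose supremum is not controlled.\<close>

lemma layer_cake_truncated:
  fixes f :: "real \<Rightarrow> real"
  assumes [measurable]: "f \<in> borel_measurable borel" and F: "F > 0"
  shows "(\<integral>\<^sup>+t\<in>{0<..<1}. emeasure lborel {x. F * t < f x} \<partial>lborel)
    = (\<integral>\<^sup>+x. ennreal (min 1 (f x / F)) \<partial>lborel)"
proof -
  have "(\<integral>\<^sup>+t\<in>{0<..<1}. emeasure lborel {x. F * t < f x} \<partial>lborel)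
    = (\<integral>\<^sup>+t. (\<integral>\<^sup>+x. indicator {0<..<1} t * indicator {x. F * t < f x} x \<partial>lborel) \<partial>lborel)"
    by (intro nn_integral_cong) (simp add: nn_integral_cmult mult.commute)
  also have "\<dots> = (\<integral>\<^sup>+x. (\<integral>\<^sup>+t. indicator {0<..<1} t * indicator {x. F * t < f x} x \<partial>lborel) \<partial>lborel)"
  proof (rule lborel_pair.Fubini')
    have "(\<lambda>p :: real \<times> real. (indicator {p. 0 < snd p \<and> snd p < 1 \<and> F * snd p < f (fst p)} p :: ennreal))
       \<in> borel_measurable (lborel \<Otimes>\<^sub>M lborel)" by measurable
    also have "(\<lambda>p :: real \<times> real. (indicator {p. 0 < snd p \<and> snd p < 1 \<and> F * snd p < f (fst p)} p :: ennreal))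
      = (\<lambda>(x, t). indicator {0<..<1} t * indicator {x. F * t < f x} x)"
      by (auto simp: fun_eq_iff split: split_indicator)
    finally show "(\<lambda>(x, t). (indicator {0<..<1} t * indicator {x. F * t < f x} x :: ennreal))
       \<in> borel_measurable (lborel \<Otimes>\<^sub>M lborel)" .
  qed
  also have "\<dots> = (\<integral>\<^sup>+x. ennreal (min 1 (f x / F)) \<partial>lborel)"
  proof (rule nn_integral_cong)
    fix x
    have "(\<integral>\<^sup>+t. indicator {0<..<1} t * indicator {x. F * t < f x} x \<partial>lborel)
      = (\<integral>\<^sup>+t. indicator {0<..<min 1 (f x / F)} t \<partial>lborel)"
      using F by (intro nn_integral_cong) (auto simp: field_simps split: split_indicator)
    also have "\<dots> = ennreal (min 1 (f x / F))"
      by (cases "min 1 (f x / F) \<ge> 0") (auto simp: ennreal_neg)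
    finally show "(\<integral>\<^sup>+t. indicator {0<..<1} t * indicator {x. F * t < f x} x \<partial>lborel)
      = ennreal (min 1 (f x / F))" .
  qed
  finally show ?thesis .
qed

lemma four_times_product_le_square: "4 * (x * y) \<le> (x + y)\<^sup>2" for x y :: real
  using zero_le_power2[of "x - y"] by (simp add: power2_eq_square algebra_simps)

text \<open>Dividing \<open>f\<close>, \<open>g\<close>, \<open>h\<close> by \<open>F = sup
  f\<close>, \<open>G = sup g\<close> and \<open>H = sqrt (F * G)\<close> makes all superlevel
  sets of \<open>f\<close> and \<open>g\<close> at levels below 1 nonempty, and midpoints of these
  lie in the superlevel set of \<open>h\<close> at the same level. Integrating the one-dimensional
  inequality for these sets over the level gives an additive inequality for the integrals, and the
  inequality of arithmetic and geometric means makes it multiplicative.\<close>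

lemma prekopa_leindler_real:
  fixes f g h :: "real \<Rightarrow> real"
  assumes [measurable]: "f \<in> borel_measurable borel" "g \<in> borel_measurable borel" "h \<in> borel_measurable borel"
    and nn: "\<And>x. 0 \<le> f x" "\<And>x. 0 \<le> g x" "\<And>x. 0 \<le> h x"
    and bd: "\<And>x. f x \<le> b" "\<And>x. g x \<le> b" "\<And>x. h x \<le> b"
    and supp: "\<And>x. R < \<bar>x\<bar> \<Longrightarrow> f x = 0" "\<And>x. R < \<bar>x\<bar> \<Longrightarrow> g x = 0" "\<And>x. R < \<bar>x\<bar> \<Longrightarrow> h x = 0"
    and mid: "\<And>x y. f x * g y \<le> (h ((x + y) / 2))\<^sup>2"
  shows "(LINT x|lborel. f x) * (LINT x|lborel. g x) \<le> (LINT x|lborel. h x)\<^sup>2"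
proof -
  have int: "integrable lborel u" if [measurable]: "u \<in> borel_measurable borel"
    and u: "\<And>x. 0 \<le> u x" "\<And>x. u x \<le> b" "\<And>x. R < \<bar>x\<bar> \<Longrightarrow> u x = 0" for u :: "real \<Rightarrow> real"
  proof (rule Bochner_Integration.integrable_bound)
    show "integrable lborel (\<lambda>x. b * indicator {-R..R} x :: real)"
      by (intro integrable_mult_right integrable_real_indicator) (auto simp: emeasure_lborel_Icc_eq)
    show "AE x in lborel. norm (u x) \<le> norm (b * indicator {-R..R} x)"
    proof (rule AE_I2)
      fix x show "norm (u x) \<le> norm (b * indicator {-R..R} x)"
        using u(1)[of x] u(2)[of x] u(3)[of x] by (cases "R < \<bar>x\<bar>") (auto simp: indicator_def abs_le_iff)
    qed
  qed simp
  define F where "F = (SUP x. f x)"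
  define G where "G = (SUP x. g x)"
  have bdd: "bdd_above (range f)" "bdd_above (range g)" using bd by (auto intro!: bdd_aboveI)
  have leF: "f x \<le> F" "g x \<le> G" for x unfolding F_def G_def by (auto intro!: cSUP_upper bdd)
  then have FG: "0 \<le> F" "0 \<le> G" using nn order.trans by blast+
  show ?thesis
  proof (cases "F = 0 \<or> G = 0")
    case True
    then have "(\<forall>x. f x = 0) \<or> (\<forall>x. g x = 0)" using leF nn by (metis antisym)
    then show ?thesis by auto
  next
    case False
    then have pos: "F > 0" "G > 0" using FG by auto
    define H where "H = sqrt (F * G)"
    have H: "H > 0" "H\<^sup>2 = F * G" using pos by (auto simp: H_def)
    let ?L = "\<lambda>u U t. {x :: real. U * t < u x}"
    \<comment> \<open>The Brunn-Minkowski inequality on the line for the superlevel sets at a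
    common relative level.\<close>
    have lev: "emeasure lborel (?L f F t) + emeasure lborel (?L g G t) \<le> 2 * emeasure lborel (?L h H t)"
      if t: "t \<in> {0<..<1}" for t
    proof -
      have bnd: "bounded (?L u U t) \<and> ?L u U t \<in> lmeasurable \<and>
          emeasure lborel (?L u U t) = ennreal (measure lebesgue (?L u U t))"
        if [measurable]: "u \<in> borel_measurable borel" and u: "\<And>x. R < \<bar>x\<bar> \<Longrightarrow> u x = 0" and U: "U > 0"
        for u :: "real \<Rightarrow> real" and U
      proof -
        have "?L u U t \<subseteq> {-R..R}"
        proof
          fix x assume "x \<in> ?L u U t"
          then have "u x > 0" using U t by (smt (verit) greaterThanLessThan_iff mem_Collect_eq mult_pos_pos)
          then show "x \<in> {-R..R}" using u[of x] by (cases "R < \<bar>x\<bar>") auto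
        qed
        then have b: "bounded (?L u U t)" using bounded_subset bounded_closed_interval by blast
        have m: "?L u U t \<in> sets borel" by measurable
        then have "?L u U t \<in> lmeasurable" by (intro bounded_set_imp_lmeasurable b) simp
        then show ?thesis using b m emeasure_bounded_finite[OF b]
            by (simp add: emeasure_eq_ennreal_measure less_top[symmetric])
      qed
      have "F * t < F" "G * t < G" using t pos by auto
      then have ne: "?L f F t \<noteq> {}" "?L g G t \<noteq> {}"
        unfolding F_def G_def using less_cSUP_iff[OF _ bdd(1)] less_cSUP_iff[OF _ bdd(2)] by auto
      have "(a + b') / 2 \<in> ?L h H t" if "a \<in> ?L f F t" "b' \<in> ?L g G t" for a b'
      proof -
        have FGt: "0 < F * t" "0 < G * t" using t pos by auto
        have "(H * t)\<^sup>2 = (F * t) * (G * t)" using H by (simp add: power2_eq_square algebra_simps)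
        also have "(F * t) * (G * t) < f a * g b'" using that FGt by (intro mult_strict_mono) auto
        also have "\<dots> \<le> (h ((a + b') / 2))\<^sup>2" by (rule mid)
        finally show ?thesis using power2_less_imp_less nn(3) by blast
      qed
      then have "measure lebesgue (?L f F t) + measure lebesgue (?L g G t) \<le> 2 * measure lebesgue (?L h H t)"
        using bnd[of f F] bnd[of g G] bnd[of h H] supp pos H ne by (intro midpoint_measure) auto
      then show ?thesis
        using bnd[of f F] bnd[of g G] bnd[of h H] supp pos H
        by (simp add: ennreal_plus[symmetric] ennreal_mult'[symmetric] ennreal_numeral[symmetric]
            del: ennreal_plus ennreal_numeral)
    qed
    have *: "(\<integral>\<^sup>+x. ennreal (u x / U) \<partial>lborel) = ennreal ((LINT x|lborel. u x) / U)"
      if "integrable lborel u" "\<And>x. 0 \<le> u x" "U > 0" for u U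
      using that by (subst nn_integral_eq_integral) auto
    have [measurable]: "(\<lambda>t. emeasure lborel (?L u U t)) \<in> borel_measurable lborel"
      if [measurable]: "u \<in> borel_measurable borel" for u and U :: real
    proof -
      have "{p \<in> space (lborel \<Otimes>\<^sub>M lborel). U * fst p < u (snd p)} \<in> sets (lborel \<Otimes>\<^sub>M lborel :: (real \<times> real) measure)"
        by measurable
      then have "{p. U * fst p < u (snd p)} \<in> sets (lborel \<Otimes>\<^sub>M lborel :: (real \<times> real) measure)"
        by (simp add: space_pair_measure)
      then show ?thesis
        using lborel.measurable_emeasure_Pair[of "{p. U * fst p < u (snd p)}"] by (simp add: vimage_def)
    qed
    have ints: "integrable lborel f" "integrable lborel g" "integrable lborel h"
      using int[OF assms(1) nn(1) bd(1) supp(1)] int[OF assms(2) nn(2) bd(2) supp(2)]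
        int[OF assms(3) nn(3) bd(3) supp(3)] by simp_all
    have layer: "(\<integral>\<^sup>+t\<in>{0<..<1}. emeasure lborel (?L f F t) \<partial>lborel) = (\<integral>\<^sup>+x. ennreal (f x / F) \<partial>lborel)"
      "(\<integral>\<^sup>+t\<in>{0<..<1}. emeasure lborel (?L g G t) \<partial>lborel) = (\<integral>\<^sup>+x. ennreal (g x / G) \<partial>lborel)"
      unfolding layer_cake_truncated[OF assms(1) pos(1)] layer_cake_truncated[OF assms(2) pos(2)]
      using leF pos by (intro nn_integral_cong arg_cong[where f = ennreal] min_absorb2; simp add: divide_le_eq_1)+
    have "ennreal ((LINT x|lborel. f x) / F) + ennreal ((LINT x|lborel. g x) / G)
      = (\<integral>\<^sup>+t\<in>{0<..<1}. emeasure lborel (?L f F t) \<partial>lborel) + (\<integral>\<^sup>+t\<in>{0<..<1}. emeasure lborel (?L g G t) \<partial>lborel)"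
      unfolding layer *[OF ints(1) nn(1) pos(1)] *[OF ints(2) nn(2) pos(2)] ..
    also have "\<dots> = (\<integral>\<^sup>+t\<in>{0<..<1}. (emeasure lborel (?L f F t) + emeasure lborel (?L g G t)) \<partial>lborel)"
      by (subst nn_integral_add[symmetric]) (auto simp: distrib_right)
    also have "\<dots> \<le> (\<integral>\<^sup>+t\<in>{0<..<1}. (2 * emeasure lborel (?L h H t)) \<partial>lborel)"
      using lev by (intro nn_integral_mono) (auto split: split_indicator)
    also have "\<dots> = 2 * (\<integral>\<^sup>+x. ennreal (min 1 (h x / H)) \<partial>lborel)"
      using H by (simp add: nn_integral_cmult mult.assoc layer_cake_truncated)
    also have "\<dots> \<le> 2 * (\<integral>\<^sup>+x. ennreal (h x / H) \<partial>lborel)"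
      by (intro mult_left_mono nn_integral_mono ennreal_leI) auto
    also have "\<dots> = 2 * ennreal ((LINT x|lborel. h x) / H)"
      unfolding *[OF ints(3) nn(3) H(1)] ..
    finally have key: "(LINT x|lborel. f x) / F + (LINT x|lborel. g x) / G \<le> 2 * ((LINT x|lborel. h x) / H)"
      using pos H nn by (simp add: ennreal_plus[symmetric] ennreal_mult'[symmetric] ennreal_numeral[symmetric] ennreal_le_iff
            del: ennreal_plus ennreal_numeral)
    have nnI: "0 \<le> (LINT x|lborel. f x)" "0 \<le> (LINT x|lborel. g x)" "0 \<le> (LINT x|lborel. h x)"
      using nn by auto
    have "4 * ((LINT x|lborel. f x) / F * ((LINT x|lborel. g x) / G)) \<le> (2 * ((LINT x|lborel. h x) / H))\<^sup>2"
      using four_times_product_le_square power_mono[OF key, of 2] nnI pos by (meson add_nonneg_nonneg divide_nonneg_pos order_trans)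
    also have "\<dots> = 4 * ((LINT x|lborel. h x)\<^sup>2 / (F * G))"
      by (simp add: power_divide power_mult_distrib H)
    finally show ?thesis using pos by (simp add: field_simps)
  qed
qed

text \<open>The multiplicative form for midpoint sets. Unlike the additive form with
  \<open>n\<close>-th roots it does not mention the dimension, and it has the shape of the
  hypothesis of the Prekopa-Leindler inequality for the measures of slices, so it passes to
  products.\<close>

definition brunn_minkowski_on :: "'a::euclidean_space itself \<Rightarrow> bool" where
  "brunn_minkowski_on T \<longleftrightarrow> (\<forall>K L :: 'a set. compact K \<longrightarrow> compact L \<longrightarrow>
     measure lborel K * measure lborel L \<le> (measure lborel ((\<lambda>(x, y). (1/2) *\<^sub>R (x + y)) ` (K \<times> L)))\<^sup>2)"

lemma compact_midpoints:
  fixes K L :: "'a::real_normed_vector set"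
  assumes "compact K" "compact L"
  shows "compact ((\<lambda>(x, y). (1/2) *\<^sub>R (x + y)) ` (K \<times> L))"
  by (intro compact_continuous_image compact_Times assms)
     (auto simp: case_prod_unfold intro!: continuous_intros)

lemma brunn_minkowski_real: "brunn_minkowski_on TYPE(real)"
  unfolding brunn_minkowski_on_def
proof (intro allI impI)
  fix K L :: "real set" assume K: "compact K" and L: "compact L"
  let ?H = "(\<lambda>(x, y). (1/2) *\<^sub>R (x + y)) ` (K \<times> L)"
  note H = compact_midpoints[OF K L]
  have eq: "measure lborel A = measure lebesgue A" if "compact A" for A :: "real set"
    using that by (simp add: borel_compact)
  show "measure lborel K * measure lborel L \<le> (measure lborel ?H)\<^sup>2"
  proof (cases "K = {} \<or> L = {}")
    case False
    then have 1: "measure lborel K + measure lborel L \<le> 2 * measure lborel ?H"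
      unfolding eq[OF K] eq[OF L] eq[OF H]
      by (intro midpoint_measure_compact K L lmeasurable_compact H) force+
    from four_times_product_le_square[of "measure lborel K" "measure lborel L"] power_mono[OF 1, of 2]
    show ?thesis by (simp add: power_mult_distrib)
  qed auto
qed

text \<open>The measures of the slices of a compact set satisfy all regularity hypotheses of
  \<open>prekopa_leindler_real\<close>.\<close>

lemma slice_measure:
  fixes K :: "(real \<times> 'a::euclidean_space) set"
  assumes K: "compact K"
  shows "(\<lambda>x. measure lborel (Pair x -` K)) \<in> borel_measurable borel"
    "(LINT x|lborel. measure lborel (Pair x -` K)) = measure lborel K"
    "\<And>x. compact (Pair x -` K)"
    "\<exists>b. \<forall>x. measure lborel (Pair x -` K) \<le> b"
    "\<exists>R. \<forall>x. R < \<bar>x\<bar> \<longrightarrow> measure lborel (Pair x -` K) = 0"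
proof -
  have m: "K \<in> sets (lborel \<Otimes>\<^sub>M lborel)" using K by (metis borel_compact lborel_prod sets_lborel)
  have sl: "Pair x -` K = snd ` (K \<inter> ({x} \<times> UNIV))" for x by force
  show c: "compact (Pair x -` K)" for x
    unfolding sl by (intro compact_continuous_image continuous_intros compact_Int_closed K closed_Times)
  have fin: "emeasure lborel (Pair x -` K) = ennreal (measure lborel (Pair x -` K))" for x
    using emeasure_eq_ennreal_measure[of lborel] emeasure_compact_finite[OF c[of x]] by (simp add: less_top)
  have meas: "(\<lambda>x. emeasure lborel (Pair x -` K)) \<in> borel_measurable borel"
    using lborel.measurable_emeasure_Pair[OF m] by simp
  show m': "(\<lambda>x. measure lborel (Pair x -` K)) \<in> borel_measurable borel"
    unfolding measure_def using meas by measurable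
  have "emeasure lborel K = (\<integral>\<^sup>+x. ennreal (measure lborel (Pair x -` K)) \<partial>lborel)"
    using lborel.emeasure_pair_measure_alt[OF m] by (simp add: lborel_prod fin)
  then show "(LINT x|lborel. measure lborel (Pair x -` K)) = measure lborel K"
    using m' by (subst integral_eq_nn_integral) (auto simp: measure_def)
  have "measure lborel (Pair x -` K) \<le> measure lborel (snd ` K)" for x
  proof (rule measure_mono_fmeasurable)
    show "snd ` K \<in> fmeasurable lborel"
      using compact_continuous_image[OF _ K, of snd] continuous_on_snd[OF continuous_on_id]
      by (intro fmeasurable_compact) auto
    show "Pair x -` K \<subseteq> snd ` K" by (rule subsetI) (metis image_iff snd_conv vimageE)
    show "Pair x -` K \<in> sets lborel" using borel_compact[OF c[of x]] by simp
  qed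
  then show "\<exists>b. \<forall>x. measure lborel (Pair x -` K) \<le> b" by blast
  obtain R where R: "\<And>p. p \<in> K \<Longrightarrow> norm p \<le> R" using compact_imp_bounded[OF K] bounded_iff by metis
  have "Pair x -` K = {}" if "R < \<bar>x\<bar>" for x
  proof -
    have "False" if "(x, y) \<in> K" for y
      using order_trans[OF norm_fst_le R[OF that]] \<open>R < \<bar>x\<bar>\<close> by auto
    then show ?thesis by auto
  qed
  then show "\<exists>R. \<forall>x. R < \<bar>x\<bar> \<longrightarrow> measure lborel (Pair x -` K) = 0" by (intro exI[of _ R]) auto
qed

text \<open>The midpoints of a slice of \<open>K\<close> at \<open>x\<close> and a slice of
  \<open>L\<close> at \<open>y\<close> lie in the slice of the midpoint set at \<open>(x + y) /
  2\<close>. So the inequality for the slices is the hypothesis of the Prekopa-Leindler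
  inequality, and the integrals of the slice measures are the measures of the sets.\<close>

lemma brunn_minkowski_prod:
  assumes "brunn_minkowski_on TYPE('a::euclidean_space)"
  shows "brunn_minkowski_on TYPE(real \<times> 'a)"
  unfolding brunn_minkowski_on_def
proof (intro allI impI)
  fix K L :: "(real \<times> 'a) set" assume K: "compact K" and L: "compact L"
  let ?m = "\<lambda>(x, y). (1/2) *\<^sub>R (x + y)"
  let ?H = "(\<lambda>(x, y). (1/2) *\<^sub>R (x + y)) ` (K \<times> L)"
  note H = compact_midpoints[OF K L]
  let ?s = "\<lambda>A x. measure lborel (Pair x -` A)"
  note k = slice_measure[OF K] and l = slice_measure[OF L] and h = slice_measure[OF H]
  obtain b1 b2 b3 where b: "\<And>x. ?s K x \<le> b1" "\<And>x. ?s L x \<le> b2" "\<And>x. ?s ?H x \<le> b3"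
    using k(4) l(4) h(4) by blast
  obtain R1 R2 R3 where R: "\<And>x. R1 < \<bar>x\<bar> \<Longrightarrow> ?s K x = 0" "\<And>x. R2 < \<bar>x\<bar> \<Longrightarrow> ?s L x = 0"
     "\<And>x. R3 < \<bar>x\<bar> \<Longrightarrow> ?s ?H x = 0"
    using k(5) l(5) h(5) by blast
  have mid: "?s K x * ?s L y \<le> (?s ?H ((x + y) / 2))\<^sup>2" for x y
  proof -
    have "?s K x * ?s L y \<le> (measure lborel (?m ` ((Pair x -` K) \<times> (Pair y -` L))))\<^sup>2"
      using assms k(3)[of x] l(3)[of y] unfolding brunn_minkowski_on_def by blast
    also have "\<dots> \<le> (?s ?H ((x + y) / 2))\<^sup>2"
    proof (intro power_mono measure_mono_fmeasurable)
      show "?m ` ((Pair x -` K) \<times> (Pair y -` L)) \<subseteq> Pair ((x + y) / 2) -` ?H"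
        by (force simp: image_iff)
      show "?m ` ((Pair x -` K) \<times> (Pair y -` L)) \<in> sets lborel"
        using compact_midpoints[OF k(3)[of x] l(3)[of y]] by (simp add: borel_compact)
      show "Pair ((x + y) / 2) -` ?H \<in> fmeasurable lborel"
        using h(3) by (rule fmeasurable_compact)
    qed simp
    finally show ?thesis .
  qed
  have "(LINT x|lborel. ?s K x) * (LINT x|lborel. ?s L x) \<le> (LINT x|lborel. ?s ?H x)\<^sup>2"
  proof (rule prekopa_leindler_real[where b = "max b1 (max b2 b3)" and R = "max R1 (max R2 R3)"])
    fix x show "?s K x \<le> max b1 (max b2 b3)" "?s L x \<le> max b1 (max b2 b3)" "?s ?H x \<le> max b1 (max b2 b3)"
      using b[of x] by linarith+
    show "(?s K x) * (?s L y) \<le> (?s ?H ((x + y) / 2))\<^sup>2" for y by (rule mid)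
    assume "max R1 (max R2 R3) < \<bar>x\<bar>"
    then show "?s K x = 0" "?s L x = 0" "?s ?H x = 0"
      using R[of x] by simp_all
  qed (simp_all only: k(1) l(1) h(1) measure_nonneg)
  then show "measure lborel K * measure lborel L \<le> (measure lborel ?H)\<^sup>2"
    unfolding k(2) l(2) h(2) .
qed

lemma brunn_minkowski_3d: "brunn_minkowski_on TYPE(real \<times> real \<times> real)"
  by (rule brunn_minkowski_prod[OF brunn_minkowski_prod[OF brunn_minkowski_real]])

definition diag3 :: "real \<Rightarrow> real \<Rightarrow> real \<times> real \<times> real \<Rightarrow> real \<times> real \<times> real" where
  "diag3 s f = (\<lambda>(r, x, y). (r, s * x, f * y))"

lemma continuous_on_diag3: "continuous_on A (diag3 s f)"
  unfolding diag3_def case_prod_unfold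
  by (intro continuous_on_Pair continuous_on_fst continuous_on_snd continuous_on_mult continuous_on_const continuous_on_id)

lemma measure_diag3:
  assumes "compact C" "s > 0" "f > 0"
  shows "measure lborel (diag3 s f ` C) = s * f * measure lborel C"
proof -
  define c :: "real \<times> real \<times> real \<Rightarrow> real" where "c = (\<lambda>b. 1 * fst b + s * fst (snd b) + f * snd (snd b))"
  have B: "(Basis :: (real \<times> real \<times> real) set) = {(1, 0), (0, (1, 0)), (0, (0, 1))}"
    unfolding Basis_prod_def Basis_real_def by (simp add: insert_commute)
  have T: "(0 + (\<Sum>j\<in>Basis. (c j * (x \<bullet> j)) *\<^sub>R j)) = diag3 s f x" for x
    by (cases x) (simp add: B c_def diag3_def)
  have "lborel = density (distr lborel borel (\<lambda>x. 0 + (\<Sum>j\<in>Basis. (c j * (x \<bullet> j)) *\<^sub>R j))) (\<lambda>_. (\<Prod>j\<in>Basis. \<bar>c j\<bar>))"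
    using assms by (intro lborel_affine_euclidean) (auto simp: B c_def)
  also have "(\<lambda>x. 0 + (\<Sum>j\<in>Basis. (c j * (x \<bullet> j)) *\<^sub>R j)) = diag3 s f" using T by auto
  also have "(\<Prod>j\<in>Basis. \<bar>c j\<bar>) = s * f" using assms by (simp add: B c_def)
  finally have L: "lborel = density (distr lborel borel (diag3 s f)) (\<lambda>_. ennreal (s * f))" .
  have [measurable]: "diag3 s f \<in> borel_measurable borel"
    by (rule borel_measurable_continuous_onI[OF continuous_on_diag3])
  have cI: "compact (diag3 s f ` C)"
    by (intro compact_continuous_image continuous_on_diag3 assms)
  have inj: "diag3 s f -` (diag3 s f ` C) = C" using assms by (auto simp: diag3_def)
  have "emeasure lborel (diag3 s f ` C) = emeasure (density (distr lborel borel (diag3 s f)) (\<lambda>_. ennreal (s * f))) (diag3 s f ` C)"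
    by (rule arg_cong[OF L])
  also have "\<dots> = ennreal (s * f) * emeasure lborel C"
    using borel_compact[OF cI] inj by (simp add: emeasure_density nn_integral_cmult emeasure_distr)
  finally show ?thesis using assms by (simp add: measure_def enn2real_mult)
qed

text \<open>Let \<open>K\<close> be the image of \<open>C\<close>. The midpoints of \<open>K\<close>
  and \<open>- K\<close> are halved differences of points of \<open>K\<close>, so they lie in the
  ball of radius \<open>d / 2\<close>; by Brunn-Minkowski their measure is at least that of
  \<open>K\<close>.\<close>

lemma isodiametric_diag3:
  fixes C :: "(real \<times> real \<times> real) set"
  assumes C: "compact C" and s: "s > 0" "f > 0" and d: "0 \<le> d"
    and diam: "\<And>x y. x \<in> C \<Longrightarrow> y \<in> C \<Longrightarrow> norm (diag3 s f (x - y)) \<le> d"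
  shows "s * f * measure lborel C \<le> unit_ball_vol 3 * (d / 2) ^ 3"
proof -
  define K where "K = diag3 s f ` C"
  have K: "compact K" unfolding K_def
    by (intro compact_continuous_image continuous_on_diag3 C)
  define L where "L = uminus ` K"
  have L: "compact L" unfolding L_def by (intro compact_negations K)
  let ?H = "(\<lambda>(x, y). (1/2) *\<^sub>R (x + y)) ` (K \<times> L)"
  have "measure lborel L = measure lborel K"
    using measure_lebesgue_affine[of "-1" 0 K] K L
    by (simp add: L_def borel_compact image_image)
  then have "(measure lborel K)\<^sup>2 \<le> (measure lborel ?H)\<^sup>2"
    using brunn_minkowski_3d K L unfolding brunn_minkowski_on_def by (metis power2_eq_square)
  then have "measure lborel K \<le> measure lborel ?H" by (rule power2_le_imp_le) simp
  also have "\<dots> \<le> measure lborel (cball (0 :: real \<times> real \<times> real) (d / 2))"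
  proof (rule measure_mono_fmeasurable)
    show "?H \<subseteq> cball 0 (d / 2)"
    proof
      fix z assume "z \<in> ?H"
      then obtain x y where xy: "x \<in> C" "y \<in> C" "z = (1/2) *\<^sub>R (diag3 s f x - diag3 s f y)"
        by (auto simp: K_def L_def)
      have "diag3 s f x - diag3 s f y = diag3 s f (x - y)"
        by (cases x; cases y) (simp add: diag3_def algebra_simps)
      then show "z \<in> cball 0 (d / 2)" using diam[OF xy(1,2)] xy(3) by simp
    qed
    show "?H \<in> sets lborel" using borel_compact[OF compact_midpoints[OF K L]] by simp
    show "cball (0 :: real \<times> real \<times> real) (d / 2) \<in> fmeasurable lborel"
      by (rule fmeasurable_compact[OF compact_cball])
  qed
  also have "\<dots> = unit_ball_vol 3 * (d / 2) ^ 3"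
    using d by (subst content_cball) (auto simp: power3_eq_cube)
  finally show ?thesis unfolding K_def measure_diag3[OF C s] .
qed

section \<open>Hausdorff premeasures\<close>

lemma hausdorff_premeasure_le:
  assumes "A \<subseteq> (\<Union>i. U i)" "\<And>i. U i \<subseteq> M" "\<And>i. ediam d (U i) \<le> ennreal \<delta>"
  shows "hausdorff_premeasure M d p \<delta> A \<le> (\<Sum>i. hausdorff_weight d p (U i))"
  unfolding hausdorff_premeasure_def using assms by (intro Inf_lower) blast

lemma hausdorff_premeasure_mono: "A \<subseteq> B \<Longrightarrow> hausdorff_premeasure M d p \<delta> A \<le> hausdorff_premeasure M d p \<delta> B"
  unfolding hausdorff_premeasure_def by (intro Inf_superset_mono) blast

lemma ediam_empty [simp]: "ediam d {} = 0"
  by (simp add: ediam_def bot_ennreal)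

lemma hausdorff_weight_empty [simp]: "hausdorff_weight d p {} = 0"
  by (simp add: hausdorff_weight_def)

lemma hausdorff_premeasure_countable_subadditive:
  "hausdorff_premeasure M d p \<delta> (\<Union>n. A n) \<le> (\<Sum>n::nat. hausdorff_premeasure M d p \<delta> (A n))"
proof (rule ennreal_le_epsilon)
  let ?H = "hausdorff_premeasure M d p \<delta>" and ?w = "hausdorff_weight d p"
  fix e :: real assume e: "0 < e" and fin: "(\<Sum>n. ?H (A n)) < top"
  have "\<exists>U. A n \<subseteq> (\<Union>i. U i) \<and> (\<forall>i. U i \<subseteq> M \<and> ediam d (U i) \<le> ennreal \<delta>) \<and>
      (\<Sum>i::nat. ?w (U i)) < ?H (A n) + ennreal (e * (1/2) ^ Suc n)" for n
  proof -
    have "?H (A n) \<noteq> \<infinity>" using fin ennreal_suminf_lessD[OF fin, of n] by auto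
    then have "?H (A n) < ?H (A n) + ennreal (e * (1/2) ^ Suc n)"
      using e by (simp add: ennreal_zero_less_mult_iff less_top[symmetric])
    then show ?thesis
      unfolding hausdorff_premeasure_def by (subst (asm) Inf_less_iff) blast
  qed
  then obtain U where U: "\<And>n. A n \<subseteq> (\<Union>i. U n i)" "\<And>n i. U n i \<subseteq> M"
      "\<And>n i. ediam d (U n i) \<le> ennreal \<delta>"
      "\<And>n. (\<Sum>i::nat. ?w (U n i)) < ?H (A n) + ennreal (e * (1/2) ^ Suc n)"
    by metis
  define V where "V = (\<lambda>k. case prod_decode k of (n, i) \<Rightarrow> U n i)"
  have "(\<Union>n. A n) \<subseteq> (\<Union>k. V k)"
  proof
    fix x assume "x \<in> (\<Union>n. A n)"
    then obtain n i where "x \<in> U n i" using U(1) by blast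
    then have "x \<in> V (prod_encode (n, i))" by (simp add: V_def)
    then show "x \<in> (\<Union>k. V k)" by blast
  qed
  then have "?H (\<Union>n. A n) \<le> (\<Sum>k. ?w (V k))"
    using U(2,3) by (intro hausdorff_premeasure_le) (auto simp: V_def split: prod.split)
  also have "\<dots> = (\<Sum>k. (case prod_decode k of (n, i) \<Rightarrow> ?w (U n i)))"
    by (simp add: V_def case_prod_unfold)
  also have "\<dots> = (\<Sum>n. \<Sum>i. ?w (U n i))"
    using suminf_ennreal_2dimen[of "\<lambda>n. \<Sum>i. ?w (U n i)" "\<lambda>(n, i). ?w (U n i)"] by simp
  also have "\<dots> \<le> (\<Sum>n. ?H (A n) + ennreal (e * (1/2) ^ Suc n))"
    using U(4) by (intro suminf_le) (auto intro: less_imp_le)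
  also have "\<dots> = (\<Sum>n. ?H (A n)) + (\<Sum>n. ennreal (e * (1/2) ^ Suc n))"
    by (rule suminf_add[symmetric]) auto
  also have "(\<Sum>n. ennreal (e * (1/2) ^ Suc n)) = ennreal e"
    using e sums_mult[OF power_half_series, of e]
    by (intro suminf_ennreal_eq) auto
  finally show "?H (\<Union>n. A n) \<le> (\<Sum>n. ?H (A n)) + ennreal e" .
qed

lemma hausdorff_premeasure_empty: "hausdorff_premeasure M d p \<delta> {} = 0"
  using hausdorff_premeasure_le[of "{}" "\<lambda>_. {}" M d \<delta> p] by simp

lemma hausdorff_premeasure_Un:
  "hausdorff_premeasure M d p \<delta> (A \<union> B) \<le> hausdorff_premeasure M d p \<delta> A + hausdorff_premeasure M d p \<delta> B"
proof -
  let ?A = "\<lambda>n::nat. if n = 0 then A else if n = 1 then B else {}"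
  have "A \<union> B = (\<Union>n. ?A n)" by (auto split: if_splits)
  then have "hausdorff_premeasure M d p \<delta> (A \<union> B) \<le> (\<Sum>n. hausdorff_premeasure M d p \<delta> (?A n))"
    using hausdorff_premeasure_countable_subadditive[of M d p \<delta> ?A] by simp
  also have "\<dots> = (\<Sum>n\<in>{0, 1::nat}. hausdorff_premeasure M d p \<delta> (?A n))"
    by (intro suminf_finite) (auto simp: hausdorff_premeasure_empty)
  finally show ?thesis by simp
qed

lemma ediam_leI:
  assumes "\<And>x y. x \<in> U \<Longrightarrow> y \<in> U \<Longrightarrow> d x y \<le> D"
  shows "ediam d U \<le> ennreal D"
  unfolding ediam_def using assms by (intro SUP_least ennreal_leI) auto

lemma hausdorff_weight_le:
  assumes "ediam d U \<le> ennreal D" "0 \<le> D" "0 < p"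
  shows "hausdorff_weight d p U \<le> ennreal (unit_ball_vol p / 2 powr p * D powr p)"
proof -
  have "enn2real (ediam d U) \<le> D" using assms by (intro enn2real_leI)
  then have "unit_ball_vol p / 2 powr p * enn2real (ediam d U) powr p \<le> unit_ball_vol p / 2 powr p * D powr p"
    using assms(3) by (intro mult_left_mono powr_mono2) auto
  then show ?thesis using assms(3) by (simp add: hausdorff_weight_def ennreal_leI)
qed

lemma dist_le_hausdorff_diam:
  assumes "ediam d U \<le> ennreal \<delta>" "x \<in> U" "y \<in> U"
  shows "d x y \<le> enn2real (ediam d U)"
proof -
  have "ennreal (d x y) \<le> ediam d U" unfolding ediam_def using assms by (meson SUP_upper2 order_refl)
  also have "ediam d U = ennreal (enn2real (ediam d U))"
    using assms(1) by (intro ennreal_enn2real[symmetric]) (auto simp: less_top intro: le_less_trans)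
  finally show ?thesis by (simp add: ennreal_le_iff)
qed

text \<open>The common step of the two applications of Vitali covering below: the images of the balls
  enlarged by \<open>m\<close> cover, and their weights are \<open>m\<^sup>n\<close> times the
  volumes of the disjoint balls.\<close>

lemma hausdorff_premeasure_disjoint_balls:
  fixes E V :: "'a::euclidean_space set" and C :: "('a \<times> real) set"
  assumes C: "countable C" "disjoint_family_on (\<lambda>(a, r). cball a r) C"
    and r: "\<And>a r. (a, r) \<in> C \<Longrightarrow> 0 < r \<and> cball a r \<subseteq> V \<and> 2 * m * r \<le> \<delta>"
    and V: "V \<in> sets borel" and m: "0 < m" and E: "E \<subseteq> (\<Union>(a, r)\<in>C. cball a (m * r))"
    and G: "\<And>x. x \<in> E \<Longrightarrow> G x \<in> M" "\<And>x y. x \<in> E \<Longrightarrow> y \<in> E \<Longrightarrow> d (G x) (G y) \<le> dist x y"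
  shows "hausdorff_premeasure M d DIM('a) \<delta> (G ` E) \<le> ennreal (m ^ DIM('a)) * emeasure lborel V"
proof (cases "C = {}")
  case True
  then show ?thesis using E by (simp add: hausdorff_premeasure_empty)
next
  case False
  let ?n = "DIM('a)"
  \<comment> \<open>An enumeration of \<open>C\<close> along the natural numbers, padded with
  empty sets when \<open>C\<close> is finite.\<close>
  define I where "I = to_nat_on C ` C"
  define c where "c = from_nat_into C"
  have c: "c i \<in> C" for i unfolding c_def by (rule from_nat_into[OF False])
  have inj: "inj_on c I"
    unfolding I_def c_def by (auto simp: inj_on_def C(1))
  define B where "B = (\<lambda>i. if i \<in> I then cball (fst (c i)) (snd (c i)) else {})"
  define U where "U = (\<lambda>i. if i \<in> I then G ` (E \<inter> cball (fst (c i)) (m * snd (c i))) else {})"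
  have rc: "0 < snd (c i)" "cball (fst (c i)) (snd (c i)) \<subseteq> V" "2 * m * snd (c i) \<le> \<delta>" for i
    using r[of "fst (c i)" "snd (c i)"] c[of i] by auto
  have diam: "ediam d (U i) \<le> ennreal (2 * m * snd (c i))" for i
  proof (rule ediam_leI)
    fix x y assume "x \<in> U i" "y \<in> U i"
    then obtain u v where uv: "u \<in> E" "v \<in> E" "dist (fst (c i)) u \<le> m * snd (c i)" "dist (fst (c i)) v \<le> m * snd (c i)"
       "x = G u" "y = G v" by (auto simp: U_def split: if_splits)
    then show "d x y \<le> 2 * m * snd (c i)"
      using G(2)[of u v] dist_triangle3[of u v "fst (c i)"] by auto
  qed
  have "hausdorff_premeasure M d ?n \<delta> (G ` E) \<le> (\<Sum>i. hausdorff_weight d ?n (U i))"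
  proof (rule hausdorff_premeasure_le)
    show "G ` E \<subseteq> (\<Union>i. U i)"
    proof clarify
      fix x assume "x \<in> E"
      then obtain q where q: "q \<in> C" "x \<in> cball (fst q) (m * snd q)" using E by fastforce
      then have "G x \<in> U (to_nat_on C q)"
        using \<open>x \<in> E\<close> by (auto simp: U_def I_def c_def C(1))
      then show "G x \<in> (\<Union>i. U i)" by blast
    qed
    show "U i \<subseteq> M" for i using G(1) by (auto simp: U_def)
    show "ediam d (U i) \<le> ennreal \<delta>" for i
      using diam[of i] ennreal_leI[OF rc(3)[of i]] by (rule order_trans)
  qed
  also have "\<dots> \<le> (\<Sum>i. ennreal (m ^ ?n) * emeasure lborel (B i))"
  proof (intro suminf_le)
    fix i
    show "hausdorff_weight d ?n (U i) \<le> ennreal (m ^ ?n) * emeasure lborel (B i)"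
    proof (cases "i \<in> I")
      case True
      have "hausdorff_weight d ?n (U i) \<le> ennreal (unit_ball_vol ?n / 2 powr ?n * (2 * m * snd (c i)) powr ?n)"
        using rc(1)[of i] m by (intro hausdorff_weight_le[OF diam]) auto
      also have "unit_ball_vol ?n / 2 powr ?n * (2 * m * snd (c i)) powr ?n = m ^ ?n * (unit_ball_vol ?n * snd (c i) ^ ?n)"
        using rc(1)[of i] m by (simp add: powr_realpow power_mult_distrib)
      also have "ennreal \<dots> = ennreal (m ^ ?n) * emeasure lborel (B i)"
        using True rc(1)[of i] m by (simp add: B_def emeasure_cball ennreal_mult)
      finally show ?thesis .
    qed (simp add: U_def)
  qed auto
  also have "\<dots> = ennreal (m ^ ?n) * (\<Sum>i. emeasure lborel (B i))" by simp
  also have "(\<Sum>i. emeasure lborel (B i)) = emeasure lborel (\<Union>i. B i)"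
  proof (rule suminf_emeasure)
    show "disjoint_family B"
      unfolding disjoint_family_on_def
    proof (intro ballI impI)
      fix i j :: nat assume "i \<noteq> j"
      then have "i \<in> I \<Longrightarrow> j \<in> I \<Longrightarrow> c i \<noteq> c j" using inj by (auto simp: inj_on_def)
      then show "B i \<inter> B j = {}"
        using C(2) c[of i] c[of j] unfolding disjoint_family_on_def B_def case_prod_unfold by auto
    qed
  qed (auto simp: B_def)
  also have "\<dots> \<le> emeasure lborel V"
    using rc(2) V by (intro emeasure_mono) (auto simp: B_def split: if_splits)
  finally show ?thesis by (simp add: mult_left_mono)
qed

text \<open>Covering \<open>E\<close> by disjoint balls inside an open set of almost the same measure
  loses only a null set (Vitali's covering theorem). Images of null sets have premeasure zero by
  the covering lemma, which covers everything after enlarging the balls five times.\<close>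

lemma hausdorff_premeasure_lipschitz_image:
  fixes E :: "'a::euclidean_space set"
  assumes \<delta>: "0 < \<delta>" and E: "E \<in> sets lebesgue"
    and G: "\<And>x. x \<in> E \<Longrightarrow> G x \<in> M" "\<And>x y. x \<in> E \<Longrightarrow> y \<in> E \<Longrightarrow> d (G x) (G y) \<le> dist x y"
  shows "hausdorff_premeasure M d DIM('a) \<delta> (G ` E) \<le> emeasure lebesgue E"
proof -
  let ?H = "\<lambda>X. hausdorff_premeasure M d DIM('a) \<delta> (G ` X)"
  let ?K = "\<lambda>V m. {(a :: 'a, r :: real). 0 < r \<and> cball a r \<subseteq> V \<and> 2 * m * r \<le> \<delta>}"
  have small: "\<exists>i. i \<in> ?K V m \<and> x \<in> cball (fst i) (snd i) \<and> snd i < e"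
    if "open V" "x \<in> V" "0 < e" "0 < m" for V m x e
  proof -
    obtain s where s: "s > 0" "cball x s \<subseteq> V" using open_contains_cball_eq[OF \<open>open V\<close>] \<open>x \<in> V\<close> by blast
    define t where "t = min s (min (e / 2) (\<delta> / (2 * m)))"
    have t: "t > 0" "t \<le> s" "t \<le> e / 2" "t \<le> \<delta> / (2 * m)"
      using s that \<delta> by (auto simp: t_def)
    have "2 * m * t \<le> \<delta>" using t(4) that by (simp add: field_simps)
    moreover have "cball x t \<subseteq> V" "t < e" using s t that by auto
    ultimately show ?thesis using t by (intro exI[of _ "(x, t)"]) auto
  qed
  have disj: "disjoint_family_on (\<lambda>(a, r). cball a r) C"
    if "pairwise (\<lambda>i j. disjnt (cball (fst i) (snd i)) (cball (fst j) (snd j))) C" for C :: "('a \<times> real) set"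
    using that by (auto simp: disjoint_family_on_def pairwise_def disjnt_def case_prod_unfold)
  have outer: "emeasure lebesgue V \<le> emeasure lebesgue Z + emeasure lebesgue (V - Z)"
    if "open V" "Z \<subseteq> V" "Z \<in> sets lebesgue" for V Z :: "'a set"
  proof -
    have "V \<in> sets lebesgue" using that(1) by simp
    then show ?thesis
      using emeasure_subadditive[of Z lebesgue "V - Z"] that(2,3) by (simp add: Un_absorb1)
  qed
  have null: "?H Z = 0" if Z: "Z \<subseteq> E" "negligible Z" for Z
  proof -
    have "?H Z \<le> 0 + ennreal e" if e: "e > 0" for e
    proof -
      have Zs: "Z \<in> sets lebesgue" using Z(2) by (simp add: negligible_iff_null_sets null_setsD2)
      have e5: "e / 5 ^ DIM('a) > 0" using e by simp
      obtain V where V: "open V" "Z \<subseteq> V" "emeasure lebesgue (V - Z) < ennreal (e / 5 ^ DIM('a))"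
        using sets_lebesgue_outer_open[OF Zs e5] by metis
      have "emeasure lebesgue V \<le> emeasure lebesgue (V - Z) + emeasure lebesgue Z"
        using outer[OF V(1,2) Zs] by (simp add: add.commute)
      also have "emeasure lebesgue Z = 0" using Z(2) by (simp add: negligible_iff_null_sets null_setsD1)
      finally have Ve: "emeasure lborel V \<le> ennreal (e / 5 ^ DIM('a))" using V(1,3) by simp
      have cov: "Z \<subseteq> (\<Union>i\<in>?K V 5. cball (fst i) (snd i))"
      proof
        fix x assume "x \<in> Z"
        then show "x \<in> (\<Union>i\<in>?K V 5. cball (fst i) (snd i))"
          using small[OF V(1), of x 1 5] V(2) by (simp add: subset_iff) blast
      qed
      obtain C where C: "countable C" "C \<subseteq> ?K V 5"
          "pairwise (\<lambda>i j. disjnt (cball (fst i) (snd i)) (cball (fst j) (snd j))) C"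
          "Z \<subseteq> (\<Union>i\<in>C. cball (fst i) (5 * snd i))"
      proof (rule Vitali_covering_lemma_cballs[OF cov, of \<delta>])
        show "0 < snd i \<and> snd i \<le> \<delta>" if "i \<in> ?K V 5" for i using that by auto
      qed
      have "?H Z \<le> ennreal (5 ^ DIM('a)) * emeasure lborel V"
      proof (rule hausdorff_premeasure_disjoint_balls[OF C(1) disj[OF C(3)]])
        show "0 < r \<and> cball a r \<subseteq> V \<and> 2 * 5 * r \<le> \<delta>" if "(a, r) \<in> C" for a r
          using subsetD[OF C(2) that] by auto
        show "Z \<subseteq> (\<Union>(a, r)\<in>C. cball a (5 * r))" using C(4) by (simp add: case_prod_unfold)
      qed (use V(1) G Z(1) in auto)
      also have "\<dots> \<le> ennreal (5 ^ DIM('a)) * ennreal (e / 5 ^ DIM('a))" by (rule mult_left_mono[OF Ve]) simp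
      also have "\<dots> = ennreal e" using e by (subst ennreal_mult[symmetric]) auto
      finally show ?thesis by simp
    qed
    then show ?thesis using ennreal_le_epsilon[of 0 "?H Z"] by simp
  qed
  show ?thesis
  proof (rule ennreal_le_epsilon)
    fix e :: real assume e: "0 < e"
    obtain V where V: "open V" "E \<subseteq> V" "emeasure lebesgue (V - E) < ennreal e"
      using sets_lebesgue_outer_open[OF E e] by metis
    obtain C where C: "countable C" "C \<subseteq> ?K V 1"
        "pairwise (\<lambda>i j. disjnt (cball (fst i) (snd i)) (cball (fst j) (snd j))) C"
        "negligible (V - (\<Union>i\<in>C. cball (fst i) (snd i)))"
    proof (rule Vitali_covering_theorem_cballs[where K = "?K V 1" and a = fst and r = snd and S = V])
      show "\<exists>i. i \<in> ?K V 1 \<and> x \<in> cball (fst i) (snd i) \<and> snd i < d" if "x \<in> V" "0 < d" for x d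
        using small[OF V(1), of x d 1] that by auto
      show "0 < snd i" if "i \<in> ?K V 1" for i using that by auto
    qed
    let ?B = "\<Union>i\<in>C. cball (fst i) (snd i)"
    have "?H E \<le> hausdorff_premeasure M d DIM('a) \<delta> (G ` (E \<inter> ?B) \<union> G ` (E - ?B))"
      by (intro hausdorff_premeasure_mono) auto
    also have "\<dots> \<le> ?H (E \<inter> ?B) + ?H (E - ?B)" by (rule hausdorff_premeasure_Un)
    also have "?H (E - ?B) = 0" using C(4) V(2) by (intro null negligible_subset[OF C(4)]) auto
    also have "?H (E \<inter> ?B) \<le> ennreal (1 ^ DIM('a)) * emeasure lborel V"
    proof (rule hausdorff_premeasure_disjoint_balls[OF C(1) disj[OF C(3)]])
      show "0 < r \<and> cball a r \<subseteq> V \<and> 2 * 1 * r \<le> \<delta>" if "(a, r) \<in> C" for a r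
        using subsetD[OF C(2) that] by auto
      show "E \<inter> ?B \<subseteq> (\<Union>(a, r)\<in>C. cball a (1 * r))" by (simp add: case_prod_unfold)
    qed (use V(1) G in auto)
    also have "ennreal (1 ^ DIM('a)) * emeasure lborel V + 0 = emeasure lebesgue V" using V(1) by simp
    also have "\<dots> \<le> emeasure lebesgue E + emeasure lebesgue (V - E)"
      by (rule outer[OF V(1,2) E])
    also have "\<dots> \<le> emeasure lebesgue E + ennreal e" using V(3) by (intro add_left_mono) simp
    finally show "?H E \<le> emeasure lebesgue E + ennreal e" by (simp add: add_right_mono)
  qed
qed

section \<open>Two metrics on the same set\<close>

text \<open>Both spaces embed into two disjoint copies of \<open>X\<close>, the copies of
  \<open>x\<close> and \<open>y\<close> having distance \<open>d x y + c\<close>. The hypotheses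
  are what the triangle inequality for this gluing needs, and the two copies of a point have
  distance \<open>c\<close>.\<close>

lemma GH_dist_le_uniform:
  fixes d e :: "'a \<Rightarrow> 'a \<Rightarrow> real"
  assumes d: "Metric_space X d" and e: "Metric_space X e" and c: "0 < c"
    and le: "\<And>x y. x \<in> X \<Longrightarrow> y \<in> X \<Longrightarrow> d x y \<le> e x y"
    and ge: "\<And>x y. x \<in> X \<Longrightarrow> y \<in> X \<Longrightarrow> e x y \<le> d x y + 2 * c"
  shows "GH_dist X d X e \<le> ennreal c"
proof -
  interpret d: Metric_space X d by (rule d)
  interpret e: Metric_space X e by (rule e)
  define D :: "'a + 'a \<Rightarrow> 'a + 'a \<Rightarrow> real" where
    "D u v = (case u of Inl x \<Rightarrow> (case v of Inl y \<Rightarrow> d x y | Inr y \<Rightarrow> d x y + c)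
       | Inr x \<Rightarrow> (case v of Inl y \<Rightarrow> d x y + c | Inr y \<Rightarrow> e x y))" for u v
  have [simp]: "D (Inl x) (Inl y) = d x y" "D (Inl x) (Inr y) = d x y + c"
    "D (Inr x) (Inl y) = d x y + c" "D (Inr x) (Inr y) = e x y" for x y by (simp_all add: D_def)
  let ?Z = "Inl ` X \<union> Inr ` X :: ('a + 'a) set"
  have Z: "Metric_space ?Z D"
  proof
    fix u v
    show "0 \<le> D u v" using c by (cases u; cases v) (auto simp: add_nonneg_nonneg)
    show "D u v = D v u" by (cases u; cases v) (auto simp: d.commute e.commute)
  next
    fix u v assume "u \<in> ?Z" "v \<in> ?Z"
    then show "D u v = 0 \<longleftrightarrow> u = v"
      using c by (auto simp: add_nonneg_eq_0_iff)
  next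
    fix u v w assume uvw: "u \<in> ?Z" "v \<in> ?Z" "w \<in> ?Z"
    have t: "d x z \<le> d x y + d y z" "e x z \<le> e x y + e y z" "d x y \<le> e x y" "e x y \<le> d x y + 2 * c"
      if "x \<in> X" "y \<in> X" "z \<in> X" for x y z
      using d.triangle e.triangle that le ge by auto
    from uvw obtain x y z where "(u = Inl x \<or> u = Inr x) \<and> x \<in> X" "(v = Inl y \<or> v = Inr y) \<and> y \<in> X"
        "(w = Inl z \<or> w = Inr z) \<and> z \<in> X" by blast
    then show "D u w \<le> D u v + D v w"
      using t[of x y z] t[of x z y] t[of y z x] c by (auto simp: d.commute e.commute)
  qed
  have "GH_dist X d X e \<le> hausdorff_dist D (Inl ` X) (Inr ` X)"
    unfolding GH_dist_def
  proof (rule Inf_lower, intro CollectI exI conjI)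
    show "isometric_embedding X d ?Z D Inl" "isometric_embedding X e ?Z D Inr"
      by (auto simp: isometric_embedding_def)
  qed (auto intro: Z)
  also have "\<dots> \<le> ennreal c"
    unfolding hausdorff_dist_def
  proof (intro max.boundedI SUP_least)
    fix a assume "a \<in> (Inl ` X :: ('a + 'a) set)"
    then obtain x where "x \<in> X" "a = Inl x" by auto
    then show "(INF b\<in>Inr ` X. ennreal (D a b)) \<le> ennreal c"
      by (intro INF_lower2[of "Inr x"]) auto
  next
    fix a assume "a \<in> (Inr ` X :: ('a + 'a) set)"
    then obtain x where "x \<in> X" "a = Inr x" by auto
    then show "(INF b\<in>Inl ` X. ennreal (D b a)) \<le> ennreal c"
      by (intro INF_lower2[of "Inl x"]) auto
  qed
  finally show ?thesis .
qed

lemma mtopology_eq_euclidean: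
  fixes M :: "'a::metric_space set"
  assumes d: "Metric_space M d" and ge: "\<And>p q. p \<in> M \<Longrightarrow> q \<in> M \<Longrightarrow> dist p q \<le> d p q"
    and cont: "\<And>p e. p \<in> M \<Longrightarrow> 0 < e \<Longrightarrow> \<exists>\<tau>>0. \<forall>q\<in>M. dist p q < \<tau> \<longrightarrow> d p q < e"
  shows "Metric_space.mtopology M d = top_of_set M"
proof -
  interpret Metric_space M d by (rule d)
  have ball: "(\<exists>r>0. mball x r \<subseteq> U) \<longleftrightarrow> (\<exists>e>0. \<forall>x'\<in>M. dist x' x < e \<longrightarrow> x' \<in> U)"
    if U: "U \<subseteq> M" "x \<in> U" for U x
  proof
    have x: "x \<in> M" using U by auto
    { assume "\<exists>r>0. mball x r \<subseteq> U"
      then obtain r where r: "r > 0" "mball x r \<subseteq> U" by auto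
      obtain t where t: "t > 0" "\<forall>q\<in>M. dist x q < t \<longrightarrow> d x q < r" using cont[OF x r(1)] by auto
      have "x' \<in> U" if "x' \<in> M" "dist x' x < t" for x'
        using t(2) r(2) x that by (auto simp: dist_commute)
      then show "\<exists>e>0. \<forall>x'\<in>M. dist x' x < e \<longrightarrow> x' \<in> U" using t(1) by blast }
    { assume "\<exists>e>0. \<forall>x'\<in>M. dist x' x < e \<longrightarrow> x' \<in> U"
      then obtain r where r: "r > 0" "\<forall>x'\<in>M. dist x' x < r \<longrightarrow> x' \<in> U" by auto
      have "mball x r \<subseteq> U"
      proof
        fix y assume "y \<in> mball x r"
        then have "y \<in> M" "d x y < r" by auto
        then show "y \<in> U" using r(2) ge[OF x, of y] by (simp add: dist_commute)
      qed
      then show "\<exists>r>0. mball x r \<subseteq> U" using r(1) by blast }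
  qed
  have "openin mtopology U \<longleftrightarrow> openin (top_of_set M) U" for U
    unfolding openin_mtopology openin_euclidean_subtopology_iff using ball[of U] by blast
  then show ?thesis by (simp add: topology_eq)
qed

section \<open>Continuously differentiable paths\<close>

text \<open>The length of a tangent vector of the warped metric at a point where the warping function
  has value \<open>F\<close>. It is also used for chords, that is, differences of points in the
  ambient space.\<close>

definition wnorm :: "real \<Rightarrow> 'a::real_normed_vector \<times> 'b::real_normed_vector \<Rightarrow> real" where
  "wnorm F v = norm (fst v, F *\<^sub>R snd v)"

lemma wnorm_eq: "wnorm F v = sqrt ((norm (fst v))\<^sup>2 + F\<^sup>2 * (norm (snd v))\<^sup>2)"
  by (simp add: wnorm_def norm_Pair power_mult_distrib)

lemma wnorm_nonneg [simp]: "0 \<le> wnorm F v" by (simp add: wnorm_def)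

lemma wnorm_scale: "wnorm F (k *\<^sub>R v) = \<bar>k\<bar> * wnorm F v"
proof -
  have eq: "(fst (k *\<^sub>R v), F *\<^sub>R snd (k *\<^sub>R v)) = k *\<^sub>R (fst v, F *\<^sub>R snd v)" by (simp add: mult.commute)
  show ?thesis unfolding wnorm_def eq norm_scaleR ..
qed

lemma wnorm_mono: "0 \<le> F \<Longrightarrow> F \<le> G \<Longrightarrow> wnorm F v \<le> wnorm G v"
  unfolding wnorm_eq by (intro real_sqrt_le_mono add_left_mono mult_right_mono power_mono) auto

lemma sqrt_warped_metric: "sqrt (warped_metric f p v v) = wnorm (f (polar_r p)) v"
  by (simp add: warped_metric_def wnorm_eq power2_norm_eq_inner)

lemma wnorm_1 [simp]: "wnorm 1 v = norm v" by (simp add: wnorm_def)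

lemma wnorm_le_norm: "1 \<le> F \<Longrightarrow> wnorm F v \<le> F * norm v"
proof -
  assume F: "1 \<le> F"
  have "wnorm F v \<le> sqrt (F\<^sup>2 * ((norm (fst v))\<^sup>2 + (norm (snd v))\<^sup>2))"
    unfolding wnorm_eq using F mult_right_mono[of 1 "F\<^sup>2" "(norm (fst v))\<^sup>2"]
    by (intro real_sqrt_le_mono) (simp add: algebra_simps)
  also have "\<dots> = F * norm v" using F by (simp add: real_sqrt_mult norm_prod_def)
  finally show ?thesis .
qed

text \<open>The derivative is carried along as a function. It is two-sided also at 0 and 1, as in
  \<open>C1_differentiable_on\<close>.\<close>

definition C1_path :: "'a::real_normed_vector set \<Rightarrow> (real \<Rightarrow> 'a) \<Rightarrow> (real \<Rightarrow> 'a) \<Rightarrow> 'a \<Rightarrow> 'a \<Rightarrow> bool" where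
  "C1_path N c D p q \<longleftrightarrow> (\<forall>t\<in>{0..1}. (c has_vector_derivative D t) (at t)) \<and> continuous_on {0..1} D \<and>
     c ` {0..1} \<subseteq> N \<and> c 0 = p \<and> c 1 = q"

lemma C1_pathD:
  assumes "C1_path N c D p q"
  shows "\<And>t. t \<in> {0..1} \<Longrightarrow> (c has_vector_derivative D t) (at t)" "continuous_on {0..1} D"
    "\<And>t. t \<in> {0..1} \<Longrightarrow> c t \<in> N" "c 0 = p" "c 1 = q" "continuous_on {0..1} c"
  using assms unfolding C1_path_def
  by (auto intro!: continuous_at_imp_continuous_on has_vector_derivative_continuous)

lemma C1_path_ends: "C1_path N c D p q \<Longrightarrow> p \<in> N \<and> q \<in> N"
  using C1_pathD(3)[of N c D p q 0] C1_pathD(3)[of N c D p q 1] C1_pathD(4,5)[of N c D p q] by auto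

lemma C1_path_reparam:
  fixes s s' :: "real \<Rightarrow> real"
  assumes c: "C1_path N c D p q"
    and s: "\<And>t. t \<in> {0..1} \<Longrightarrow> (s has_real_derivative s' t) (at t)" "continuous_on {0..1} s'"
      "\<And>t. t \<in> {0..1} \<Longrightarrow> s t \<in> {0..1}"
  shows "C1_path N (c \<circ> s) (\<lambda>t. s' t *\<^sub>R D (s t)) (c (s 0)) (c (s 1))"
  unfolding C1_path_def
proof (intro conjI ballI)
  note C = C1_pathD[OF c]
  fix t :: real assume t: "t \<in> {0..1}"
  show "(c \<circ> s has_vector_derivative s' t *\<^sub>R D (s t)) (at t)"
    using s(1)[OF t] C(1)[OF s(3)[OF t]]
    by (intro vector_diff_chain_at) (auto simp: has_real_derivative_iff_has_vector_derivative)
next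
  have cs: "continuous_on {0..1} s"
    using s(1) by (meson DERIV_isCont continuous_at_imp_continuous_on)
  have "continuous_on {0..1} (D \<circ> s)"
    by (rule continuous_on_compose[OF cs continuous_on_subset[OF C1_pathD(2)[OF c]]]) (use s(3) in auto)
  then show "continuous_on {0..1} (\<lambda>t. s' t *\<^sub>R D (s t))"
    using s(2) by (intro continuous_on_scaleR) (auto simp: o_def)
  show "(c \<circ> s) ` {0..1} \<subseteq> N" using C1_pathD(3)[OF c] s(3) by auto
qed auto

text \<open>Joining two paths keeps the derivative continuous when both have velocity zero at the
  joint.\<close>

lemma C1_path_join:
  assumes 1: "C1_path N c D p q" "D 1 = 0" and 2: "C1_path N c' D' q r" "D' 0 = 0"
  shows "C1_path N (\<lambda>t. if t \<in> {..1/2} then c (2 * t) else c' (2 * t - 1))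
    (\<lambda>t. if t \<in> {..1/2} then 2 *\<^sub>R D (2 * t) else 2 *\<^sub>R D' (2 * t - 1)) p r"
  unfolding C1_path_def
proof (intro conjI ballI)
  note A = C1_pathD[OF 1(1)] and B = C1_pathD[OF 2(1)]
  fix t :: real assume t: "t \<in> {0..1}"
  have fr: "closure {..1/2} \<inter> closure {1/2..} = {1/2::real}" by auto
  have d1: "((\<lambda>t. c (2 * t)) has_vector_derivative 2 *\<^sub>R D (2 * t)) (at t within X)" if "2 * t \<le> 1" for X
  proof -
    have "((c \<circ> (\<lambda>t. 2 * t)) has_vector_derivative 2 *\<^sub>R D (2 * t)) (at t)"
      using t that by (intro vector_diff_chain_at A)
        (auto intro!: derivative_eq_intros simp: has_real_derivative_iff_has_vector_derivative[symmetric])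
    then show ?thesis by (simp add: o_def has_vector_derivative_at_within)
  qed
  have d2: "((\<lambda>t. c' (2 * t - 1)) has_vector_derivative 2 *\<^sub>R D' (2 * t - 1)) (at t within X)" if "1 \<le> 2 * t" for X
  proof -
    have "((c' \<circ> (\<lambda>t. 2 * t - 1)) has_vector_derivative 2 *\<^sub>R D' (2 * t - 1)) (at t)"
      using t that by (intro vector_diff_chain_at B)
        (auto intro!: derivative_eq_intros simp: has_real_derivative_iff_has_vector_derivative[symmetric])
    then show ?thesis by (simp add: o_def has_vector_derivative_at_within)
  qed
  show "((\<lambda>t. if t \<in> {..1/2} then c (2 * t) else c' (2 * t - 1)) has_vector_derivative
     (if t \<in> {..1/2} then 2 *\<^sub>R D (2 * t) else 2 *\<^sub>R D' (2 * t - 1))) (at t)"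
  proof (rule has_vector_derivative_If_within_closures[where T = "{1/2..}"])
    assume "t \<in> closure {..1/2}" "t \<in> closure {1/2..}"
    then have t2: "t = 1/2" by simp
    show "c (2 * t) = c' (2 * t - 1)" unfolding t2 using A(5) B(4) by simp
    show "2 *\<^sub>R D (2 * t) = 2 *\<^sub>R D' (2 * t - 1)" unfolding t2 using 1(2) 2(2) by simp
  qed (auto simp: fr intro!: d1 d2)
next
  note A = C1_pathD[OF 1(1)] and B = C1_pathD[OF 2(1)]
  have "continuous_on ({0..1/2} \<union> {1/2..1}) (\<lambda>t. if t \<le> 1/2 then 2 *\<^sub>R D (2 * t) else 2 *\<^sub>R D' (2 * t - 1))"
  proof (rule continuous_on_If)
    show "continuous_on {0..1/2} (\<lambda>t. 2 *\<^sub>R D (2 * t))"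
      by (intro continuous_on_scaleR continuous_on_const continuous_on_compose2[OF A(2)] continuous_intros) auto
    show "continuous_on {1/2..1} (\<lambda>t. 2 *\<^sub>R D' (2 * t - 1))"
      by (intro continuous_on_scaleR continuous_on_const continuous_on_compose2[OF B(2)] continuous_intros) auto
  next
    fix t :: real assume "t \<in> {0..1/2}" "\<not> t \<le> 1/2"
    then show "2 *\<^sub>R D (2 * t) = 2 *\<^sub>R D' (2 * t - 1)" by simp
  next
    fix t :: real assume "t \<in> {1/2..1}" "t \<le> 1/2"
    then have t2: "t = 1/2" by simp
    show "2 *\<^sub>R D (2 * t) = 2 *\<^sub>R D' (2 * t - 1)" unfolding t2 using 1(2) 2(2) by simp
  qed auto
  moreover have "{0..1/2} \<union> {1/2..1} = {0..1::real}" by auto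
  ultimately show "continuous_on {0..1} (\<lambda>t. if t \<in> {..1/2} then 2 *\<^sub>R D (2 * t) else 2 *\<^sub>R D' (2 * t - 1))" by simp
  show "(\<lambda>t. if t \<in> {..1/2} then c (2 * t) else c' (2 * t - 1)) ` {0..1} \<subseteq> N"
    using A(3) B(3) by auto
qed (use C1_pathD[OF 1(1)] C1_pathD[OF 2(1)] in auto)

lemma integral_double:
  fixes g :: "real \<Rightarrow> real"
  assumes "continuous_on {0..1} g"
  shows "((\<lambda>t. 2 * g (2 * t)) has_integral integral {0..1} g) {0..1/2}"
    "((\<lambda>t. 2 * g (2 * t - 1)) has_integral integral {0..1} g) {1/2..1}"
proof -
  have "((\<lambda>t. 2 *\<^sub>R g (2 * t)) has_integral integral {2 * 0..2 * (1/2)} g) {0..1/2}"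
    by (rule has_integral_substitution[where c = 0 and d = 1]) (auto intro!: derivative_eq_intros assms)
  then show "((\<lambda>t. 2 * g (2 * t)) has_integral integral {0..1} g) {0..1/2}" by simp
  have "((\<lambda>t. 2 *\<^sub>R g (2 * t - 1)) has_integral integral {2 * (1/2) - 1..2 * 1 - 1} g) {1/2..1}"
    by (rule has_integral_substitution[where c = 0 and d = 1]) (auto intro!: derivative_eq_intros assms)
  then show "((\<lambda>t. 2 * g (2 * t - 1)) has_integral integral {0..1} g) {1/2..1}" by simp
qed

section \<open>Riemannian distances of warped metrics\<close>

text \<open>A warping function of at least 1 makes every path at least as long as the Euclidean
  distance of its ends, so that the infimum of lengths is a metric; connectedness makes it an
  infimum over a nonempty set.\<close>

locale warped_space =
  fixes N :: "((real^3) \<times> complex) set" and f :: "real \<Rightarrow> real"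
  assumes sub: "N \<subseteq> S2xS1" and cont: "continuous_on N (\<lambda>p. f (polar_r p))"
    and ge1: "\<And>p. p \<in> N \<Longrightarrow> 1 \<le> f (polar_r p)"
    and connected: "\<And>p q. p \<in> N \<Longrightarrow> q \<in> N \<Longrightarrow> \<exists>c D. C1_path N c D p q"
begin

abbreviation "d \<equiv> riem_dist N (warped_metric f)"

definition speed :: "(real \<Rightarrow> (real^3) \<times> complex) \<Rightarrow> (real \<Rightarrow> (real^3) \<times> complex) \<Rightarrow> real \<Rightarrow> real" where
  "speed c D t = wnorm (f (polar_r (c t))) (D t)"

lemma speed_nonneg [simp]: "0 \<le> speed c D t" by (simp add: speed_def)

lemma continuous_speed: "C1_path N c D p q \<Longrightarrow> continuous_on {0..1} (speed c D)"
  unfolding speed_def wnorm_def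
  by (intro continuous_on_norm continuous_on_Pair continuous_on_scaleR continuous_on_fst continuous_on_snd
       continuous_on_compose2[OF cont, of _ c]) (auto dest: C1_pathD)

lemma integrable_speed: "C1_path N c D p q \<Longrightarrow> 0 \<le> a \<Longrightarrow> b \<le> 1 \<Longrightarrow> speed c D integrable_on {a..b}"
  by (intro integrable_continuous_real continuous_on_subset[OF continuous_speed]) auto

lemma riem_length_eq:
  assumes "C1_path N c D p q"
  shows "riem_length (warped_metric f) c = integral {0..1} (speed c D)"
  unfolding riem_length_def speed_def sqrt_warped_metric
  by (intro integral_cong) (simp add: vector_derivative_at[OF C1_pathD(1)[OF assms]])

lemma dist_set_eq:
  "{riem_length (warped_metric f) c | c. c C1_differentiable_on {0..1} \<and> c ` {0..1} \<subseteq> N \<and> c 0 = p \<and> c 1 = q}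
    = {integral {0..1} (speed c D) | c D. C1_path N c D p q}" (is "?A = ?B")
proof (intro equalityI subsetI)
  fix l assume "l \<in> ?A"
  then obtain c where c: "l = riem_length (warped_metric f) c" "c C1_differentiable_on {0..1}"
     "c ` {0..1} \<subseteq> N" "c 0 = p" "c 1 = q" by auto
  then obtain D where "C1_path N c D p q" unfolding C1_differentiable_on_def C1_path_def by auto
  then show "l \<in> ?B" using riem_length_eq c(1) by auto
next
  fix l assume "l \<in> ?B"
  then obtain c D where c: "C1_path N c D p q" "l = integral {0..1} (speed c D)" by auto
  then have "c C1_differentiable_on {0..1}" unfolding C1_differentiable_on_def C1_path_def by auto
  moreover have "c ` {0..1} \<subseteq> N" "c 0 = p" "c 1 = q" using c(1) by (auto simp: C1_path_def)
  ultimately show "l \<in> ?A" using c(2) riem_length_eq[OF c(1), symmetric] by blast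
qed

lemma dist_eq: "p \<in> N \<Longrightarrow> q \<in> N \<Longrightarrow> d p q = Inf {integral {0..1} (speed c D) | c D. C1_path N c D p q}"
  by (simp add: riem_dist_def dist_set_eq)

lemma speed_integral_nonneg: "C1_path N c D p q \<Longrightarrow> 0 \<le> integral {0..1} (speed c D)"
  by (intro integral_nonneg integrable_speed) auto

lemma dist_le_length:
  assumes "C1_path N c D p q"
  shows "d p q \<le> integral {0..1} (speed c D)"
  using C1_path_ends[OF assms] assms
  by (auto simp: dist_eq intro!: cInf_lower bdd_belowI[of _ 0] speed_integral_nonneg)

lemma dist_less_obtain:
  assumes "p \<in> N" "q \<in> N" "d p q < L"
  obtains c D where "C1_path N c D p q" "integral {0..1} (speed c D) < L"
proof -
  have "{integral {0..1} (speed c D) | c D. C1_path N c D p q} \<noteq> {}"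
    using connected[OF assms(1,2)] by auto
  from cInf_lessD[OF this, of L] assms show thesis by (auto simp: dist_eq intro: that)
qed

lemma dist_nonneg: "0 \<le> d p q"
proof (cases "p \<in> N \<and> q \<in> N")
  case True
  then show ?thesis unfolding dist_eq[OF conjunct1[OF True] conjunct2[OF True]]
    using connected by (intro cInf_greatest) (auto intro: speed_integral_nonneg)
qed (auto simp: riem_dist_def)

lemma substitution_speed:
  assumes c: "C1_path N c D p q" and s: "\<And>t. t \<in> {0..1} \<Longrightarrow> (s has_real_derivative s' t) (at t)"
      "\<And>t. t \<in> {0..1} \<Longrightarrow> s t \<in> {0..1}" "continuous_on {0..1} s'"
  shows "integral {0..1} (\<lambda>t. s' t * speed c D (s t)) = integral {s 0..s 1} (speed c D) - integral {s 1..s 0} (speed c D)"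
proof -
  have "((\<lambda>t. s' t *\<^sub>R speed c D (s t)) has_integral
      (integral {s 0..s 1} (speed c D) - integral {s 1..s 0} (speed c D))) {0..1}"
  proof (rule has_integral_substitution_general[of "{}" 0 1 s 0 1])
    show "continuous_on {0..1} s" using s(1) by (meson DERIV_isCont continuous_at_imp_continuous_on)
  qed (use s continuous_speed[OF c] in \<open>auto intro: has_field_derivative_at_within\<close>)
  then show ?thesis by (simp add: integral_unique)
qed

lemma reparam_speed: "speed (c \<circ> s) (\<lambda>t. s' t *\<^sub>R D (s t)) t = \<bar>s' t\<bar> * speed c D (s t)"
  by (simp add: speed_def wnorm_scale)

lemma dist_sym: "d p q = d q p"
proof -
  have "d q p \<le> d p q" if pq: "p \<in> N" "q \<in> N" for p q
  proof (rule field_le_epsilon)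
    fix e :: real assume "0 < e"
    then obtain c D where c: "C1_path N c D p q" "integral {0..1} (speed c D) < d p q + e"
      using dist_less_obtain[OF pq, of "d p q + e"] by auto
    have s: "((\<lambda>t. 1 - t) has_real_derivative - 1) (at t)" for t :: real
      by (auto intro!: derivative_eq_intros)
    have "C1_path N (c \<circ> (\<lambda>t. 1 - t)) (\<lambda>t. (- 1) *\<^sub>R D (1 - t)) (c (1 - 0)) (c (1 - 1))"
      by (rule C1_path_reparam[OF c(1) s]) auto
    then have "C1_path N (c \<circ> (\<lambda>t. 1 - t)) (\<lambda>t. (- 1) *\<^sub>R D (1 - t)) q p"
      using C1_pathD(4,5)[OF c(1)] by simp
    from dist_le_length[OF this] have "d q p \<le> integral {0..1} (speed (c \<circ> (\<lambda>t. 1 - t)) (\<lambda>t. (- 1) *\<^sub>R D (1 - t)))" .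
    also have "\<dots> = integral {0..1} (\<lambda>t. - (- 1 * speed c D (1 - t)))"
      unfolding reparam_speed[where s' = "\<lambda>_. - 1"] by simp
    also have "\<dots> = integral {0..1} (speed c D)"
      unfolding integral_neg using substitution_speed[OF c(1) s, of] by simp
    finally show "d q p \<le> d p q + e" using c(2) by simp
  qed
  then have "p \<in> N \<Longrightarrow> q \<in> N \<Longrightarrow> ?thesis" by (simp add: antisym)
  then show ?thesis by (cases "p \<in> N \<and> q \<in> N") (auto simp: riem_dist_def)
qed

text \<open>The reparametrisation \<open>3 * t\<^sup>2 - 2 * t\<^sup>3\<close> is monotone from 0 to
  1 and has derivative zero at both ends, so it prepares paths for \<open>C1_path_join\<close>
  without changing their length.\<close>

lemma slow_ends:
  assumes c: "C1_path N c D p q"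
  obtains c' D' where "C1_path N c' D' p q" "D' 0 = 0" "D' 1 = 0"
    "integral {0..1} (speed c' D') = integral {0..1} (speed c D)"
proof -
  let ?s = "\<lambda>t::real. 3 * t\<^sup>2 - 2 * t ^ 3" and ?s' = "\<lambda>t::real. 6 * t * (1 - t)"
  have s: "(?s has_real_derivative ?s' t) (at t)" for t
    by (auto intro!: derivative_eq_intros simp: algebra_simps power2_eq_square)
  have s01: "?s t \<in> {0..1}" if "t \<in> {0..1}" for t
  proof -
    have "?s t = t\<^sup>2 * (3 - 2 * t)" "1 - ?s t = (1 - t)\<^sup>2 * (1 + 2 * t)"
      by (simp_all add: power2_eq_square power3_eq_cube algebra_simps)
    moreover have "0 \<le> t\<^sup>2 * (3 - 2 * t)" "0 \<le> (1 - t)\<^sup>2 * (1 + 2 * t)" using that by auto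
    ultimately show ?thesis by auto
  qed
  have cs: "continuous_on {0..1} ?s'" by (intro continuous_intros)
  have "C1_path N (c \<circ> ?s) (\<lambda>t. ?s' t *\<^sub>R D (?s t)) (c (?s 0)) (c (?s 1))"
    by (rule C1_path_reparam[OF c s cs s01])
  then have "C1_path N (c \<circ> ?s) (\<lambda>t. ?s' t *\<^sub>R D (?s t)) p q"
    using C1_pathD(4,5)[OF c] by simp
  moreover have "integral {0..1} (speed (c \<circ> ?s) (\<lambda>t. ?s' t *\<^sub>R D (?s t))) = integral {0..1} (\<lambda>t. ?s' t * speed c D (?s t))"
    using reparam_speed[of c ?s ?s' D] by (intro integral_cong) (simp add: abs_of_nonneg)
  moreover have "\<dots> = integral {0..1} (speed c D)"
    using substitution_speed[OF c s s01 cs] by simp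
  ultimately show thesis by (intro that[of "c \<circ> ?s" "\<lambda>t. ?s' t *\<^sub>R D (?s t)"]) simp_all
qed

lemma dist_triangle:
  assumes "p \<in> N" "q \<in> N" "r \<in> N"
  shows "d p r \<le> d p q + d q r"
proof (rule field_le_epsilon)
  fix e :: real assume "0 < e"
  then have e: "0 < e / 2" by simp
  obtain c1 D1 where 1: "C1_path N c1 D1 p q" "integral {0..1} (speed c1 D1) < d p q + e / 2"
    using dist_less_obtain[OF assms(1,2), of "d p q + e / 2"] e by auto
  obtain c2 D2 where 2: "C1_path N c2 D2 q r" "integral {0..1} (speed c2 D2) < d q r + e / 2"
    using dist_less_obtain[OF assms(2,3), of "d q r + e / 2"] e by auto
  obtain c D where 3: "C1_path N c D p q" "D 0 = 0" "D 1 = 0"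
      "integral {0..1} (speed c D) = integral {0..1} (speed c1 D1)" by (rule slow_ends[OF 1(1)])
  obtain c' D' where 4: "C1_path N c' D' q r" "D' 0 = 0" "D' 1 = 0"
      "integral {0..1} (speed c' D') = integral {0..1} (speed c2 D2)" by (rule slow_ends[OF 2(1)])
  let ?c = "\<lambda>t. if t \<in> {..1/2} then c (2 * t) else c' (2 * t - 1)"
  let ?D = "\<lambda>t. if t \<in> {..1/2} then 2 *\<^sub>R D (2 * t) else 2 *\<^sub>R D' (2 * t - 1)"
  have J: "C1_path N ?c ?D p r" by (rule C1_path_join[OF 3(1,3) 4(1,2)])
  have i1: "(speed ?c ?D has_integral integral {0..1} (speed c D)) {0..1/2}"
    by (rule has_integral_eq[OF _ integral_double(1)[OF continuous_speed[OF 3(1)]]])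
       (auto simp: speed_def wnorm_scale)
  have i2: "(speed ?c ?D has_integral integral {0..1} (speed c' D')) {1/2..1}"
  proof (rule has_integral_eq[OF _ integral_double(2)[OF continuous_speed[OF 4(1)]]])
    fix t :: real assume "t \<in> {1/2..1}"
    show "2 * speed c' D' (2 * t - 1) = speed ?c ?D t"
    proof (cases "t = 1/2")
      case True
      show ?thesis unfolding True speed_def using 3(3) 4(2) by (simp add: wnorm_def)
    next
      case False
      then show ?thesis using \<open>t \<in> {1/2..1}\<close> by (auto simp: speed_def wnorm_scale)
    qed
  qed
  have "integral {0..1} (speed ?c ?D) = integral {0..1} (speed c D) + integral {0..1} (speed c' D')"
    by (rule integral_unique, rule has_integral_combine[OF _ _ i1 i2]) auto
  then show "d p r \<le> d p q + d q r + e"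
    using dist_le_length[OF J] 1(2) 2(2) 3(4) 4(4) by simp
qed

text \<open>In the space \<open>(real^3) \<times> complex\<close> with the circle factor rescaled by
  \<open>F\<close> straight segments are shortest, so a piece of a path along which the warping
  function is at least \<open>F\<close> is at least as long as the rescaled chord.\<close>

lemma chord_le_partial_length:
  assumes c: "C1_path N c D p q" and ab: "0 \<le> a" "a \<le> b" "b \<le> 1"
    and F: "0 \<le> F" "\<And>t. t \<in> {a..b} \<Longrightarrow> F \<le> f (polar_r (c t))"
  shows "wnorm F (c b - c a) \<le> integral {a..b} (speed c D)"
proof -
  let ?T = "\<lambda>v :: (real^3) \<times> complex. (fst v, F *\<^sub>R snd v)"
  have lin: "bounded_linear ?T"
    by (rule bounded_linear_Pair[OF bounded_linear_fst bounded_linear_const_scaleR[OF bounded_linear_snd]])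
  have "((\<lambda>t. ?T (c t)) has_vector_derivative ?T (D t)) (at t within {a..b})" if "t \<in> {a..b}" for t
  proof -
    have "(c has_vector_derivative D t) (at t within {a..b})"
      using that ab by (intro has_vector_derivative_at_within[OF C1_pathD(1)[OF c]]) auto
    from bounded_linear.has_vector_derivative[OF lin this] show ?thesis .
  qed
  then have I: "((\<lambda>t. ?T (D t)) has_integral (?T (c b) - ?T (c a))) {a..b}"
    by (rule fundamental_theorem_of_calculus[OF ab(2)])
  have "norm (integral {a..b} (\<lambda>t. ?T (D t))) \<le> integral {a..b} (speed c D)"
  proof (rule integral_norm_bound_integral)
    show "speed c D integrable_on {a..b}" by (rule integrable_speed[OF c]) (use ab in auto)
    show "norm (?T (D t)) \<le> speed c D t" if "t \<in> {a..b}" for t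
      using wnorm_mono[OF F(1) F(2)[OF that], of "D t"] by (simp add: speed_def wnorm_def)
  qed (use I in blast)
  moreover have "?T (c b) - ?T (c a) = ?T (c b - c a)" by (simp add: scaleR_diff_right)
  ultimately show ?thesis using integral_unique[OF I] by (simp add: wnorm_def)
qed

lemma chord_le_length:
  assumes c: "C1_path N c D p q"
    and F: "0 \<le> F" "\<And>t. t \<in> {0..1} \<Longrightarrow> F \<le> f (polar_r (c t))"
  shows "wnorm F (q - p) \<le> integral {0..1} (speed c D)"
  using chord_le_partial_length[OF c _ _ _ F(1), of 0 1] F(2) C1_pathD(4,5)[OF c] by simp

lemma dist_from_start_le_length:
  assumes c: "C1_path N c D p q" and t: "t \<in> {0..1}"
  shows "dist p (c t) \<le> integral {0..1} (speed c D)"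
proof -
  have "dist p (c t) \<le> wnorm 1 (c t - c 0)"
    using C1_pathD(4)[OF c] by (simp add: dist_norm norm_minus_commute)
  also have "\<dots> \<le> integral {0..t} (speed c D)"
    using t C1_pathD(3)[OF c] ge1 by (intro chord_le_partial_length[OF c]) auto
  also have "\<dots> \<le> integral {0..1} (speed c D)"
    using t by (intro integral_subset_le integrable_speed[OF c]) auto
  finally show ?thesis .
qed

lemma dist_le_riem_dist:
  assumes "p \<in> N" "q \<in> N"
  shows "dist p q \<le> d p q"
proof (rule field_le_epsilon)
  fix e :: real assume "0 < e"
  then obtain c D where c: "C1_path N c D p q" "integral {0..1} (speed c D) < d p q + e"
    using dist_less_obtain[OF assms, of "d p q + e"] by auto
  then show "dist p q \<le> d p q + e" 
    using dist_from_start_le_length[OF c(1), of 1] C1_pathD(5)[OF c(1)] by simp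
qed

lemma dist_self: "p \<in> N \<Longrightarrow> d p p = 0"
proof -
  assume p: "p \<in> N"
  have c: "C1_path N (\<lambda>_. p) (\<lambda>_. 0) p p" using p by (auto simp: C1_path_def)
  have "speed (\<lambda>_. p) (\<lambda>_. 0) = (\<lambda>_. 0)" by (simp add: speed_def wnorm_def fun_eq_iff)
  then have "integral {0..1} (speed (\<lambda>_. p) (\<lambda>_. 0)) = 0" by simp
  then show ?thesis using dist_le_length[OF c] dist_nonneg[of p p] by simp
qed

lemma Metric_space_dist: "Metric_space N d"
proof
  show "d p q = 0 \<longleftrightarrow> p = q" if "p \<in> N" "q \<in> N" for p q
    using dist_self[OF that(1)] dist_le_riem_dist[OF that] dist_nonneg[of p q] by (metis dist_le_zero_iff)
qed (use dist_nonneg dist_sym dist_triangle in auto)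

lemma dist_le_speed_bound:
  assumes c: "C1_path N c D p q" and B: "\<And>t. t \<in> {0..1} \<Longrightarrow> speed c D t \<le> B"
  shows "d p q \<le> B"
proof -
  have "integral {0..1} (speed c D) \<le> integral {0..1} (\<lambda>_::real. B)"
    using B by (intro integral_le integrable_speed[OF c]) auto
  then show ?thesis using dist_le_length[OF c] by simp
qed

text \<open>Almost midpoints: cut an almost shortest path where its length from \<open>p\<close>
  takes a suitable value.\<close>

lemma dist_split:
  assumes pq: "p \<in> N" "q \<in> N" and less: "d p q < s + u" and su: "0 < s" "0 < u"
  shows "\<exists>m\<in>N. d p m < s \<and> d m q < u"
proof -
  obtain c D where c: "C1_path N c D p q" and L: "integral {0..1} (speed c D) < s + u"
    using dist_less_obtain[OF pq less] by auto
  let ?I = "\<lambda>a b. integral {a..b} (speed c D)"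
  have sub: "d (c a) (c b) \<le> ?I a b" if ab: "0 \<le> a" "a \<le> b" "b \<le> 1" for a b
  proof -
    have s: "((\<lambda>t. a + t * (b - a)) has_real_derivative (b - a)) (at t)" for t
      by (auto intro!: derivative_eq_intros)
    have in01: "a + t * (b - a) \<in> {0..1}" if "t \<in> {0..1}" for t
    proof -
      have "0 \<le> t * (b - a)" "t * (b - a) \<le> 1 * (b - a)" using that ab mult_right_mono[of t 1 "b - a"] by auto
      then show ?thesis using ab by auto
    qed
    have P: "C1_path N (c \<circ> (\<lambda>t. a + t * (b - a))) (\<lambda>t. (b - a) *\<^sub>R D (a + t * (b - a))) (c (a + 0 * (b - a))) (c (a + 1 * (b - a)))"
      by (rule C1_path_reparam[OF c s continuous_on_const in01])
    have "d (c a) (c b) \<le> integral {0..1} (\<lambda>t. (b - a) * speed c D (a + t * (b - a)))"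
    proof -
      have "speed (c \<circ> (\<lambda>t. a + t * (b - a))) (\<lambda>t. (b - a) *\<^sub>R D (a + t * (b - a)))
          = (\<lambda>t. (b - a) * speed c D (a + t * (b - a)))"
        using ab by (simp add: fun_eq_iff speed_def wnorm_scale)
      then show ?thesis using dist_le_length[OF P] by simp
    qed
    also have "\<dots> = ?I a b"
      using substitution_speed[OF c s in01 continuous_on_const] ab by (cases "a = b") auto
    finally show ?thesis .
  qed
  have cont: "continuous_on {0..1} (\<lambda>t. ?I 0 t)"
    by (rule indefinite_integral_continuous_1[OF integrable_speed[OF c]]) auto
  \<comment> \<open>Any value in \<open>[0, L]\<close> strictly between \<open>L - u\<close> and
  \<open>s\<close> will do, where \<open>L\<close> is the length of the path; the middle of the
  interval \<open>[L - u, s]\<close>, truncated to \<open>[0, L]\<close>, is one.\<close>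
  define l where "l = max 0 (min (?I 0 1) ((?I 0 1 - u + s) / 2))"
  have I0: "0 \<le> ?I 0 1" by (rule speed_integral_nonneg[OF c])
  have l: "0 \<le> l" "l \<le> ?I 0 1" "l < s" "?I 0 1 - l < u"
    using I0 L su by (auto simp: l_def max_def min_def field_simps)
  obtain t where t: "0 \<le> t" "t \<le> 1" "?I 0 t = l"
    using IVT'[of "\<lambda>t. ?I 0 t" 0 l 1] l cont by auto
  have "?I 0 t + ?I t 1 = ?I 0 1"
    using t by (intro Henstock_Kurzweil_Integration.integral_combine integrable_speed[OF c]) auto
  then have "d p (c t) < s" "d (c t) q < u"
    using sub[of 0 t] sub[of t 1] t l C1_pathD(4,5)[OF c] by auto
  moreover have "c t \<in> N" using C1_pathD(3)[OF c] t by auto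
  ultimately show ?thesis by auto
qed

end

section \<open>Explicit paths\<close>

lemma C1_path_mono: "C1_path M c D p q \<Longrightarrow> (\<And>t. t \<in> {0..1} \<Longrightarrow> c t \<in> N) \<Longrightarrow> C1_path N c D p q"
  by (auto simp: C1_path_def)

text \<open>The velocity of a segment projected to the unit sphere is the component of
  \<open>v\<close> tangent to the sphere divided by the norm, so it is at most \<open>norm v /
  k\<close> outside the ball of radius \<open>k\<close>.\<close>

lemma normalized_segment:
  fixes w v :: "'a::real_inner"
  assumes k: "0 < k" "\<And>t. t \<in> {0..1} \<Longrightarrow> k \<le> norm (w + t *\<^sub>R v)"
  shows "\<exists>D. (\<forall>t\<in>{0..1}. ((\<lambda>t. sgn (w + t *\<^sub>R v)) has_vector_derivative D t) (at t)) \<and>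
    continuous_on {0..1} D \<and> (\<forall>t\<in>{0..1}. norm (D t) \<le> norm v / k)"
proof -
  define W where "W = (\<lambda>t::real. w + t *\<^sub>R v)"
  define D where "D = (\<lambda>t. inverse (norm (W t)) *\<^sub>R (v - (sgn (W t) \<bullet> v) *\<^sub>R sgn (W t)))"
  have nz: "W t \<noteq> 0" "k \<le> norm (W t)" if "t \<in> {0..1}" for t using k(1) k(2)[OF that] by (auto simp: W_def)
  have cW: "continuous_on A W" for A unfolding W_def by (intro continuous_intros)
  have "((\<lambda>t. sgn (W t)) has_vector_derivative D t) (at t)" if t: "t \<in> {0..1}" for t
  proof -
    have dW: "(W has_vector_derivative v) (at t)" unfolding W_def
      by (auto intro!: derivative_eq_intros)
    have "(norm has_derivative (\<lambda>h. sgn (W t) \<bullet> h)) (at (W t))"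
      using has_derivative_norm[OF nz(1)[OF t]] by (simp add: inner_commute)
    from diff_chain_at[OF dW[unfolded has_vector_derivative_def] this]
    have "((\<lambda>t. norm (W t)) has_real_derivative (sgn (W t) \<bullet> v)) (at t)"
      by (intro has_derivative_imp_has_field_derivative[where D = "(\<lambda>h. sgn (W t) \<bullet> h) \<circ> (\<lambda>x. x *\<^sub>R v)"])
         (simp_all add: o_def mult.commute)
    from DERIV_inverse'[OF this] have "((\<lambda>t. inverse (norm (W t))) has_real_derivative
       - (inverse (norm (W t)) * (sgn (W t) \<bullet> v) * inverse (norm (W t)))) (at t)" using nz(1)[OF t] by simp
    from has_vector_derivative_scaleR[OF this dW]
    show ?thesis unfolding sgn_div_norm[abs_def] D_def by (simp add: algebra_simps sgn_div_norm)
  qed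
  moreover have "continuous_on {0..1} D" unfolding D_def sgn_div_norm
    by (intro continuous_intros cW) (use nz in auto)
  moreover have "norm (D t) \<le> norm v / k" if t: "t \<in> {0..1}" for t
  proof -
    let ?u = "sgn (W t)"
    have u: "?u \<bullet> ?u = 1" using nz(1)[OF t] by (simp add: dot_square_norm norm_sgn)
    have "(norm (v - (?u \<bullet> v) *\<^sub>R ?u))\<^sup>2 = (norm v)\<^sup>2 - (?u \<bullet> v)\<^sup>2"
      unfolding power2_norm_eq_inner
      by (simp add: inner_diff_left inner_diff_right u inner_commute power2_eq_square)
    then have "norm (v - (?u \<bullet> v) *\<^sub>R ?u) \<le> norm v"
      using power2_le_imp_le[of "norm (v - (?u \<bullet> v) *\<^sub>R ?u)" "norm v"] by simp
    moreover have "inverse (norm (W t)) \<le> inverse k" using nz[OF t] k(1) by (simp add: le_imp_inverse_le)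
    ultimately have "inverse (norm (W t)) * norm (v - (?u \<bullet> v) *\<^sub>R ?u) \<le> inverse k * norm v"
      using k(1) by (intro mult_mono) auto
    then show ?thesis by (simp add: D_def divide_inverse mult.commute)
  qed
  ultimately show ?thesis unfolding W_def by blast
qed

lemma wnorm_le_scaled:
  assumes "norm (fst v) \<le> norm (fst w) / k" "norm (snd v) \<le> norm (snd w) / k" "0 < k"
  shows "wnorm F v \<le> wnorm F w / k"
proof -
  have "wnorm F v \<le> sqrt ((norm (fst w) / k)\<^sup>2 + F\<^sup>2 * (norm (snd w) / k)\<^sup>2)"
    unfolding wnorm_eq using assms by (intro real_sqrt_le_mono add_mono mult_left_mono power_mono) auto
  also have "\<dots> = sqrt (((norm (fst w))\<^sup>2 + F\<^sup>2 * (norm (snd w))\<^sup>2) / k\<^sup>2)"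
    by (simp add: power_divide add_divide_distrib)
  also have "\<dots> = wnorm F w / k" using assms(3) by (simp add: wnorm_eq real_sqrt_divide)
  finally show ?thesis .
qed

definition proj :: "(real^3) \<times> complex \<Rightarrow> (real^3) \<times> complex" where
  "proj p = (sgn (fst p), sgn (snd p))"

lemma proj_id: "p \<in> S2xS1 \<Longrightarrow> proj p = p"
  by (cases p) (auto simp: proj_def S2xS1_def sgn_div_norm)

text \<open>Projected segments are the explicit competitors for the distance near the axis, where
  polar coordinates degenerate. The estimate holds for all \<open>F\<close> at once because it
  holds in both factors separately.\<close>

lemma proj_segment_path:
  fixes p v :: "(real^3) \<times> complex"
  assumes k: "0 < k" "\<And>t. t \<in> {0..1} \<Longrightarrow> k \<le> norm (fst (p + t *\<^sub>R v))" "\<And>t. t \<in> {0..1} \<Longrightarrow> k \<le> norm (snd (p + t *\<^sub>R v))"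
  shows "\<exists>D. C1_path S2xS1 (\<lambda>t. proj (p + t *\<^sub>R v)) D (proj p) (proj (p + v)) \<and>
    (\<forall>t\<in>{0..1}. \<forall>F. wnorm F (D t) \<le> wnorm F v / k)"
proof -
  have ex1: "\<exists>D. (\<forall>t\<in>{0..1}. ((\<lambda>t. sgn (fst p + t *\<^sub>R fst v)) has_vector_derivative D t) (at t)) \<and>
    continuous_on {0..1} D \<and> (\<forall>t\<in>{0..1}. norm (D t) \<le> norm (fst v) / k)"
    by (rule normalized_segment[OF k(1)]) (use k(2) in simp)
  have ex2: "\<exists>D. (\<forall>t\<in>{0..1}. ((\<lambda>t. sgn (snd p + t *\<^sub>R snd v)) has_vector_derivative D t) (at t)) \<and>
    continuous_on {0..1} D \<and> (\<forall>t\<in>{0..1}. norm (D t) \<le> norm (snd v) / k)"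
    by (rule normalized_segment[OF k(1)]) (use k(3) in simp)
  obtain D1 where D1: "\<And>t. t\<in>{0..1} \<Longrightarrow> ((\<lambda>t. sgn (fst p + t *\<^sub>R fst v)) has_vector_derivative D1 t) (at t)"
    "continuous_on {0..1} D1" "\<And>t. t\<in>{0..1} \<Longrightarrow> norm (D1 t) \<le> norm (fst v) / k"
    using ex1 by blast
  obtain D2 where D2: "\<And>t. t\<in>{0..1} \<Longrightarrow> ((\<lambda>t. sgn (snd p + t *\<^sub>R snd v)) has_vector_derivative D2 t) (at t)"
    "continuous_on {0..1} D2" "\<And>t. t\<in>{0..1} \<Longrightarrow> norm (D2 t) \<le> norm (snd v) / k"
    using ex2 by blast
  have eq: "(\<lambda>t. proj (p + t *\<^sub>R v)) = (\<lambda>t. (sgn (fst p + t *\<^sub>R fst v), sgn (snd p + t *\<^sub>R snd v)))"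
    by (simp add: proj_def)
  have "C1_path S2xS1 (\<lambda>t. proj (p + t *\<^sub>R v)) (\<lambda>t. (D1 t, D2 t)) (proj p) (proj (p + v))"
    unfolding C1_path_def
  proof (intro conjI ballI)
    fix t :: real assume "t \<in> {0..1}"
    then show "((\<lambda>t. proj (p + t *\<^sub>R v)) has_vector_derivative (D1 t, D2 t)) (at t)"
      unfolding eq by (intro has_vector_derivative_Pair D1 D2)
  next
    show "continuous_on {0..1} (\<lambda>t. (D1 t, D2 t))" by (intro continuous_on_Pair D1 D2)
    show "(\<lambda>t. proj (p + t *\<^sub>R v)) ` {0..1} \<subseteq> S2xS1"
    proof (rule image_subsetI)
      fix t :: real assume "t \<in> {0..1}"
      then have "fst (p + t *\<^sub>R v) \<noteq> 0" "snd (p + t *\<^sub>R v) \<noteq> 0" using k by fastforce+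
      then show "proj (p + t *\<^sub>R v) \<in> S2xS1" by (auto simp: proj_def S2xS1_def norm_sgn)
    qed
  qed auto
  moreover have "wnorm F (D1 t, D2 t) \<le> wnorm F v / k" if "t \<in> {0..1}" for t F
    using D1(3)[OF that] D2(3)[OF that] k(1) by (intro wnorm_le_scaled) auto
  ultimately show ?thesis by blast
qed

text \<open>A segment in polar coordinates. The value of \<open>F\<close> is left open so that the
  estimate applies to every warped metric.\<close>

lemma polar_path:
  fixes r0 r1 \<theta>0 \<theta>1 \<phi>0 \<phi>1 :: real
  assumes r: "0 \<le> r0" "r0 \<le> pi" "0 \<le> r1" "r1 \<le> pi"
  defines "R \<equiv> \<lambda>t. r0 + t * (r1 - r0)"
  shows "\<exists>D. C1_path S2xS1 (\<lambda>t. polar_point (R t) (\<theta>0 + t * (\<theta>1 - \<theta>0)) (\<phi>0 + t * (\<phi>1 - \<phi>0))) D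
      (polar_point r0 \<theta>0 \<phi>0) (polar_point r1 \<theta>1 \<phi>1) \<and>
    (\<forall>t\<in>{0..1}. 0 \<le> R t \<and> R t \<le> pi \<and> (\<forall>F. wnorm F (D t) =
       sqrt ((r1 - r0)\<^sup>2 + (sin (R t))\<^sup>2 * (\<theta>1 - \<theta>0)\<^sup>2 + F\<^sup>2 * (\<phi>1 - \<phi>0)\<^sup>2)))"
proof -
  let ?T = "\<lambda>t. \<theta>0 + t * (\<theta>1 - \<theta>0)" and ?P = "\<lambda>t. \<phi>0 + t * (\<phi>1 - \<phi>0)"
  let ?c = "\<lambda>t. polar_point (R t) (?T t) (?P t)"
  have vec: "(vector [a, b, d] :: real^3) = a *\<^sub>R axis 1 1 + b *\<^sub>R axis 2 1 + d *\<^sub>R axis 3 1"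
    for a b d :: real
    by (simp add: vec_eq_iff forall_3 axis_def)
  have ce: "cis y = cos y *\<^sub>R 1 + sin y *\<^sub>R \<i>" for y by (simp add: complex_eq_iff)
  have cc: "?c = (\<lambda>t. ((sin (R t) * cos (?T t)) *\<^sub>R axis 1 1 + (sin (R t) * sin (?T t)) *\<^sub>R axis 2 1 + cos (R t) *\<^sub>R axis 3 1,
     cos (?P t) *\<^sub>R 1 + sin (?P t) *\<^sub>R \<i>))"
    unfolding polar_point_def vec ce ..
  define D where "D = (\<lambda>t. ((cos (R t) * (r1 - r0) * cos (?T t) - sin (R t) * (sin (?T t) * (\<theta>1 - \<theta>0))) *\<^sub>R axis 1 1
     + (cos (R t) * (r1 - r0) * sin (?T t) + sin (R t) * (cos (?T t) * (\<theta>1 - \<theta>0))) *\<^sub>R axis 2 1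
     + (- (sin (R t) * (r1 - r0))) *\<^sub>R axis 3 1 :: real^3,
     (- sin (?P t) * (\<phi>1 - \<phi>0)) *\<^sub>R 1 + (cos (?P t) * (\<phi>1 - \<phi>0)) *\<^sub>R \<i>))"
  have dR: "(R has_real_derivative (r1 - r0)) (at t)" "(?T has_real_derivative (\<theta>1 - \<theta>0)) (at t)"
     "(?P has_real_derivative (\<phi>1 - \<phi>0)) (at t)" for t
    unfolding R_def by (auto intro!: derivative_eq_intros)
  have der: "(?c has_vector_derivative D t) (at t)" for t
  proof -
    have 1: "((\<lambda>t. sin (R t) * cos (?T t)) has_vector_derivative
        cos (R t) * (r1 - r0) * cos (?T t) - sin (R t) * (sin (?T t) * (\<theta>1 - \<theta>0))) (at t)"
      "((\<lambda>t. sin (R t) * sin (?T t)) has_vector_derivative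
        cos (R t) * (r1 - r0) * sin (?T t) + sin (R t) * (cos (?T t) * (\<theta>1 - \<theta>0))) (at t)"
      "((\<lambda>t. cos (R t)) has_vector_derivative - (sin (R t) * (r1 - r0))) (at t)"
      "((\<lambda>t. cos (?P t)) has_vector_derivative - sin (?P t) * (\<phi>1 - \<phi>0)) (at t)"
      "((\<lambda>t. sin (?P t)) has_vector_derivative cos (?P t) * (\<phi>1 - \<phi>0)) (at t)"
      unfolding has_real_derivative_iff_has_vector_derivative[symmetric]
      by (auto intro!: derivative_eq_intros dR simp: algebra_simps)
    show ?thesis unfolding cc D_def
      by (intro has_vector_derivative_Pair has_vector_derivative_add
        bounded_linear.has_vector_derivative[OF bounded_linear_scaleR_left] 1)
  qed
  have R01: "0 \<le> R t \<and> R t \<le> pi" if "t \<in> {0..1}" for t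
  proof -
    have eq: "R t = (1 - t) * r0 + t * r1" by (simp add: R_def algebra_simps)
    have "(1 - t) * r0 + t * r1 \<le> (1 - t) * pi + t * pi"
      using r that by (intro add_mono mult_left_mono) auto
    moreover have "(1 - t) * pi + t * pi = pi" by (simp add: algebra_simps)
    moreover have "0 \<le> (1 - t) * r0" "0 \<le> t * r1" using r that by auto
    ultimately show ?thesis unfolding eq by linarith
  qed
  have cD: "continuous_on {0..1} D" unfolding D_def R_def
    by (intro continuous_on_Pair continuous_on_add continuous_on_scaleR continuous_on_const continuous_intros)
  have "C1_path S2xS1 ?c D (?c 0) (?c 1)"
    unfolding C1_path_def using der cD polar_point_in by auto
  moreover have "wnorm F (D t) = sqrt ((r1 - r0)\<^sup>2 + (sin (R t))\<^sup>2 * (\<theta>1 - \<theta>0)\<^sup>2 + F\<^sup>2 * (\<phi>1 - \<phi>0)\<^sup>2)"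
    if t: "t \<in> {0..1}" for t F
  proof -
    obtain c' where c': "(?c has_vector_derivative c') (at t)"
      "warped_metric (\<lambda>_. F) (?c t) c' c' = (r1 - r0)\<^sup>2 + (sin (R t))\<^sup>2 * (\<theta>1 - \<theta>0)\<^sup>2 + F\<^sup>2 * (\<phi>1 - \<phi>0)\<^sup>2"
      by (rule warped_metric_polar[OF dR(1) conjunct1[OF R01[OF t]] conjunct2[OF R01[OF t]] dR(2) dR(3), where f = "\<lambda>_. F"])
    have "c' = D t" using vector_derivative_unique_at[OF c'(1) der] .
    then show ?thesis using c'(2) sqrt_warped_metric[of "\<lambda>_. F"] by metis
  qed
  ultimately show ?thesis using R01 by (intro exI[of _ D]) (simp add: R_def)
qed

section \<open>Distance to the axis\<close>

definition axis_dist :: "(real^3) \<times> complex \<Rightarrow> real" where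
  "axis_dist p = sqrt ((fst p $ 1)\<^sup>2 + (fst p $ 2)\<^sup>2)"

lemma S2xS1_coords: "p \<in> S2xS1 \<Longrightarrow> (fst p $ 1)\<^sup>2 + (fst p $ 2)\<^sup>2 + (fst p $ 3)\<^sup>2 = 1"
  by (auto simp: S2xS1_def norm_vec_def L2_set_def sum_3)

lemma axis_dist_sq: "p \<in> S2xS1 \<Longrightarrow> (axis_dist p)\<^sup>2 = 1 - (fst p $ 3)\<^sup>2"
  using S2xS1_coords[of p] by (simp add: axis_dist_def)

lemma axis_dist_nonneg [simp]: "0 \<le> axis_dist p" by (simp add: axis_dist_def)

lemma axis_dist_le_1: "p \<in> S2xS1 \<Longrightarrow> axis_dist p \<le> 1"
  using axis_dist_sq[of p] power2_le_imp_le[of "axis_dist p" 1] by simp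

lemma height_bound: "p \<in> S2xS1 \<Longrightarrow> \<bar>fst p $ 3\<bar> \<le> 1"
  using axis_dist_sq[of p] zero_le_power2[of "axis_dist p"] abs_square_le_1 by fastforce

lemma sin_polar_r: "p \<in> S2xS1 \<Longrightarrow> sin (polar_r p) = axis_dist p"
  unfolding polar_r_def using height_bound[of p] axis_dist_sq[of p]
  by (simp add: sin_arccos_abs) (metis axis_dist_nonneg real_sqrt_unique)

lemma polar_r_bounds: "p \<in> S2xS1 \<Longrightarrow> 0 \<le> polar_r p \<and> polar_r p \<le> pi"
  unfolding polar_r_def using height_bound[of p] arccos_lbound arccos_ubound by (auto simp: abs_le_iff)

lemma singular_set_eq: "singular_set = {p \<in> S2xS1. axis_dist p = 0}"
proof -
  have "(polar_r p = 0 \<or> polar_r p = pi) \<longleftrightarrow> axis_dist p = 0" if "p \<in> S2xS1" for p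
  proof -
    have "0 < sin (polar_r p)" if "0 < polar_r p" "polar_r p < pi" using sin_gt_zero that by blast
    then show ?thesis using sin_polar_r[OF that] polar_r_bounds[OF that] by force
  qed
  then show ?thesis by (auto simp: singular_set_def)
qed

lemma axis_dist_polar_point: "0 \<le> r \<Longrightarrow> r \<le> pi \<Longrightarrow> axis_dist (polar_point r \<theta> \<phi>) = sin r"
  using sin_polar_r[OF polar_point_in, of r \<theta> \<phi>] polar_r_polar_point[of r \<theta> \<phi>] by simp

lemma axis_dist_complex: "axis_dist p = cmod (Complex (fst p $ 1) (fst p $ 2))"
  by (simp add: axis_dist_def cmod_def)

lemma axis_dist_lipschitz: "\<bar>axis_dist p - axis_dist q\<bar> \<le> dist p q"
proof -
  have "\<bar>axis_dist p - axis_dist q\<bar> \<le> cmod (Complex (fst p $ 1) (fst p $ 2) - Complex (fst q $ 1) (fst q $ 2))"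
    unfolding axis_dist_complex by (rule norm_triangle_ineq3)
  also have "\<dots> \<le> dist (fst p) (fst q)"
    unfolding dist_norm norm_vec_def L2_set_def cmod_def
    by (intro real_sqrt_le_mono) (simp add: sum_3)
  also have "\<dots> \<le> dist p q" by (rule dist_fst_le)
  finally show ?thesis .
qed

section \<open>The warping functions in terms of the distance to the axis\<close>

text \<open>The warping functions in terms of \<open>s = sin r\<close>. The singular one is the case
  \<open>a = 0\<close>.\<close>

definition profile :: "real \<Rightarrow> real \<Rightarrow> real \<Rightarrow> real" where
  "profile \<beta> a s = ln ((1 + a) / (s\<^sup>2 + a)) + \<beta>"

lemma f_reg_profile: "p \<in> S2xS1 \<Longrightarrow> f_reg \<beta> a (polar_r p) = profile \<beta> a (axis_dist p)"
  by (simp add: f_reg_def profile_def sin_polar_r)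

lemma f_inf_profile: "p \<in> S2xS1 - singular_set \<Longrightarrow> f_inf \<beta> (polar_r p) = profile \<beta> 0 (axis_dist p)"
  using axis_dist_nonneg[of p]
  by (auto simp: f_inf_def profile_def sin_polar_r singular_set_eq ln_div ln_realpow)

lemma profile_antimono:
  assumes "0 \<le> a" "0 \<le> s" "s \<le> s'" "0 < a \<or> 0 < s"
  shows "profile \<beta> a s' \<le> profile \<beta> a s"
proof -
  have "0 < s\<^sup>2 + a" "s\<^sup>2 + a \<le> s'\<^sup>2 + a" using assms by (auto simp: add_pos_nonneg add_nonneg_pos power_mono)
  then show ?thesis using assms(1) by (simp add: profile_def divide_left_mono)
qed

lemma profile_ge: 
  assumes "0 \<le> a" "0 \<le> s" "s \<le> 1" "0 < a \<or> 0 < s"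
  shows "\<beta> \<le> profile \<beta> a s"
proof -
  have "profile \<beta> a 1 \<le> profile \<beta> a s" using assms by (intro profile_antimono) auto
  then show ?thesis using assms(1) by (simp add: profile_def)
qed

lemma profile_antimono_param:
  assumes "0 \<le> a" "a \<le> b" "0 \<le> s" "s \<le> 1" "0 < a \<or> 0 < s"
  shows "profile \<beta> b s \<le> profile \<beta> a s"
proof -
  have pos: "0 < s\<^sup>2 + a" "0 < s\<^sup>2 + b" using assms by (auto simp: add_pos_nonneg add_nonneg_pos)
  have "(1 + b) * (s\<^sup>2 + a) \<le> (1 + a) * (s\<^sup>2 + b)"
  proof -
    have "s\<^sup>2 \<le> 1" using assms by (simp add: power_le_one)
    then have "(b - a) * s\<^sup>2 \<le> (b - a) * 1" using assms by (intro mult_left_mono) auto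
    then show ?thesis by (simp add: algebra_simps)
  qed
  then have "(1 + b) / (s\<^sup>2 + b) \<le> (1 + a) / (s\<^sup>2 + a)" using pos by (simp add: divide_simps mult.commute)
  moreover have "0 < (1 + b) / (s\<^sup>2 + b)" using assms pos by auto
  ultimately show ?thesis using pos assms by (simp add: profile_def)
qed

text \<open>Away from the axis the profiles converge uniformly.\<close>

lemma profile_zero_le:
  assumes "0 \<le> a" "0 < s"
  shows "profile \<beta> 0 s \<le> profile \<beta> a s + a / s\<^sup>2"
proof -
  have s2: "0 < s\<^sup>2" using assms by simp
  have "ln (1 / s\<^sup>2) - ln ((1 + a) / (s\<^sup>2 + a)) = ln ((s\<^sup>2 + a) / s\<^sup>2) - ln (1 + a)"
  proof -
    have "ln (1 / q) - ln ((1 + a) / (q + a)) = ln ((q + a) / q) - ln (1 + a)" if "0 < q" for q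
      using assms(1) that by (simp add: ln_div)
    then show ?thesis using s2 .
  qed
  also have "\<dots> \<le> ln (1 + a / s\<^sup>2)" using assms s2 by (simp add: add_divide_distrib)
  also have "\<dots> \<le> a / s\<^sup>2" using assms by (intro ln_add_one_self_le_self) auto
  finally show ?thesis by (simp add: profile_def)
qed

lemma continuous_profile: "0 < a \<Longrightarrow> continuous_on UNIV (profile \<beta> a)" "continuous_on {0<..} (profile \<beta> 0)"
proof -
  assume a: "0 < a"
  have "s\<^sup>2 + a \<noteq> 0" for s using a by (metis add_nonneg_pos less_irrefl zero_le_power2)
  then show "continuous_on UNIV (profile \<beta> a)"
    unfolding profile_def using a by (intro continuous_on_add continuous_on_ln continuous_on_divide continuous_intros) auto
next
  show "continuous_on {0<..} (profile \<beta> 0)"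
    unfolding profile_def by (intro continuous_on_add continuous_on_ln continuous_on_divide continuous_intros) auto
qed

section \<open>The regular and singular spaces as length spaces\<close>

lemma continuous_axis_dist: "continuous_on A axis_dist"
  unfolding axis_dist_def by (intro continuous_intros)

lemma S2xS1_obtain_polar:
  assumes "p \<in> S2xS1"
  obtains \<theta> \<phi> where "p = polar_point (polar_r p) \<theta> \<phi>"
  using assms polar_r_polar_point unfolding S2xS1_polar by auto

lemma polar_r_regular: "p \<in> S2xS1 - singular_set \<longleftrightarrow> p \<in> S2xS1 \<and> 0 < polar_r p \<and> polar_r p < pi"
  using polar_r_bounds[of p] by (auto simp: singular_set_def)

lemma polar_point_regular: "0 < r \<Longrightarrow> r < pi \<Longrightarrow> polar_point r \<theta> \<phi> \<in> S2xS1 - singular_set"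
  by (simp add: singular_set_def polar_point_in polar_r_polar_point)

lemma connected_S2xS1:
  assumes "p \<in> S2xS1" "q \<in> S2xS1"
  shows "\<exists>c D. C1_path S2xS1 c D p q"
proof -
  obtain \<theta> \<phi> where p: "p = polar_point (polar_r p) \<theta> \<phi>" by (rule S2xS1_obtain_polar[OF assms(1)])
  obtain \<theta>' \<phi>' where q: "q = polar_point (polar_r q) \<theta>' \<phi>'" by (rule S2xS1_obtain_polar[OF assms(2)])
  show ?thesis
    using polar_path[of "polar_r p" "polar_r q" \<theta> \<theta>' \<phi> \<phi>', folded p q] polar_r_bounds[OF assms(1)] polar_r_bounds[OF assms(2)]
    by blast
qed

lemma connected_regular_part:
  assumes "p \<in> S2xS1 - singular_set" "q \<in> S2xS1 - singular_set"
  shows "\<exists>c D. C1_path (S2xS1 - singular_set) c D p q"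
proof -
  have p: "p \<in> S2xS1" "0 < polar_r p" "polar_r p < pi" and q: "q \<in> S2xS1" "0 < polar_r q" "polar_r q < pi"
    using assms polar_r_regular by auto
  obtain \<theta> \<phi> where pp: "p = polar_point (polar_r p) \<theta> \<phi>" by (rule S2xS1_obtain_polar[OF p(1)])
  obtain \<theta>' \<phi>' where qq: "q = polar_point (polar_r q) \<theta>' \<phi>'" by (rule S2xS1_obtain_polar[OF q(1)])
  obtain D where D: "C1_path S2xS1 (\<lambda>t. polar_point (polar_r p + t * (polar_r q - polar_r p)) (\<theta> + t * (\<theta>' - \<theta>)) (\<phi> + t * (\<phi>' - \<phi>))) D p q"
    using polar_path[of "polar_r p" "polar_r q" \<theta> \<theta>' \<phi> \<phi>', folded pp qq] p q by fastforce
  have "0 < polar_r p + t * (polar_r q - polar_r p)" "polar_r p + t * (polar_r q - polar_r p) < pi" if "t \<in> {0..1}" for t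
  proof -
    have eq: "polar_r p + t * (polar_r q - polar_r p) = (1 - t) * polar_r p + t * polar_r q" by (simp add: algebra_simps)
    have "{0<..<pi} = {x. 0 < x \<and> x < pi}" by auto
    then have "(1 - t) *\<^sub>R polar_r p + t *\<^sub>R polar_r q \<in> {0<..<pi}"
      using p q that by (intro convexD_alt[OF convex_real_interval(8)]) auto
    then show "0 < polar_r p + t * (polar_r q - polar_r p)" "polar_r p + t * (polar_r q - polar_r p) < pi"
      unfolding eq by auto
  qed
  then have "C1_path (S2xS1 - singular_set) (\<lambda>t. polar_point (polar_r p + t * (polar_r q - polar_r p)) (\<theta> + t * (\<theta>' - \<theta>)) (\<phi> + t * (\<phi>' - \<phi>))) D p q"
    by (intro C1_path_mono[OF D] polar_point_regular)
  then show ?thesis by (intro exI)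
qed

lemma warped_space_reg:
  assumes "1 \<le> \<beta>" "0 < a"
  shows "warped_space S2xS1 (f_reg \<beta> a)"
proof
  have "continuous_on S2xS1 (\<lambda>p. profile \<beta> a (axis_dist p))"
    by (intro continuous_on_compose2[OF continuous_profile(1)[OF assms(2)] continuous_axis_dist]) auto
  then show "continuous_on S2xS1 (\<lambda>p. f_reg \<beta> a (polar_r p))"
    by (rule continuous_on_eq) (simp add: f_reg_profile)
  show "1 \<le> f_reg \<beta> a (polar_r p)" if "p \<in> S2xS1" for p
    using profile_ge[of a "axis_dist p" \<beta>] assms axis_dist_le_1[OF that] by (simp add: f_reg_profile that)
qed (use connected_S2xS1 in blast)+

lemma warped_space_inf:
  assumes "1 \<le> \<beta>"
  shows "warped_space (S2xS1 - singular_set) (f_inf \<beta>)"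
proof
  have pos: "0 < axis_dist p" if "p \<in> S2xS1 - singular_set" for p
    using that axis_dist_nonneg[of p] unfolding singular_set_eq by (auto simp: less_le)
  have "continuous_on (S2xS1 - singular_set) (\<lambda>p. profile \<beta> 0 (axis_dist p))"
    by (intro continuous_on_compose2[OF continuous_profile(2) continuous_axis_dist]) (use pos in auto)
  then show "continuous_on (S2xS1 - singular_set) (\<lambda>p. f_inf \<beta> (polar_r p))"
    by (rule continuous_on_eq) (simp add: f_inf_profile)
  show "1 \<le> f_inf \<beta> (polar_r p)" if "p \<in> S2xS1 - singular_set" for p
    using profile_ge[of 0 "axis_dist p" \<beta>] assms axis_dist_le_1[of p] pos[OF that] that by (simp add: f_inf_profile)
qed (use connected_regular_part in blast)+

lemma warped_space_product: "warped_space S2xS1 (\<lambda>_. 1)"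
  by standard (use connected_S2xS1 in \<open>auto\<close>)

section \<open>Comparing warped metrics\<close>

lemma wnorm_le_mult:
  assumes "1 \<le> K" "0 \<le> F'" "F' \<le> K * F"
  shows "wnorm F' v \<le> K * wnorm F v"
proof -
  have "F'\<^sup>2 \<le> (K * F)\<^sup>2" using assms by (intro power_mono) auto
  moreover have "1 * (norm (fst v))\<^sup>2 \<le> K\<^sup>2 * (norm (fst v))\<^sup>2" using assms by (intro mult_right_mono) auto
  ultimately have "wnorm F' v \<le> sqrt (K\<^sup>2 * (norm (fst v))\<^sup>2 + (K * F)\<^sup>2 * (norm (snd v))\<^sup>2)"
    unfolding wnorm_eq by (intro real_sqrt_le_mono add_mono mult_right_mono) auto
  also have "\<dots> = sqrt (K\<^sup>2 * ((norm (fst v))\<^sup>2 + F\<^sup>2 * (norm (snd v))\<^sup>2))"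
    by (simp add: power_mult_distrib algebra_simps)
  also have "\<dots> = K * wnorm F v" using assms by (simp add: wnorm_eq real_sqrt_mult)
  finally show ?thesis .
qed

lemma riem_dist_mono:
  assumes 1: "warped_space N f" and 2: "warped_space N' f'" and sub: "N \<subseteq> N'"
    and le: "\<And>p. p \<in> N \<Longrightarrow> f' (polar_r p) \<le> f (polar_r p)" and pq: "p \<in> N" "q \<in> N"
  shows "riem_dist N' (warped_metric f') p q \<le> riem_dist N (warped_metric f) p q"
proof (rule field_le_epsilon)
  interpret A: warped_space N f by (rule 1)
  interpret B: warped_space N' f' by (rule 2)
  fix e :: real assume "0 < e"
  then obtain c D where c: "C1_path N c D p q" "integral {0..1} (A.speed c D) < A.d p q + e"
    using A.dist_less_obtain[OF pq, of "A.d p q + e"] by auto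
  have c': "C1_path N' c D p q" using C1_path_mono[OF c(1)] C1_pathD(3)[OF c(1)] sub by auto
  have "B.d p q \<le> integral {0..1} (B.speed c D)" by (rule B.dist_le_length[OF c'])
  also have "\<dots> \<le> integral {0..1} (A.speed c D)"
  proof (rule integral_le)
    show "B.speed c D t \<le> A.speed c D t" if "t \<in> {0..1}" for t
      unfolding A.speed_def B.speed_def
      using le[OF C1_pathD(3)[OF c(1) that]] B.ge1[OF C1_pathD(3)[OF c' that]] by (intro wnorm_mono) auto
  qed (use A.integrable_speed[OF c(1)] B.integrable_speed[OF c'] in auto)
  finally show "B.d p q \<le> A.d p q + e" using c(2) by simp
qed

lemma S2xS1_norms: "p \<in> S2xS1 \<Longrightarrow> norm (fst p) = 1 \<and> norm (snd p) = 1"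
  by (auto simp: S2xS1_def)

lemma norm_add_ge: "norm x - norm v \<le> norm (x + v)" for x v :: "'a::real_normed_vector"
  by (metis norm_diff_ineq)

lemma norm_components_le_dist:
  fixes p q :: "'a::real_normed_vector \<times> 'b::real_normed_vector"
  shows "norm (fst (q - p)) \<le> dist p q" "norm (snd (q - p)) \<le> dist p q"
  using dist_fst_le[of q p] dist_snd_le[of q p] by (simp_all add: dist_norm norm_minus_commute[of p q])

text \<open>For close points the segment in the ambient space stays outside the balls of radius
  \<open>1/2\<close> of both factors, and projecting it to the manifold at most doubles its
  speed.\<close>

lemma riem_dist_lipschitz:
  assumes "warped_space S2xS1 f" and F: "\<And>p. p \<in> S2xS1 \<Longrightarrow> f (polar_r p) \<le> F"
    and pq: "p \<in> S2xS1" "q \<in> S2xS1" "dist p q \<le> 1/2"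
  shows "riem_dist S2xS1 (warped_metric f) p q \<le> 2 * F * dist p q"
proof -
  interpret warped_space S2xS1 f by (rule assms)
  have nd: "norm (fst (q - p)) \<le> 1/2" "norm (snd (q - p)) \<le> 1/2"
    using pq(3) norm_components_le_dist[of q p] by linarith+
  have half: "1/2 \<le> norm (x + t *\<^sub>R v)" if "norm x = 1" "norm v \<le> 1/2" "t \<in> {0..1}" for x v :: "'b::real_normed_vector" and t
  proof -
    have "t * norm v \<le> 1 * (1/2)" using that by (intro mult_mono) auto
    then show ?thesis using norm_add_ge[of x "t *\<^sub>R v"] that by auto
  qed
  have ex: "\<exists>D. C1_path S2xS1 (\<lambda>t. proj (p + t *\<^sub>R (q - p))) D (proj p) (proj (p + (q - p))) \<and>
    (\<forall>t\<in>{0..1}. \<forall>F. wnorm F (D t) \<le> wnorm F (q - p) / (1/2))"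
    by (rule proj_segment_path) (use half S2xS1_norms[OF pq(1)] nd in auto)
  then obtain D where D: "C1_path S2xS1 (\<lambda>t. proj (p + t *\<^sub>R (q - p))) D p q"
     "\<And>t F. t\<in>{0..1} \<Longrightarrow> wnorm F (D t) \<le> wnorm F (q - p) / (1/2)"
    using pq by (auto simp: proj_id)
  have F1: "1 \<le> F" using ge1[OF pq(1)] F[OF pq(1)] by simp
  show ?thesis
  proof (rule dist_le_speed_bound[OF D(1)])
    fix t :: real assume t: "t \<in> {0..1}"
    have "speed (\<lambda>t. proj (p + t *\<^sub>R (q - p))) D t \<le> wnorm F (D t)"
      unfolding speed_def using F[OF C1_pathD(3)[OF D(1) t]] ge1[OF C1_pathD(3)[OF D(1) t]]
      by (intro wnorm_mono) auto
    also have "\<dots> \<le> 2 * wnorm F (q - p)" using D(2)[OF t, of F] by simp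
    also have "\<dots> \<le> 2 * (F * norm (q - p))" using wnorm_le_norm[OF F1, of "q - p"] by simp
    finally show "speed (\<lambda>t. proj (p + t *\<^sub>R (q - p))) D t \<le> 2 * F * dist p q"
      by (simp add: dist_norm norm_minus_commute)
  qed
qed

lemma angle_obtain:
  obtains \<psi> :: real where "0 \<le> \<psi>" "\<psi> < 2 * pi" "cos \<theta> = cos \<psi>" "sin \<theta> = sin \<psi>"
  using sincos_total_2pi[of "cos \<theta>" "sin \<theta>"] by auto

lemma S2xS1_obtain_polar_2pi:
  assumes "p \<in> S2xS1"
  obtains \<theta> \<phi> where "p = polar_point (polar_r p) \<theta> \<phi>" "0 \<le> \<theta>" "\<theta> < 2 * pi" "0 \<le> \<phi>" "\<phi> < 2 * pi"
proof -
  obtain \<theta>' \<phi>' where p: "p = polar_point (polar_r p) \<theta>' \<phi>'" by (rule S2xS1_obtain_polar[OF assms])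
  obtain \<theta> where t: "0 \<le> \<theta>" "\<theta> < 2 * pi" "cos \<theta>' = cos \<theta>" "sin \<theta>' = sin \<theta>" by (rule angle_obtain)
  obtain \<phi> where f: "0 \<le> \<phi>" "\<phi> < 2 * pi" "cos \<phi>' = cos \<phi>" "sin \<phi>' = sin \<phi>" by (rule angle_obtain)
  have "polar_point r \<theta>' \<phi>' = polar_point r \<theta> \<phi>" for r
    using t f by (simp add: polar_point_def complex_eq_iff)
  then show thesis using that p t f by metis
qed

lemma regular_part_dense:
  assumes "p \<in> S2xS1" "0 < e"
  shows "\<exists>p'\<in>S2xS1 - singular_set. dist p p' < e"
proof (cases "p \<in> singular_set")
  case False
  then show ?thesis using assms by (intro bexI[of _ p]) auto
next
  case True
  obtain \<theta> \<phi> where p: "p = polar_point (polar_r p) \<theta> \<phi>" by (rule S2xS1_obtain_polar[OF assms(1)])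
  let ?c = "\<lambda>t. polar_point (polar_r p + t * (pi/2 - polar_r p)) \<theta> \<phi>"
  have "\<exists>D. C1_path S2xS1 ?c D p (polar_point (pi/2) \<theta> \<phi>)"
    using polar_path[of "polar_r p" "pi/2" \<theta> \<theta> \<phi> \<phi>] polar_r_bounds[OF assms(1)] p by auto
  then have c: "continuous_on {0..1} ?c" using C1_pathD(6) by blast
  obtain \<delta> where \<delta>: "0 < \<delta>" "\<And>t. t \<in> {0..1} \<Longrightarrow> dist t 0 < \<delta> \<Longrightarrow> dist (?c t) (?c 0) < e"
    using c assms(2) unfolding continuous_on_iff by (metis atLeastAtMost_iff order_refl zero_le_one)
  define t where "t = min (1/2) (\<delta>/2)"
  have t: "0 < t" "t \<le> 1/2" "t < \<delta>" using \<delta> by (auto simp: t_def)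
  have r: "0 < polar_r p + t * (pi/2 - polar_r p)" "polar_r p + t * (pi/2 - polar_r p) < pi"
    using True t by (auto simp: singular_set_def mult_pos_pos field_simps)
  have "dist p (?c t) < e" using \<delta>(2)[of t] t p by (simp add: dist_commute)
  then show ?thesis using polar_point_regular[OF r] by blast
qed

text \<open>The distance to the axis is bounded from below through one horizontal direction, in which
  it is linear along segments.\<close>

lemma horizontal_inner_le_axis_dist:
  fixes m :: "real^3"
  assumes "m $ 3 = 0" "norm m = 1"
  shows "m \<bullet> fst p \<le> axis_dist p"
proof -
  let ?h = "vector [fst p $ 1, fst p $ 2, 0] :: real^3"
  have "m \<bullet> fst p = m \<bullet> ?h" using assms(1) by (simp add: inner_vec_def sum_3)
  also have "\<dots> \<le> norm m * norm ?h" by (rule norm_cauchy_schwarz)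
  also have "\<dots> = axis_dist p" using assms(2) by (simp add: axis_dist_def norm_vec_def L2_set_def sum_3)
  finally show ?thesis .
qed

lemma axis_dist_proj:
  assumes "fst p \<noteq> 0"
  shows "axis_dist (proj p) = axis_dist p / norm (fst p)"
proof -
  have "fst (proj p) $ i = fst p $ i / norm (fst p)" for i
    by (simp add: proj_def sgn_div_norm divide_inverse mult.commute)
  then have "axis_dist (proj p) = sqrt (((fst p $ 1)\<^sup>2 + (fst p $ 2)\<^sup>2) / (norm (fst p))\<^sup>2)"
    by (simp add: axis_dist_def power_divide add_divide_distrib)
  also have "\<dots> = axis_dist p / norm (fst p)" by (simp add: axis_dist_def real_sqrt_divide)
  finally show ?thesis .
qed

text \<open>A direction in which to push both ends of the segment from \<open>x\<close> to \<open>x +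
  d\<close> away from the axis: moving along \<open>d\<close> does not change the component along
  \<open>m\<close>.\<close>

lemma horizontal_normal_exists:
  fixes x d :: "real^3"
  obtains m :: "real^3" where "m $ 3 = 0" "norm m = 1" "m \<bullet> d = 0" "0 \<le> m \<bullet> x"
proof -
  have "\<exists>m :: real^3. m $ 3 = 0 \<and> norm m = 1 \<and> m \<bullet> d = 0"
  proof (cases "d $ 1 = 0 \<and> d $ 2 = 0")
    case True
    then show ?thesis
      by (intro exI[of _ "vector [1, 0, 0]"]) (simp add: inner_vec_def sum_3 norm_vec_def L2_set_def)
  next
    case False
    let ?n = "vector [- d $ 2, d $ 1, 0] :: real^3"
    have "?n \<noteq> 0" using False by (auto simp: vec_eq_iff forall_3)
    moreover have "?n \<bullet> d = 0" by (simp add: inner_vec_def sum_3)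
    moreover have "?n $ 3 = 0" by simp
    ultimately show ?thesis
      by (intro exI[of _ "sgn ?n"]) (simp add: norm_sgn sgn_div_norm)
  qed
  then obtain m :: "real^3" where m: "m $ 3 = 0" "norm m = 1" "m \<bullet> d = 0" by auto
  show thesis
  proof (cases "0 \<le> m \<bullet> x")
    case True then show ?thesis using that m by blast
  next
    case False then show ?thesis using that[of "- m"] m by auto
  qed
qed

section \<open>The singular distance near the axis\<close>

locale dissolving_metrics =
  fixes \<beta> :: real
  assumes \<beta>: "2 \<le> \<beta>"
begin

definition dreg :: "real \<Rightarrow> (real^3) \<times> complex \<Rightarrow> (real^3) \<times> complex \<Rightarrow> real" where
  "dreg a = riem_dist S2xS1 (warped_metric (f_reg \<beta> a))"

definition dsing :: "(real^3) \<times> complex \<Rightarrow> (real^3) \<times> complex \<Rightarrow> real" where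
  "dsing = riem_dist (S2xS1 - singular_set) (warped_metric (f_inf \<beta>))"

lemma reg: "0 < a \<Longrightarrow> warped_space S2xS1 (f_reg \<beta> a)"
  using \<beta> by (intro warped_space_reg) auto

sublocale sing: warped_space "S2xS1 - singular_set" "f_inf \<beta>"
  rewrites "riem_dist (S2xS1 - singular_set) (warped_metric (f_inf \<beta>)) = dsing"
  using \<beta> by (auto intro: warped_space_inf simp: dsing_def)

lemma axis_pos: "p \<in> S2xS1 - singular_set \<Longrightarrow> 0 < axis_dist p"
  using axis_dist_nonneg[of p] unfolding singular_set_eq by (auto simp: less_le)

lemma dreg_le_dsing:
  assumes "0 < a" "p \<in> S2xS1 - singular_set" "q \<in> S2xS1 - singular_set"
  shows "dreg a p q \<le> dsing p q"
  unfolding dreg_def dsing_def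
proof (rule riem_dist_mono[OF _ reg[OF assms(1)] _ _ assms(2,3)])
  show "warped_space (S2xS1 - singular_set) (f_inf \<beta>)" by unfold_locales
  show "f_reg \<beta> a (polar_r p) \<le> f_inf \<beta> (polar_r p)" if "p \<in> S2xS1 - singular_set" for p
    using that assms(1) axis_pos[OF that] axis_dist_le_1[of p]
    by (auto simp: f_reg_profile f_inf_profile intro!: profile_antimono_param)
qed auto

lemma dreg_lipschitz:
  assumes "0 < a" "p \<in> S2xS1" "q \<in> S2xS1" "dist p q \<le> 1/2"
  shows "dreg a p q \<le> 2 * profile \<beta> a 0 * dist p q"
  unfolding dreg_def
proof (rule riem_dist_lipschitz[OF reg[OF assms(1)] _ assms(2-4)])
  show "f_reg \<beta> a (polar_r p) \<le> profile \<beta> a 0" if "p \<in> S2xS1" for p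
    using assms(1) by (auto simp: f_reg_profile[OF that] intro!: profile_antimono)
qed

text \<open>The segment from \<open>p\<close> in the direction \<open>m\<close> does not move the
  circle factor, so the warping function does not contribute to its length, however large it
  is.\<close>

lemma dsing_push:
  assumes p: "p \<in> S2xS1 - singular_set" and r: "0 < \<rho>" "\<rho> \<le> 1/8"
    and m: "m $ 3 = 0" "norm m = 1" "0 \<le> m \<bullet> fst p"
  shows "proj (p + ((2 * \<rho>) *\<^sub>R m, 0)) \<in> S2xS1 - singular_set"
    "dsing p (proj (p + ((2 * \<rho>) *\<^sub>R m, 0))) \<le> 4 * \<rho>"
proof -
  let ?v = "((2 * \<rho>) *\<^sub>R m, 0) :: (real^3) \<times> complex"
  note n = S2xS1_norms[of p]
  have pS: "p \<in> S2xS1" using p by auto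
  have n1: "1/2 \<le> norm (fst (p + t *\<^sub>R ?v))" if "t \<in> {0..1}" for t
  proof -
    have "t * (2 * \<rho>) \<le> 1 * (2 * (1/8))" using that r by (intro mult_mono) auto
    then show ?thesis
      using norm_add_ge[of "fst p" "t *\<^sub>R fst ?v"] n pS m r that by (simp add: abs_mult)
  qed
  have ex: "\<exists>D. C1_path S2xS1 (\<lambda>t. proj (p + t *\<^sub>R ?v)) D (proj p) (proj (p + ?v)) \<and>
    (\<forall>t\<in>{0..1}. \<forall>F. wnorm F (D t) \<le> wnorm F ?v / (1/2))"
    by (rule proj_segment_path) (use n1 n pS in auto)
  then obtain D where D: "C1_path S2xS1 (\<lambda>t. proj (p + t *\<^sub>R ?v)) D p (proj (p + ?v))"
     "\<And>t F. t\<in>{0..1} \<Longrightarrow> wnorm F (D t) \<le> wnorm F ?v / (1/2)"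
    using pS by (auto simp: proj_id)
  have inR: "proj (p + t *\<^sub>R ?v) \<in> S2xS1 - singular_set" if t: "t \<in> {0..1}" for t
  proof (cases "t = 0")
    case True then show ?thesis using p pS by (simp add: proj_id zero_prod_def[symmetric])
  next
    case False
    then have "0 < t * (2 * \<rho>)" using t r by auto
    moreover have "m \<bullet> fst (p + t *\<^sub>R ?v) = m \<bullet> fst p + t * (2 * \<rho>)"
      using m(2) by (simp add: inner_add_right norm_eq_1)
    ultimately have "0 < axis_dist (p + t *\<^sub>R ?v)"
      using m(3) horizontal_inner_le_axis_dist[OF m(1,2), of "p + t *\<^sub>R ?v"] by linarith
    moreover have "fst (p + t *\<^sub>R ?v) \<noteq> 0" using n1[OF t] by auto
    ultimately have "axis_dist (proj (p + t *\<^sub>R ?v)) \<noteq> 0" by (simp add: axis_dist_proj)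
    then show ?thesis using C1_pathD(3)[OF D(1) t] by (simp add: singular_set_eq)
  qed
  then show "proj (p + ?v) \<in> S2xS1 - singular_set" using inR[of 1] by simp
  have D': "C1_path (S2xS1 - singular_set) (\<lambda>t. proj (p + t *\<^sub>R ?v)) D p (proj (p + ?v))"
    by (rule C1_path_mono[OF D(1) inR])
  show "dsing p (proj (p + ?v)) \<le> 4 * \<rho>"
  proof (rule sing.dist_le_speed_bound[OF D'])
    fix t :: real assume "t \<in> {0..1}"
    have half: "y / (1/2) = 2 * y" for y :: real by simp
    from D(2)[OF \<open>t \<in> {0..1}\<close>, unfolded half, of "f_inf \<beta> (polar_r (proj (p + t *\<^sub>R ?v)))"]
    have "sing.speed (\<lambda>t. proj (p + t *\<^sub>R ?v)) D t \<le> 2 * wnorm (f_inf \<beta> (polar_r (proj (p + t *\<^sub>R ?v)))) ?v"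
      unfolding sing.speed_def .
    also have "\<dots> = 4 * \<rho>" using m(2) r by (simp add: wnorm_eq real_sqrt_mult)
    finally show "sing.speed (\<lambda>t. proj (p + t *\<^sub>R ?v)) D t \<le> 4 * \<rho>" .
  qed
qed

text \<open>Push both points by \<open>2 * \<rho>\<close> in a horizontal direction \<open>m\<close>
  normal to the chord and join the pushed points by the projected segment. All points of the
  segment have component at least \<open>2 * \<rho>\<close> along \<open>m\<close> and norm at
  most 2, so after projection they have distance at least \<open>\<rho>\<close> from the axis,
  where the warping function is at most \<open>profile \<beta> 0 \<rho>\<close>. The denominator
  is the speed factor of the projection, the summand \<open>8 * \<rho>\<close> the cost of the two
  pushes.\<close>

lemma dsing_near:
  assumes p: "p \<in> S2xS1 - singular_set" and q: "q \<in> S2xS1 - singular_set"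
    and r: "0 < \<rho>" "\<rho> \<le> 1/8" and pq: "dist p q \<le> 1/4"
  shows "dsing p q \<le> 8 * \<rho> + wnorm (profile \<beta> 0 \<rho>) (q - p) / (1 - 2 * \<rho> - dist p q)"
proof -
  have pS: "p \<in> S2xS1" "q \<in> S2xS1" using p q by auto
  note n = S2xS1_norms[OF pS(1)] S2xS1_norms[OF pS(2)]
  obtain m :: "real^3" where m: "m $ 3 = 0" "norm m = 1" "m \<bullet> (fst q - fst p) = 0" "0 \<le> m \<bullet> fst p"
    by (rule horizontal_normal_exists)
  have mq: "0 \<le> m \<bullet> fst q" using m(3,4) by (simp add: inner_diff_right)
  define v where "v = ((2 * \<rho>) *\<^sub>R m, 0 :: complex)"
  define k where "k = 1 - 2 * \<rho> - dist p q"
  have k: "1/2 \<le> k" using r pq by (simp add: k_def)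
  note P = dsing_push[OF p r m(1,2,4), folded v_def] and Q = dsing_push[OF q r m(1,2) mq, folded v_def]
  note nd = norm_components_le_dist[of q p]
  have tn: "t * norm (fst (q - p)) \<le> dist p q" "t * norm (snd (q - p)) \<le> dist p q" if "t \<in> {0..1}" for t
    using mult_mono[of t 1 "norm (fst (q - p))" "dist p q"] mult_mono[of t 1 "norm (snd (q - p))" "dist p q"] nd that by auto
  have nv: "norm (fst v) = 2 * \<rho>" "snd v = 0" using m(2) r by (auto simp: v_def)
  have n1: "k \<le> norm (fst (p + v + t *\<^sub>R (q - p)))" "norm (fst (p + v + t *\<^sub>R (q - p))) \<le> 2"
     "k \<le> norm (snd (p + v + t *\<^sub>R (q - p)))" if t: "t \<in> {0..1}" for t
  proof -
    have *: "fst (p + v + t *\<^sub>R (q - p)) = fst p + (fst v + t *\<^sub>R fst (q - p))"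
       "snd (p + v + t *\<^sub>R (q - p)) = snd p + t *\<^sub>R snd (q - p)" using nv(2) by (simp_all add: add_ac)
    have "norm (fst v + t *\<^sub>R fst (q - p)) \<le> 2 * \<rho> + dist p q"
      using norm_triangle_ineq[of "fst v" "t *\<^sub>R fst (q - p)"] nv(1) tn(1)[OF t] t by auto
    then show "k \<le> norm (fst (p + v + t *\<^sub>R (q - p)))" "norm (fst (p + v + t *\<^sub>R (q - p))) \<le> 2"
      unfolding * using norm_add_ge[of "fst p" "fst v + t *\<^sub>R fst (q - p)"]
        norm_triangle_ineq[of "fst p" "fst v + t *\<^sub>R fst (q - p)"] n r pq by (auto simp: k_def)
    have "norm (t *\<^sub>R snd (q - p)) \<le> dist p q" using tn(2)[OF t] t by auto
    then show "k \<le> norm (snd (p + v + t *\<^sub>R (q - p)))"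
      unfolding * using norm_add_ge[of "snd p" "t *\<^sub>R snd (q - p)"] n r by (auto simp: k_def)
  qed
  let ?c = "\<lambda>t. proj (p + v + t *\<^sub>R (q - p))"
  have ex: "\<exists>D. C1_path S2xS1 ?c D (proj (p + v)) (proj (p + v + (q - p))) \<and>
    (\<forall>t\<in>{0..1}. \<forall>F. wnorm F (D t) \<le> wnorm F (q - p) / k)"
    by (rule proj_segment_path) (use n1 k in auto)
  have e: "p + v + (q - p) = q + v" by simp
  from ex obtain D where D: "C1_path S2xS1 ?c D (proj (p + v)) (proj (q + v))"
     "\<And>t F. t\<in>{0..1} \<Longrightarrow> wnorm F (D t) \<le> wnorm F (q - p) / k"
    unfolding e by blast
  have ax: "\<rho> \<le> axis_dist (?c t)" if t: "t \<in> {0..1}" for t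
  proof -
    have "m \<bullet> fst (p + v + t *\<^sub>R (q - p)) = m \<bullet> fst p + 2 * \<rho>"
      using m(2,3) by (simp add: v_def inner_add_right norm_eq_1)
    then have a: "2 * \<rho> \<le> axis_dist (p + v + t *\<^sub>R (q - p))"
      using horizontal_inner_le_axis_dist[OF m(1,2), of "p + v + t *\<^sub>R (q - p)"] m(4) by linarith
    have pos: "0 < norm (fst (p + v + t *\<^sub>R (q - p)))" using n1(1)[OF t] k by linarith
    have "\<rho> * norm (fst (p + v + t *\<^sub>R (q - p))) \<le> \<rho> * 2" using n1(2)[OF t] r by (intro mult_left_mono) auto
    then have "\<rho> \<le> axis_dist (p + v + t *\<^sub>R (q - p)) / norm (fst (p + v + t *\<^sub>R (q - p)))"
      using a pos by (simp add: pos_le_divide_eq)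
    then show ?thesis using pos by (subst axis_dist_proj) auto
  qed
  have inR: "?c t \<in> S2xS1 - singular_set" if t: "t \<in> {0..1}" for t
    using ax[OF t] r C1_pathD(3)[OF D(1) t] by (auto simp: singular_set_eq)
  have D': "C1_path (S2xS1 - singular_set) ?c D (proj (p + v)) (proj (q + v))"
    by (rule C1_path_mono[OF D(1) inR])
  have mid: "dsing (proj (p + v)) (proj (q + v)) \<le> wnorm (profile \<beta> 0 \<rho>) (q - p) / k"
  proof (rule sing.dist_le_speed_bound[OF D'])
    fix t :: real assume t: "t \<in> {0..1}"
    have "f_inf \<beta> (polar_r (?c t)) \<le> profile \<beta> 0 \<rho>"
      unfolding f_inf_profile[OF inR[OF t]] using ax[OF t] r by (intro profile_antimono) auto
    then have "sing.speed ?c D t \<le> wnorm (profile \<beta> 0 \<rho>) (D t)"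
      using sing.ge1[OF inR[OF t]] unfolding sing.speed_def by (intro wnorm_mono) auto
    then show "sing.speed ?c D t \<le> wnorm (profile \<beta> 0 \<rho>) (q - p) / k" using D(2)[OF t] order_trans by blast
  qed
  have "dsing p q \<le> dsing p (proj (p + v)) + dsing (proj (p + v)) q"
    by (rule sing.dist_triangle[OF p P(1) q])
  also have "dsing (proj (p + v)) q \<le> dsing (proj (p + v)) (proj (q + v)) + dsing (proj (q + v)) q"
    by (rule sing.dist_triangle[OF P(1) Q(1) q])
  also have "dsing (proj (q + v)) q = dsing q (proj (q + v))" by (rule sing.dist_sym)
  finally show ?thesis using P(2) Q(2) mid unfolding k_def[symmetric] by linarith
qed

section \<open>Uniform comparison of the regular and singular distances\<close>

lemma dist_le_dreg: "0 < a \<Longrightarrow> p \<in> S2xS1 \<Longrightarrow> q \<in> S2xS1 \<Longrightarrow> dist p q \<le> dreg a p q"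
  unfolding dreg_def by (rule warped_space.dist_le_riem_dist[OF reg])

text \<open>The last two properties are the only ways in which an almost shortest path is used near
  the axis: it does not leave a small neighbourhood of its starting point, and it is longer than
  the rescaled chord.\<close>

lemma dreg_obtain_path:
  assumes a: "0 < a" and pq: "p \<in> S2xS1" "q \<in> S2xS1" and L: "dreg a p q < L"
  obtains c D where "C1_path S2xS1 c D p q"
    "integral {0..1} (\<lambda>t. wnorm (profile \<beta> a (axis_dist (c t))) (D t)) < L"
    "(\<lambda>t. wnorm (profile \<beta> a (axis_dist (c t))) (D t)) integrable_on {0..1}"
    "\<And>t. t \<in> {0..1} \<Longrightarrow> \<bar>axis_dist (c t) - axis_dist p\<bar> < L"
    "\<And>F. 0 \<le> F \<Longrightarrow> (\<And>t. t \<in> {0..1} \<Longrightarrow> F \<le> profile \<beta> a (axis_dist (c t))) \<Longrightarrow> wnorm F (q - p) < L"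
proof -
  interpret A: warped_space S2xS1 "f_reg \<beta> a" by (rule reg[OF a])
  obtain c D where c: "C1_path S2xS1 c D p q" "integral {0..1} (A.speed c D) < L"
    using A.dist_less_obtain[OF pq] L unfolding dreg_def by metis
  have f: "f_reg \<beta> a (polar_r (c t)) = profile \<beta> a (axis_dist (c t))" if "t \<in> {0..1}" for t
    using C1_pathD(3)[OF c(1) that] by (rule f_reg_profile)
  then have sp: "A.speed c D t = wnorm (profile \<beta> a (axis_dist (c t))) (D t)" if "t \<in> {0..1}" for t
    using that by (simp add: A.speed_def)
  show thesis
  proof (rule that[OF c(1)])
    show "integral {0..1} (\<lambda>t. wnorm (profile \<beta> a (axis_dist (c t))) (D t)) < L"
      using c(2) integral_cong[of "{0..1}" "A.speed c D", OF sp] by simp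
    show "(\<lambda>t. wnorm (profile \<beta> a (axis_dist (c t))) (D t)) integrable_on {0..1}"
      using integrable_eq[OF A.integrable_speed[OF c(1), of 0 1] sp] by simp
    show "\<bar>axis_dist (c t) - axis_dist p\<bar> < L" if "t \<in> {0..1}" for t
      using A.dist_from_start_le_length[OF c(1) that] c(2) axis_dist_lipschitz[of "c t" p] by (simp add: dist_commute)
    show "wnorm F (q - p) < L" if "0 \<le> F" "\<And>t. t \<in> {0..1} \<Longrightarrow> F \<le> profile \<beta> a (axis_dist (c t))" for F
      using A.chord_le_length[OF c(1) that(1)] that(2) f c(2) by fastforce
  qed
qed

text \<open>The logarithm does not distinguish the scales \<open>\<delta> * x\<close> and \<open>3 *
  x\<close> to leading order. The factor in the denominator is the speed factor in
  \<open>dsing_near\<close> for \<open>\<rho> = \<delta> * x\<close> and points at distance at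
  most \<open>x\<close>.\<close>

lemma profile_ratio_tendsto:
  assumes "0 < \<delta>"
  shows "((\<lambda>x. profile \<beta> 0 (\<delta> * x) / ((1 - 2 * (\<delta> * x) - x) * profile \<beta> 0 (3 * x))) \<longlongrightarrow> 1) (at_right 0)"
  unfolding profile_def using assms by real_asymp

text \<open>The relative error comes from comparing the warping functions, the additive one from
  pushing the points away from the axis. If \<open>p\<close> has distance at least \<open>2 *
  l\<close> from the axis, an almost shortest path stays at distance at least \<open>l\<close>,
  where the two profiles are close, and is itself a competitor for \<open>dsing\<close>. Otherwise
  it stays within distance \<open>3 * l\<close>, and \<open>dsing_near\<close> with \<open>\<rho>
  = \<delta> * l\<close> applies.\<close>

lemma local_comparison:
  assumes \<eta>: "0 < \<eta>"
  obtains l \<alpha> where "0 < l" "l \<le> 1/8" "0 < \<alpha>"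
    "\<And>a p q L. 0 < a \<Longrightarrow> a \<le> \<alpha> \<Longrightarrow> p \<in> S2xS1 - singular_set \<Longrightarrow> q \<in> S2xS1 - singular_set \<Longrightarrow>
       dreg a p q < L \<Longrightarrow> L \<le> l \<Longrightarrow> dsing p q \<le> (1 + \<eta>) * L + \<eta> * l"
proof -
  \<comment> \<open>Chosen such that the cost \<open>8 * \<delta> * l\<close> of the two pushes is
  at most \<open>\<eta> * l\<close>.\<close>
  define \<delta> where "\<delta> = min \<eta> 1 / 16"
  have \<delta>: "0 < \<delta>" "\<delta> \<le> 1/16" "16 * \<delta> \<le> \<eta>" using \<eta> by (auto simp: \<delta>_def)
  have "eventually (\<lambda>x. profile \<beta> 0 (\<delta> * x) / ((1 - 2 * (\<delta> * x) - x) * profile \<beta> 0 (3 * x)) < 1 + \<eta> / 2) (at_right 0)"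
    using order_tendstoD(2)[OF profile_ratio_tendsto[OF \<delta>(1)], of "1 + \<eta> / 2"] \<eta> by simp
  moreover have "eventually (\<lambda>x::real. x \<in> {0<..<1/8}) (at_right 0)"
    by (rule eventually_at_right_real) simp
  ultimately have "eventually (\<lambda>x. profile \<beta> 0 (\<delta> * x) / ((1 - 2 * (\<delta> * x) - x) * profile \<beta> 0 (3 * x)) < 1 + \<eta> / 2 \<and> x \<in> {0<..<1/8}) (at_right 0)"
    by (rule eventually_conj)
  then obtain l where l: "profile \<beta> 0 (\<delta> * l) / ((1 - 2 * (\<delta> * l) - l) * profile \<beta> 0 (3 * l)) < 1 + \<eta> / 2" "0 < l" "l < 1/8"
    using eventually_happens'[OF trivial_limit_at_right_real] by fastforce
  define \<rho> where "\<rho> = \<delta> * l"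
  define k where "k = 1 - 2 * \<rho> - l"
  have \<rho>: "0 < \<rho>" "\<rho> \<le> 1/8" "\<rho> \<le> 3 * l"
    using \<delta> l mult_mono[of \<delta> "1/16" l "1/8"] mult_right_mono[of \<delta> 3 l] by (auto simp: \<rho>_def)
  have k: "0 < k" using \<rho> l by (simp add: k_def)
  define F0 where "F0 = profile \<beta> 0 \<rho>"
  have P3: "2 \<le> profile \<beta> 0 (3 * l)" using profile_ge[of 0 "3 * l" \<beta>] \<beta> l by auto
  have F0: "F0 \<le> (1 + \<eta> / 2) * (k * profile \<beta> 0 (3 * l))"
    using l(1) P3 k unfolding F0_def k_def \<rho>_def by (simp add: divide_less_eq mult_pos_pos less_imp_le)
  \<comment> \<open>Chosen such that \<open>a / l\<^sup>2\<close>, the bound of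
  \<open>profile_zero_le\<close> at distance at least \<open>l\<close>, is at most \<open>\<eta> /
  (1 + \<eta>)\<close>.\<close>
  define \<alpha> where "\<alpha> = l\<^sup>2 * \<eta> / (1 + \<eta>)"
  have \<alpha>: "0 < \<alpha>" using l \<eta> by (auto simp: \<alpha>_def)
  show thesis
  proof (rule that[of l \<alpha>])
    fix a p q L
    assume a: "0 < a" "a \<le> \<alpha>" and p: "p \<in> S2xS1 - singular_set" and q: "q \<in> S2xS1 - singular_set"
      and L: "dreg a p q < L" "L \<le> l"
    have pS: "p \<in> S2xS1" "q \<in> S2xS1" using p q by auto
    have "a * (1 + \<eta>) \<le> l\<^sup>2 * \<eta>" using a(2) \<eta> by (simp add: \<alpha>_def pos_le_divide_eq)
    then have al: "a / l\<^sup>2 * (1 + \<eta>) \<le> \<eta>" using l(2) by (simp add: field_simps)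
    have al1: "a / l\<^sup>2 \<le> \<eta>"
      using mult_left_mono[of 1 "1 + \<eta>" "a / l\<^sup>2"] al a \<eta> by simp
    obtain c D where c: "C1_path S2xS1 c D p q"
        "integral {0..1} (\<lambda>t. wnorm (profile \<beta> a (axis_dist (c t))) (D t)) < L"
        "(\<lambda>t. wnorm (profile \<beta> a (axis_dist (c t))) (D t)) integrable_on {0..1}"
        "\<And>t. t \<in> {0..1} \<Longrightarrow> \<bar>axis_dist (c t) - axis_dist p\<bar> < L"
        "\<And>F. 0 \<le> F \<Longrightarrow> (\<And>t. t \<in> {0..1} \<Longrightarrow> F \<le> profile \<beta> a (axis_dist (c t))) \<Longrightarrow> wnorm F (q - p) < L"
      by (rule dreg_obtain_path[OF a(1) pS L(1)]) blast
    have L0: "0 < L" using dist_le_dreg[OF a(1) pS] L(1) zero_le_dist[of p q] by linarith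
    show "dsing p q \<le> (1 + \<eta>) * L + \<eta> * l"
    proof (cases "2 * l \<le> axis_dist p")
      case True
      have far: "l \<le> axis_dist (c t)" if "t \<in> {0..1}" for t using c(4)[OF that] True L by linarith
      have R: "c t \<in> S2xS1 - singular_set" if "t \<in> {0..1}" for t
        using C1_pathD(3)[OF c(1) that] far[OF that] l by (auto simp: singular_set_eq)
      have c': "C1_path (S2xS1 - singular_set) c D p q" by (rule C1_path_mono[OF c(1) R])
      have "dsing p q \<le> integral {0..1} (sing.speed c D)" by (rule sing.dist_le_length[OF c'])
      also have "\<dots> \<le> integral {0..1} (\<lambda>t. (1 + \<eta>) * wnorm (profile \<beta> a (axis_dist (c t))) (D t))"
      proof (rule integral_le)
        show "sing.speed c D integrable_on {0..1}" by (rule sing.integrable_speed[OF c']) auto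
        show "(\<lambda>t. (1 + \<eta>) * wnorm (profile \<beta> a (axis_dist (c t))) (D t)) integrable_on {0..1}"
          using integrable_cmul[OF c(3), of "1 + \<eta>"] by simp
        fix t :: real assume t: "t \<in> {0..1}"
        let ?s = "axis_dist (c t)"
        have s: "0 < ?s" "?s \<le> 1" using far[OF t] l axis_dist_le_1[OF C1_pathD(3)[OF c(1) t]] by auto
        have "1 \<le> profile \<beta> a ?s" using profile_ge[of a ?s \<beta>] \<beta> a s by auto
        then have "\<eta> * 1 \<le> \<eta> * profile \<beta> a ?s" using \<eta> by (intro mult_left_mono) auto
        moreover have "a / ?s\<^sup>2 \<le> a / l\<^sup>2"
          using far[OF t] l a s by (intro divide_left_mono power_mono mult_pos_pos) auto
        ultimately have "profile \<beta> 0 ?s \<le> (1 + \<eta>) * profile \<beta> a ?s"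
          using profile_zero_le[of a ?s \<beta>] a s al1 by (simp add: algebra_simps)
        moreover have "0 \<le> profile \<beta> 0 ?s" using profile_ge[of 0 ?s \<beta>] \<beta> s by auto
        ultimately show "sing.speed c D t \<le> (1 + \<eta>) * wnorm (profile \<beta> a ?s) (D t)"
          unfolding sing.speed_def f_inf_profile[OF R[OF t]] using \<eta> by (intro wnorm_le_mult) auto
      qed
      also have "\<dots> \<le> (1 + \<eta>) * L" using c(2) \<eta> by simp
      finally show ?thesis using \<eta> l by (simp add: add_increasing2)
    next
      case False
      define F where "F = profile \<beta> a (3 * l)"
      have F2: "2 \<le> F" using profile_ge[of a "3 * l" \<beta>] \<beta> l a by (auto simp: F_def)
      have FF: "F \<le> F0"
        using profile_antimono_param[of 0 a "3 * l" \<beta>] profile_antimono[of 0 \<rho> "3 * l" \<beta>] a l \<rho>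
        by (auto simp: F_def F0_def)
      have chord: "wnorm F (q - p) < L"
      proof (rule c(5))
        show "F \<le> profile \<beta> a (axis_dist (c t))" if "t \<in> {0..1}" for t
          unfolding F_def using c(4)[OF that] False L a by (intro profile_antimono) auto
      qed (use F2 in simp)
      have F0F: "F0 \<le> k * (1 + \<eta>) * F"
      proof -
        have "profile \<beta> 0 (3 * l) \<le> F + a / l\<^sup>2"
        proof -
          have "a / (3 * l)\<^sup>2 \<le> a / l\<^sup>2" using a l by (intro divide_left_mono) (auto simp: power_mult_distrib)
          then show ?thesis using profile_zero_le[of a "3 * l" \<beta>] a l by (simp add: F_def)
        qed
        moreover have "(1 + \<eta> / 2) * P \<le> (1 + \<eta>) * F" if "P \<le> F + x" "x * (1 + \<eta>) \<le> \<eta>" "0 \<le> x" for P x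
        proof -
          have "2 * \<eta> \<le> F * \<eta>" "0 \<le> x * \<eta>" using F2 \<eta> that by (auto intro: mult_right_mono)
          moreover have "(1 + \<eta> / 2) * P \<le> (1 + \<eta> / 2) * (F + x)" using that(1) \<eta> by (intro mult_left_mono) auto
          moreover have "(1 + \<eta> / 2) * (F + x) = F + F * \<eta> / 2 + x + x * \<eta> / 2" "(1 + \<eta>) * F = F + F * \<eta>"
            "x * (1 + \<eta>) = x + x * \<eta>" by (simp_all add: algebra_simps)
          ultimately show ?thesis using that(2) by linarith
        qed
        ultimately have "(1 + \<eta> / 2) * profile \<beta> 0 (3 * l) \<le> (1 + \<eta>) * F" using al a(1) by fastforce
        then have "k * ((1 + \<eta> / 2) * profile \<beta> 0 (3 * l)) \<le> k * ((1 + \<eta>) * F)" using k by (intro mult_left_mono) auto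
        also have "k * ((1 + \<eta> / 2) * profile \<beta> 0 (3 * l)) = (1 + \<eta> / 2) * (k * profile \<beta> 0 (3 * l))" by (rule mult.left_commute)
        finally show ?thesis using F0 by (simp only: mult.assoc)
      qed
      have dpq: "dist p q \<le> l" using dist_le_dreg[OF a(1) pS] L by simp
      have k': "k \<le> 1 - 2 * \<rho> - dist p q" using dpq by (simp add: k_def)
      have "dsing p q \<le> 8 * \<rho> + wnorm F0 (q - p) / (1 - 2 * \<rho> - dist p q)"
        unfolding F0_def using dpq l by (intro dsing_near[OF p q \<rho>(1,2)]) auto
      also have "wnorm F0 (q - p) / (1 - 2 * \<rho> - dist p q) \<le> wnorm F0 (q - p) / k"
        using k k' by (intro divide_left_mono mult_pos_pos) auto
      also have "wnorm F0 (q - p) \<le> F0 / F * wnorm F (q - p)"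
        using F2 FF by (intro wnorm_le_mult) auto
      also have "F0 / F * wnorm F (q - p) \<le> (k * (1 + \<eta>)) * L"
        using F0F F2 FF chord L0 k \<eta> by (intro mult_mono) (auto simp: pos_divide_le_eq)
      also have "(k * (1 + \<eta>)) * L / k = (1 + \<eta>) * L" using k by simp
      finally have "dsing p q \<le> 8 * \<rho> + (1 + \<eta>) * L" using k by (simp add: divide_right_mono)
      moreover have "8 * \<rho> \<le> \<eta> * l" using \<delta> l mult_right_mono[of "8 * \<delta>" \<eta> l] by (simp add: \<rho>_def)
      ultimately show ?thesis by simp
    qed
  qed (use l \<alpha> in auto)
qed

text \<open>The intermediate point is moved off the singular set, so that \<open>dsing\<close> is
  meaningful at the end points of both halves.\<close>

lemma dreg_split:
  assumes a: "0 < a" and pq: "p \<in> S2xS1" "q \<in> S2xS1" and less: "dreg a p q < s + u" and su: "0 < s" "0 < u"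
  shows "\<exists>m\<in>S2xS1 - singular_set. dreg a p m < s \<and> dreg a m q < u"
proof -
  interpret A: warped_space S2xS1 "f_reg \<beta> a" rewrites "riem_dist S2xS1 (warped_metric (f_reg \<beta> a)) = dreg a"
    using reg[OF a] by (auto simp: dreg_def)
  obtain m where m: "m \<in> S2xS1" "dreg a p m < s" "dreg a m q < u" using A.dist_split[OF pq less su] by auto
  define F where "F = profile \<beta> a 0"
  have F: "0 < F" using profile_ge[of a 0 \<beta>] \<beta> a by (auto simp: F_def)
  define e where "e = min (s - dreg a p m) (u - dreg a m q)"
  have e: "0 < e" using m by (simp add: e_def)
  obtain m' where m': "m' \<in> S2xS1 - singular_set" "dist m m' < min (1/2) (e / (2 * F))"
    using regular_part_dense[OF m(1), of "min (1/2) (e / (2 * F))"] e F by auto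
  have "dreg a m m' \<le> 2 * F * dist m m'" unfolding F_def using m m' a by (intro dreg_lipschitz) auto
  also have "\<dots> < e" using m'(2) F by (simp add: field_simps)
  finally have d: "dreg a m m' < e" .
  have "dreg a p m' < s" using A.dist_triangle[of p m m'] pq m m' d by (auto simp: e_def)
  moreover have "dreg a m' q < u" using A.dist_triangle[of m' m q] A.dist_sym[of m m'] pq m m' d by (auto simp: e_def)
  ultimately show ?thesis using m' by auto
qed

text \<open>Split off pieces of length \<open>l\<close> one by one. The relative errors apply to a
  total length of \<open>L\<close>, and each of the \<open>n\<close> pieces contributes one
  additive error.\<close>

lemma chained_comparison:
  fixes n :: nat
  assumes a: "0 < a" and l: "0 < l" "0 < \<eta>"
    and loc: "\<And>p q L. p \<in> S2xS1 - singular_set \<Longrightarrow> q \<in> S2xS1 - singular_set \<Longrightarrow>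
       dreg a p q < L \<Longrightarrow> L \<le> l \<Longrightarrow> dsing p q \<le> (1 + \<eta>) * L + \<eta> * l"
    and pq: "p \<in> S2xS1 - singular_set" "q \<in> S2xS1 - singular_set" and L: "dreg a p q < L" "L \<le> real n * l"
  shows "dsing p q \<le> (1 + \<eta>) * L + real n * \<eta> * l"
  using pq L
proof (induction n arbitrary: p L)
  case 0
  then have "dreg a p q < 0" by simp
  then show ?case using dist_le_dreg[OF a, of p q] 0 zero_le_dist[of p q] by auto
next
  case (Suc n)
  show ?case
  proof (cases "L \<le> l")
    case True
    then have "dsing p q \<le> (1 + \<eta>) * L + \<eta> * l" using loc Suc.prems by blast
    moreover have "\<eta> * l \<le> real (Suc n) * \<eta> * l" using l by (simp add: algebra_simps)
    ultimately show ?thesis by linarith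
  next
    case False
    then obtain m where m: "m \<in> S2xS1 - singular_set" "dreg a p m < l" "dreg a m q < L - l"
      using dreg_split[OF a, of p q l "L - l"] Suc.prems l by auto
    have "dsing m q \<le> (1 + \<eta>) * (L - l) + real n * \<eta> * l"
      using Suc.IH[of m "L - l"] m Suc.prems by (simp add: algebra_simps)
    moreover have "dsing p m \<le> (1 + \<eta>) * l + \<eta> * l" using loc[of p m l] m Suc.prems by auto
    moreover have "dsing p q \<le> dsing p m + dsing m q"
      using sing.dist_triangle[of p m q] Suc.prems m by auto
    ultimately show ?thesis by (simp add: algebra_simps)
  qed
qed

lemma dsing_polar_le:
  assumes r: "0 < r0" "r0 < pi" "0 < r1" "r1 < pi" and s: "0 < s"
    and bd: "\<And>r. r \<in> closed_segment r0 r1 \<Longrightarrow> s \<le> sin r \<and> sin r \<le> S"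
  shows "dsing (polar_point r0 \<theta>0 \<phi>0) (polar_point r1 \<theta>1 \<phi>1)
    \<le> sqrt ((r1 - r0)\<^sup>2 + S\<^sup>2 * (\<theta>1 - \<theta>0)\<^sup>2 + (profile \<beta> 0 s)\<^sup>2 * (\<phi>1 - \<phi>0)\<^sup>2)"
proof -
  let ?R = "\<lambda>t. r0 + t * (r1 - r0)"
  let ?c = "\<lambda>t. polar_point (?R t) (\<theta>0 + t * (\<theta>1 - \<theta>0)) (\<phi>0 + t * (\<phi>1 - \<phi>0))"
  obtain D where D: "C1_path S2xS1 ?c D (polar_point r0 \<theta>0 \<phi>0) (polar_point r1 \<theta>1 \<phi>1)"
    "\<And>t. t\<in>{0..1} \<Longrightarrow> 0 \<le> ?R t \<and> ?R t \<le> pi \<and> (\<forall>F. wnorm F (D t) =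
       sqrt ((r1 - r0)\<^sup>2 + (sin (?R t))\<^sup>2 * (\<theta>1 - \<theta>0)\<^sup>2 + F\<^sup>2 * (\<phi>1 - \<phi>0)\<^sup>2))"
    using polar_path[of r0 r1 \<theta>0 \<theta>1 \<phi>0 \<phi>1] r by fastforce
  have seg: "?R t \<in> closed_segment r0 r1" if "t \<in> {0..1}" for t
    unfolding closed_segment_def using that by (auto intro!: exI[of _ t] simp: algebra_simps)
  have ax: "axis_dist (?c t) = sin (?R t)" if "t \<in> {0..1}" for t
    using D(2)[OF that] by (intro axis_dist_polar_point) auto
  have R: "?c t \<in> S2xS1 - singular_set" if "t \<in> {0..1}" for t
    using ax[OF that] bd[OF seg[OF that]] s polar_point_in by (auto simp: singular_set_eq)
  have D': "C1_path (S2xS1 - singular_set) ?c D (polar_point r0 \<theta>0 \<phi>0) (polar_point r1 \<theta>1 \<phi>1)"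
    by (rule C1_path_mono[OF D(1) R])
  show ?thesis
  proof (rule sing.dist_le_speed_bound[OF D'])
    fix t :: real assume t: "t \<in> {0..1}"
    have b: "s \<le> sin (?R t)" "sin (?R t) \<le> S" using bd[OF seg[OF t]] by auto
    have "f_inf \<beta> (polar_r (?c t)) = profile \<beta> 0 (sin (?R t))"
      using f_inf_profile[OF R[OF t]] ax[OF t] by simp
    moreover have "profile \<beta> 0 (sin (?R t)) \<le> profile \<beta> 0 s" using b s by (intro profile_antimono) auto
    moreover have "0 \<le> profile \<beta> 0 (sin (?R t))" using profile_ge[of 0 "sin (?R t)" \<beta>] b s \<beta> by auto
    ultimately have "sing.speed ?c D t \<le> wnorm (profile \<beta> 0 s) (D t)"
      unfolding sing.speed_def by (simp add: wnorm_mono)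
    also have "\<dots> \<le> sqrt ((r1 - r0)\<^sup>2 + S\<^sup>2 * (\<theta>1 - \<theta>0)\<^sup>2 + (profile \<beta> 0 s)\<^sup>2 * (\<phi>1 - \<phi>0)\<^sup>2)"
      using D(2)[OF t] b s by (auto intro!: real_sqrt_le_mono add_right_mono mult_right_mono power_mono)
    finally show "sing.speed ?c D t \<le> sqrt ((r1 - r0)\<^sup>2 + S\<^sup>2 * (\<theta>1 - \<theta>0)\<^sup>2 + (profile \<beta> 0 s)\<^sup>2 * (\<phi>1 - \<phi>0)\<^sup>2)" .
  qed
qed

text \<open>Go along the meridian to the equator \<open>r = pi / 2\<close>, along the equator, and
  back; meridians have length at most \<open>pi / 2\<close> whatever the warping function.\<close>

lemma dsing_bounded:
  obtains B where "0 < B" "\<And>p q. p \<in> S2xS1 - singular_set \<Longrightarrow> q \<in> S2xS1 - singular_set \<Longrightarrow> dsing p q \<le> B"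
proof -
  define B where "B = pi + sqrt ((2 * pi)\<^sup>2 + (profile \<beta> 0 1)\<^sup>2 * (2 * pi)\<^sup>2)"
  have "dsing p q \<le> B" if p: "p \<in> S2xS1 - singular_set" and q: "q \<in> S2xS1 - singular_set" for p q
  proof -
    have radial: "dsing (polar_point r \<theta> \<phi>) (polar_point (pi/2) \<theta> \<phi>) \<le> pi / 2" if r: "0 < r" "r < pi" for r \<theta> \<phi>
    proof -
      have "\<exists>s>0. \<forall>x\<in>closed_segment r (pi/2). s \<le> sin x"
      proof -
        have "continuous_on (closed_segment r (pi/2)) sin" by (intro continuous_intros)
        then obtain x where x: "x \<in> closed_segment r (pi/2)" "\<And>y. y \<in> closed_segment r (pi/2) \<Longrightarrow> sin x \<le> sin y"
          using continuous_attains_inf[of "closed_segment r (pi/2)" sin] by auto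
        have "0 < sin x" using x(1) r by (intro sin_gt_zero) (auto simp: closed_segment_eq_real_ivl split: if_splits)
        then show ?thesis using x(2) by blast
      qed
      then obtain s where s: "0 < s" "\<And>x. x \<in> closed_segment r (pi/2) \<Longrightarrow> s \<le> sin x" by auto
      have "dsing (polar_point r \<theta> \<phi>) (polar_point (pi/2) \<theta> \<phi>) \<le> sqrt ((pi/2 - r)\<^sup>2 + 1\<^sup>2 * (\<theta> - \<theta>)\<^sup>2 + (profile \<beta> 0 s)\<^sup>2 * (\<phi> - \<phi>)\<^sup>2)"
        using r s by (intro dsing_polar_le[where s = s]) auto
      also have "\<dots> = \<bar>pi/2 - r\<bar>" by simp
      finally show ?thesis using r by (simp add: abs_if split: if_splits)
    qed
    obtain \<theta> \<phi> where pp: "p = polar_point (polar_r p) \<theta> \<phi>" "0 \<le> \<theta>" "\<theta> < 2 * pi" "0 \<le> \<phi>" "\<phi> < 2 * pi"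
      using S2xS1_obtain_polar_2pi[of p] p by blast
    obtain \<theta>' \<phi>' where qq: "q = polar_point (polar_r q) \<theta>' \<phi>'" "0 \<le> \<theta>'" "\<theta>' < 2 * pi" "0 \<le> \<phi>'" "\<phi>' < 2 * pi"
      using S2xS1_obtain_polar_2pi[of q] q by blast
    let ?p = "polar_point (pi/2) \<theta> \<phi>" and ?q = "polar_point (pi/2) \<theta>' \<phi>'"
    have R: "?p \<in> S2xS1 - singular_set" "?q \<in> S2xS1 - singular_set" using polar_point_regular[of "pi/2"] by auto
    have 1: "dsing p ?p \<le> pi / 2" "dsing q ?q \<le> pi / 2"
      using radial[of "polar_r p" \<theta> \<phi>] radial[of "polar_r q" \<theta>' \<phi>'] p q pp(1) qq(1) polar_r_regular by auto
    have "dsing ?p ?q \<le> sqrt ((pi/2 - pi/2)\<^sup>2 + 1\<^sup>2 * (\<theta>' - \<theta>)\<^sup>2 + (profile \<beta> 0 1)\<^sup>2 * (\<phi>' - \<phi>)\<^sup>2)"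
    proof (intro dsing_polar_le)
      fix r :: real assume "r \<in> closed_segment (pi/2) (pi/2)"
      then have r: "r = pi / 2" by (simp only: closed_segment_idem singleton_iff)
      show "1 \<le> sin r \<and> sin r \<le> 1" unfolding r by simp
    qed auto
    also have "\<dots> \<le> sqrt ((2 * pi)\<^sup>2 + (profile \<beta> 0 1)\<^sup>2 * (2 * pi)\<^sup>2)"
    proof -
      have "(\<theta>' - \<theta>)\<^sup>2 \<le> (2 * pi)\<^sup>2" "(\<phi>' - \<phi>)\<^sup>2 \<le> (2 * pi)\<^sup>2"
        using pp(2-) qq(2-) abs_le_square_iff[of "\<theta>' - \<theta>" "2 * pi"] abs_le_square_iff[of "\<phi>' - \<phi>" "2 * pi"]
        by (simp_all only: abs_le_iff) linarith+
      then show ?thesis by (intro real_sqrt_le_mono) (simp add: add_mono mult_left_mono)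
    qed
    finally have 2: "dsing ?p ?q \<le> sqrt ((2 * pi)\<^sup>2 + (profile \<beta> 0 1)\<^sup>2 * (2 * pi)\<^sup>2)" .
    have "dsing p q \<le> dsing p ?p + dsing ?p q" by (rule sing.dist_triangle[OF p R(1) q])
    also have "dsing ?p q \<le> dsing ?p ?q + dsing ?q q" by (rule sing.dist_triangle[OF R q])
    finally show ?thesis using 1 2 sing.dist_sym[of q ?q] by (simp add: B_def)
  qed
  moreover have "0 < B" by (simp add: B_def add_pos_nonneg)
  ultimately show thesis using that by blast
qed

text \<open>The number of pieces in the chained comparison is about \<open>L / l\<close>, so the
  additive errors \<open>\<eta> * l\<close> sum up to about \<open>\<eta> * L\<close>, which is
  small as \<open>dsing\<close> is bounded.\<close>

lemma uniform_comparison: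
  assumes e: "0 < e"
  obtains \<alpha> where "0 < \<alpha>"
    "\<And>a p q. 0 < a \<Longrightarrow> a \<le> \<alpha> \<Longrightarrow> p \<in> S2xS1 - singular_set \<Longrightarrow> q \<in> S2xS1 - singular_set \<Longrightarrow>
       dsing p q \<le> dreg a p q + e"
proof -
  obtain B where B: "0 < B" "\<And>p q. p \<in> S2xS1 - singular_set \<Longrightarrow> q \<in> S2xS1 - singular_set \<Longrightarrow> dsing p q \<le> B"
    by (rule dsing_bounded) blast
  define \<eta> where "\<eta> = min 1 (e / (2 * B + 4))"
  have \<eta>: "0 < \<eta>" "\<eta> \<le> 1" "\<eta> \<le> e / (2 * B + 4)"
    using e B(1) by (auto simp: \<eta>_def)
  then have \<eta>e: "\<eta> * (2 * B + 4) \<le> e" using B(1) by (simp add: pos_le_divide_eq)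
  obtain l \<alpha> where l: "0 < l" "l \<le> 1/8" "0 < \<alpha>"
    "\<And>a p q L. 0 < a \<Longrightarrow> a \<le> \<alpha> \<Longrightarrow> p \<in> S2xS1 - singular_set \<Longrightarrow> q \<in> S2xS1 - singular_set \<Longrightarrow>
       dreg a p q < L \<Longrightarrow> L \<le> l \<Longrightarrow> dsing p q \<le> (1 + \<eta>) * L + \<eta> * l"
    by (rule local_comparison[OF \<eta>(1)]) blast
  show thesis
  proof (rule that[OF l(3)])
    fix a p q assume a: "0 < a" "a \<le> \<alpha>" and p: "p \<in> S2xS1 - singular_set" and q: "q \<in> S2xS1 - singular_set"
    define L where "L = dreg a p q + \<eta>"
    have L: "dreg a p q < L" "0 \<le> L"
      using \<eta> order_trans[OF zero_le_dist dist_le_dreg[OF a(1), of p q]] p q by (auto simp: L_def)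
    \<comment> \<open>The number of pieces of length \<open>l\<close>.\<close>
    define n where "n = nat \<lceil>L / l\<rceil>"
    have n: "L / l \<le> real n" "real n \<le> L / l + 1" using L l by (auto simp: n_def)
    have nl: "L \<le> real n * l" "real n * l \<le> L + l" using n l by (auto simp: field_simps)
    have "dsing p q \<le> (1 + \<eta>) * L + real n * \<eta> * l"
      by (rule chained_comparison[OF a(1) l(1) \<eta>(1) _ p q L(1) nl(1)]) (use l(4)[OF a] in blast)
    also have "real n * \<eta> * l \<le> \<eta> * (L + l)"
      using mult_left_mono[OF nl(2), of \<eta>] \<eta> by (simp add: mult_ac)
    finally have "dsing p q \<le> L + \<eta> * (2 * L + l)" by (simp add: algebra_simps)
    also have "\<dots> \<le> dreg a p q + \<eta> * (2 * B + 4)"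
    proof -
      have "dreg a p q \<le> B" using dreg_le_dsing[OF a(1) p q] B(2)[OF p q] by simp
      then have "1 + 2 * L + l \<le> 2 * B + 4" using \<eta> l by (simp add: L_def)
      from mult_left_mono[OF this, of \<eta>] \<eta> show ?thesis by (simp add: L_def algebra_simps)
    qed
    finally show "dsing p q \<le> dreg a p q + e" using \<eta>e by simp
  qed
qed

section \<open>The limit metric\<close>

lemma reg_metric: "0 < a \<Longrightarrow> Metric_space S2xS1 (dreg a)"
  unfolding dreg_def by (rule warped_space.Metric_space_dist[OF reg])

lemma dreg_sym: "dreg a p q = dreg a q p" if "0 < a"
  unfolding dreg_def by (rule warped_space.dist_sym[OF reg[OF that]])

lemma dreg_triangle:
  assumes "0 < a" "p \<in> S2xS1" "q \<in> S2xS1" "r \<in> S2xS1"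
  shows "dreg a p r \<le> dreg a p q + dreg a q r"
  unfolding dreg_def by (rule warped_space.dist_triangle[OF reg[OF assms(1)] assms(2-)])

lemma dreg_nonneg: "0 < a \<Longrightarrow> 0 \<le> dreg a p q"
  unfolding dreg_def by (rule warped_space.dist_nonneg[OF reg])

text \<open>On the regular part this is \<open>dreg b \<le> dsing \<le> dreg a + e / 2\<close>. For
  points of the singular set take regular points so close to them that the change is small for
  these two values of \<open>a\<close> and \<open>b\<close>; how close depends on \<open>a\<close>
  and \<open>b\<close>, but \<open>\<alpha>\<close> does not.\<close>

lemma dreg_cauchy:
  assumes e: "0 < e"
  obtains \<alpha> where "0 < \<alpha>" "\<And>a b p q. 0 < a \<Longrightarrow> a \<le> \<alpha> \<Longrightarrow> 0 < b \<Longrightarrow> p \<in> S2xS1 \<Longrightarrow> q \<in> S2xS1 \<Longrightarrow>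
    dreg b p q \<le> dreg a p q + e"
proof -
  obtain \<alpha> where \<alpha>: "0 < \<alpha>" "\<And>a p q. 0 < a \<Longrightarrow> a \<le> \<alpha> \<Longrightarrow> p \<in> S2xS1 - singular_set \<Longrightarrow> q \<in> S2xS1 - singular_set \<Longrightarrow>
       dsing p q \<le> dreg a p q + e / 2"
    by (rule uniform_comparison[of "e / 2"]) (use e in auto)
  show thesis
  proof (rule that[OF \<alpha>(1)])
    fix a b :: real and p q assume a: "0 < a" "a \<le> \<alpha>" and b: "0 < b" and p: "p \<in> S2xS1" and q: "q \<in> S2xS1"
    define C where "C = profile \<beta> a 0 + profile \<beta> b 0"
    have P: "2 \<le> profile \<beta> a 0" "2 \<le> profile \<beta> b 0"
      using profile_ge[of a 0 \<beta>] profile_ge[of b 0 \<beta>] a b \<beta> by auto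
    then have C: "0 < C" by (simp add: C_def)
    define \<tau> where "\<tau> = min (1/2) (e / (8 * C))"
    have \<tau>: "0 < \<tau>" "\<tau> \<le> 1/2" "\<tau> \<le> e / (8 * C)" using e C by (auto simp: \<tau>_def)
    have C\<tau>: "4 * (C * \<tau>) \<le> e / 2" using \<tau>(3) C by (simp add: field_simps)
    obtain p' where p': "p' \<in> S2xS1 - singular_set" "dist p p' < \<tau>" using regular_part_dense[OF p \<tau>(1)] by auto
    obtain q' where q': "q' \<in> S2xS1 - singular_set" "dist q q' < \<tau>" using regular_part_dense[OF q \<tau>(1)] by auto
    have lip: "dreg c x y \<le> 2 * (profile \<beta> c 0 * \<tau>)"
      if "0 < c" "2 \<le> profile \<beta> c 0" "x \<in> S2xS1" "y \<in> S2xS1" "dist x y < \<tau>" for c x y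
    proof -
      have "dreg c x y \<le> 2 * profile \<beta> c 0 * dist x y" using that \<tau> by (intro dreg_lipschitz) auto
      also have "\<dots> \<le> 2 * profile \<beta> c 0 * \<tau>" using that by (intro mult_left_mono) auto
      finally show ?thesis by simp
    qed
    have l: "dreg b p p' \<le> 2 * (profile \<beta> b 0 * \<tau>)" "dreg b q' q \<le> 2 * (profile \<beta> b 0 * \<tau>)"
      "dreg a p' p \<le> 2 * (profile \<beta> a 0 * \<tau>)" "dreg a q q' \<le> 2 * (profile \<beta> a 0 * \<tau>)"
      using lip[of b p p'] lip[of b q' q] lip[of a p' p] lip[of a q q'] p q p' q' a b P by (auto simp: dist_commute)
    have "dreg b p q \<le> dreg b p p' + dreg b p' q" "dreg b p' q \<le> dreg b p' q' + dreg b q' q"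
      "dreg a p' q' \<le> dreg a p' p + dreg a p q'" "dreg a p q' \<le> dreg a p q + dreg a q q'"
      using dreg_triangle p q p' q' a b by auto
    moreover have "dreg b p' q' \<le> dsing p' q'" by (rule dreg_le_dsing[OF b p'(1) q'(1)])
    moreover have "dsing p' q' \<le> dreg a p' q' + e / 2" by (rule \<alpha>(2)[OF a p'(1) q'(1)])
    moreover have "C * \<tau> = profile \<beta> a 0 * \<tau> + profile \<beta> b 0 * \<tau>" by (simp add: C_def algebra_simps)
    ultimately show "dreg b p q \<le> dreg a p q + e" using l C\<tau> by linarith
  qed
qed

definition dlim :: "(real^3) \<times> complex \<Rightarrow> (real^3) \<times> complex \<Rightarrow> real" where
  "dlim p q = (SUP a\<in>{0<..}. dreg a p q)"

lemma dreg_outside: "p \<notin> S2xS1 \<or> q \<notin> S2xS1 \<Longrightarrow> dreg a p q = 0"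
  by (auto simp: dreg_def riem_dist_def)

lemma dreg_bdd_above: "bdd_above ((\<lambda>a. dreg a p q) ` {0<..})"
proof (cases "p \<in> S2xS1 \<and> q \<in> S2xS1")
  case True
  obtain \<alpha> where \<alpha>: "0 < \<alpha>" "\<And>a b p q. 0 < a \<Longrightarrow> a \<le> \<alpha> \<Longrightarrow> 0 < b \<Longrightarrow> p \<in> S2xS1 \<Longrightarrow> q \<in> S2xS1 \<Longrightarrow>
    dreg b p q \<le> dreg a p q + 1"
    by (rule dreg_cauchy[of 1]) auto
  have "dreg b p q \<le> dreg \<alpha> p q + 1" if "0 < b" for b using \<alpha>(2)[of \<alpha> b p q] \<alpha>(1) True that by simp
  then show ?thesis by (intro bdd_aboveI[of _ "dreg \<alpha> p q + 1"]) auto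
qed (auto simp: dreg_outside)

lemma dreg_le_dlim: "0 < a \<Longrightarrow> dreg a p q \<le> dlim p q"
  unfolding dlim_def by (intro cSUP_upper dreg_bdd_above) auto

lemma dlim_leI: "(\<And>a. 0 < a \<Longrightarrow> dreg a p q \<le> B) \<Longrightarrow> dlim p q \<le> B"
  unfolding dlim_def by (intro cSUP_least) (auto intro: exI[of _ 1])

lemma dlim_uniform:
  assumes e: "0 < e"
  obtains \<alpha> where "0 < \<alpha>" "\<And>a p q. 0 < a \<Longrightarrow> a \<le> \<alpha> \<Longrightarrow> dlim p q \<le> dreg a p q + e"
proof -
  obtain \<alpha> where \<alpha>: "0 < \<alpha>" "\<And>a b p q. 0 < a \<Longrightarrow> a \<le> \<alpha> \<Longrightarrow> 0 < b \<Longrightarrow> p \<in> S2xS1 \<Longrightarrow> q \<in> S2xS1 \<Longrightarrow>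
    dreg b p q \<le> dreg a p q + e"
    by (rule dreg_cauchy[OF e]) blast
  show thesis
  proof (rule that[OF \<alpha>(1)])
    fix a p q assume "0 < a" "a \<le> \<alpha>"
    then show "dlim p q \<le> dreg a p q + e"
      using \<alpha>(2) e by (intro dlim_leI) (cases "p \<in> S2xS1 \<and> q \<in> S2xS1", auto simp: dreg_outside)
  qed
qed

lemma dlim_nonneg: "0 \<le> dlim p q"
  using dreg_le_dlim[of 1 p q] dreg_nonneg[of 1 p q] by simp

lemma dlim_sym: "dlim p q = dlim q p"
  unfolding dlim_def by (intro SUP_cong refl dreg_sym) auto

lemma dist_le_dlim: "p \<in> S2xS1 \<Longrightarrow> q \<in> S2xS1 \<Longrightarrow> dist p q \<le> dlim p q"
  using dreg_le_dlim[of 1 p q] dist_le_dreg[of 1 p q] by simp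

lemma dlim_self: "dlim p p = 0"
proof (rule antisym[OF dlim_leI dlim_nonneg])
  fix a :: real assume "0 < a"
  then show "dreg a p p \<le> 0"
    using Metric_space.zero[OF reg_metric, of a p p] by (cases "p \<in> S2xS1") (auto simp: dreg_outside)
qed

lemma dlim_triangle:
  assumes "p \<in> S2xS1" "q \<in> S2xS1" "r \<in> S2xS1"
  shows "dlim p r \<le> dlim p q + dlim q r"
proof (rule dlim_leI)
  fix a :: real assume a: "0 < a"
  show "dreg a p r \<le> dlim p q + dlim q r"
    using dreg_triangle[OF a assms] dreg_le_dlim[OF a, of p q] dreg_le_dlim[OF a, of q r] by simp
qed

lemma Metric_space_dlim: "Metric_space S2xS1 dlim"
proof
  show "dlim p q = 0 \<longleftrightarrow> p = q" if "p \<in> S2xS1" "q \<in> S2xS1" for p q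
    using dlim_self dist_le_dlim[OF that] by (metis dist_le_zero_iff)
qed (use dlim_nonneg dlim_sym dlim_triangle in auto)

lemma dlim_eq_dsing:
  assumes "p \<in> S2xS1 - singular_set" "q \<in> S2xS1 - singular_set"
  shows "dlim p q = dsing p q"
proof (rule antisym)
  show "dlim p q \<le> dsing p q" by (intro dlim_leI dreg_le_dsing assms)
  show "dsing p q \<le> dlim p q"
  proof (rule field_le_epsilon)
    fix e :: real assume "0 < e"
    then obtain \<alpha> where \<alpha>: "0 < \<alpha>" "\<And>a p q. 0 < a \<Longrightarrow> a \<le> \<alpha> \<Longrightarrow> p \<in> S2xS1 - singular_set \<Longrightarrow> q \<in> S2xS1 - singular_set \<Longrightarrow>
       dsing p q \<le> dreg a p q + e"
      by (rule uniform_comparison) blast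
    then show "dsing p q \<le> dlim p q + e"
      using \<alpha>(2)[OF \<alpha>(1) order_refl assms] dreg_le_dlim[OF \<alpha>(1), of p q] by simp
  qed
qed

lemma dlim_continuous:
  assumes "p \<in> S2xS1" "0 < e"
  shows "\<exists>\<tau>>0. \<forall>q\<in>S2xS1. dist p q < \<tau> \<longrightarrow> dlim p q < e"
proof -
  obtain \<alpha> where \<alpha>: "0 < \<alpha>" "\<And>a p q. 0 < a \<Longrightarrow> a \<le> \<alpha> \<Longrightarrow> dlim p q \<le> dreg a p q + e / 2"
    by (rule dlim_uniform[of "e / 2"]) (use assms in auto)
  have P: "2 \<le> profile \<beta> \<alpha> 0" using profile_ge[of \<alpha> 0 \<beta>] \<alpha> \<beta> by auto
  define \<tau> where "\<tau> = min (1/2) (e / (4 * profile \<beta> \<alpha> 0))"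
  have \<tau>: "0 < \<tau>" using assms P by (simp add: \<tau>_def)
  have "dlim p q < e" if q: "q \<in> S2xS1" "dist p q < \<tau>" for q
  proof -
    have "dreg \<alpha> p q \<le> 2 * profile \<beta> \<alpha> 0 * dist p q"
      using q assms \<alpha> by (intro dreg_lipschitz) (auto simp: \<tau>_def)
    also have "\<dots> < 2 * profile \<beta> \<alpha> 0 * (e / (4 * profile \<beta> \<alpha> 0))"
      using q P by (intro mult_strict_left_mono) (auto simp: \<tau>_def)
    also have "\<dots> = e / 2" using P by simp
    finally show ?thesis using \<alpha>(2)[of \<alpha> p q] \<alpha>(1) by simp
  qed
  then show ?thesis using \<tau> by blast
qed

lemma mtopology_dlim: "Metric_space.mtopology S2xS1 dlim = top_of_set S2xS1"
  by (rule mtopology_eq_euclidean[OF Metric_space_dlim dist_le_dlim dlim_continuous])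

lemma compact_S2xS1: "compact S2xS1"
  unfolding S2xS1_def by (intro compact_Times compact_sphere)

text \<open>An almost shortest path from \<open>p\<close> stays at distance at most \<open>axis_dist
  p + l\<close> from the axis, where the warping function is at least \<open>profile \<beta> a
  (axis_dist p + l)\<close>; let \<open>a\<close> tend to 0.\<close>

lemma dlim_lower_bound:
  assumes p: "p \<in> S2xS1" and q: "q \<in> S2xS1" and l: "dlim p q < l" "l \<le> 1"
  shows "wnorm (profile \<beta> 0 (axis_dist p + l)) (q - p) \<le> dlim p q"
proof -
  let ?s = "axis_dist p + l"
  have s: "0 < ?s" "?s \<le> 2"
    using l dlim_nonneg[of p q] axis_dist_le_1[OF p] axis_dist_nonneg[of p] by linarith+
  have bound: "wnorm (profile \<beta> a ?s) (q - p) \<le> dlim p q" if a: "0 < a" for a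
  proof (rule order_trans[OF _ dreg_le_dlim[OF a]], rule dense_ge)
    fix L0 assume L0: "dreg a p q < L0"
    define L where "L = min L0 l"
    have L: "dreg a p q < L" "L \<le> l" using L0 dreg_le_dlim[OF a, of p q] l by (auto simp: L_def)
    obtain c D where c: "C1_path S2xS1 c D p q"
        "\<And>t. t \<in> {0..1} \<Longrightarrow> \<bar>axis_dist (c t) - axis_dist p\<bar> < L"
        "\<And>F. 0 \<le> F \<Longrightarrow> (\<And>t. t \<in> {0..1} \<Longrightarrow> F \<le> profile \<beta> a (axis_dist (c t))) \<Longrightarrow> wnorm F (q - p) < L"
      by (rule dreg_obtain_path[OF a p q L(1)]) blast
    have "wnorm (profile \<beta> a ?s) (q - p) < L"
    proof (rule c(3))
      \<comment> \<open>As \<open>axis_dist p + l\<close> may exceed 1, where the logarithm is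
      negative, \<open>\<beta> \<ge> 2\<close> has to compensate it.\<close>
      have "1 / 4 \<le> (1 + a) / (?s\<^sup>2 + a)"
      proof -
        have "?s\<^sup>2 \<le> 2\<^sup>2" using s by (intro power_mono) auto
        moreover have "0 < ?s\<^sup>2 + a" using a by (simp add: add_nonneg_pos)
        ultimately show ?thesis using a by (simp add: field_simps)
      qed
      then have "ln (1 / 4) \<le> ln ((1 + a) / (?s\<^sup>2 + a))" by (intro ln_mono) auto
      moreover have "- 2 \<le> ln (1 / 4 :: real)"
      proof -
        have "ln (2 :: real) \<le> 1" using ln_le_minus_one[of 2] by simp
        moreover have "ln (4 :: real) = 2 * ln 2" using ln_realpow[of 2 2] by simp
        ultimately show ?thesis by (simp add: ln_div)
      qed
      ultimately show "0 \<le> profile \<beta> a ?s" using \<beta> by (simp add: profile_def)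
      show "profile \<beta> a ?s \<le> profile \<beta> a (axis_dist (c t))" if "t \<in> {0..1}" for t
        using c(2)[OF that] L a by (intro profile_antimono) auto
    qed
    then show "wnorm (profile \<beta> a ?s) (q - p) \<le> L0" by (simp add: L_def)
  qed
  have "((\<lambda>a. profile \<beta> a ?s) \<longlongrightarrow> profile \<beta> 0 ?s) (at_right 0)"
    unfolding profile_def using s by (auto intro!: tendsto_eq_intros)
  then have "((\<lambda>a. wnorm (profile \<beta> a ?s) (q - p)) \<longlongrightarrow> wnorm (profile \<beta> 0 ?s) (q - p)) (at_right 0)"
    unfolding wnorm_def by (intro tendsto_intros)
  then show ?thesis
    by (rule tendsto_upperbound) (use bound in \<open>auto simp: eventually_at_right_field intro!: exI[of _ 1]\<close>)
qed

lemma dlim_polar_le: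
  assumes r: "0 < r0" "r0 < pi" "0 < r1" "r1 < pi" and s: "0 < s"
    and bd: "\<And>r. r \<in> closed_segment r0 r1 \<Longrightarrow> s \<le> sin r \<and> sin r \<le> S"
  shows "dlim (polar_point r0 \<theta>0 \<phi>0) (polar_point r1 \<theta>1 \<phi>1)
    \<le> sqrt ((r1 - r0)\<^sup>2 + S\<^sup>2 * (\<theta>1 - \<theta>0)\<^sup>2 + (profile \<beta> 0 s)\<^sup>2 * (\<phi>1 - \<phi>0)\<^sup>2)"
  using dsing_polar_le[OF assms] polar_point_regular r by (subst dlim_eq_dsing) auto

lemma dlim_radial_le:
  assumes r: "0 \<le> r0" "r0 \<le> pi" "0 \<le> r1" "r1 \<le> pi"
  shows "dlim (polar_point r0 \<theta> \<phi>) (polar_point r1 \<theta> \<phi>) \<le> \<bar>r1 - r0\<bar>"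
proof (rule dlim_leI)
  fix a :: real assume a: "0 < a"
  interpret A: warped_space S2xS1 "f_reg \<beta> a" by (rule reg[OF a])
  obtain D where D: "C1_path S2xS1 (\<lambda>t. polar_point (r0 + t * (r1 - r0)) (\<theta> + t * (\<theta> - \<theta>)) (\<phi> + t * (\<phi> - \<phi>))) D
      (polar_point r0 \<theta> \<phi>) (polar_point r1 \<theta> \<phi>)"
    "\<And>t F. t\<in>{0..1} \<Longrightarrow> wnorm F (D t) = \<bar>r1 - r0\<bar>"
    using polar_path[of r0 r1 \<theta> \<theta> \<phi> \<phi>] r by auto
  show "dreg a (polar_point r0 \<theta> \<phi>) (polar_point r1 \<theta> \<phi>) \<le> \<bar>r1 - r0\<bar>"
    unfolding dreg_def by (rule A.dist_le_speed_bound[OF D(1)]) (simp add: A.speed_def D(2))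
qed

end

section \<open>The singular fibres\<close>

lemma hausdorff_weight_1: "hausdorff_weight d 1 U = ennreal (enn2real (ediam d U))"
  by (simp add: hausdorff_weight_def)

text \<open>For sets of diameter at most 1 the weights decrease with the dimension, up to the
  normalising factors.\<close>

lemma hausdorff_weight_1_le:
  assumes "0 \<le> p" "p \<le> 1"
  obtains C where "0 < C" "\<And>d U. ediam d U \<le> ennreal 1 \<Longrightarrow> hausdorff_weight d 1 U \<le> ennreal C * hausdorff_weight d p U"
proof -
  define C where "C = (if p = 0 then 1 else 2 powr p / unit_ball_vol p)"
  have C: "0 < C" using assms by (simp add: C_def)
  have "hausdorff_weight d 1 U \<le> ennreal C * hausdorff_weight d p U" if "ediam d U \<le> ennreal 1" for d :: "'a \<Rightarrow> 'a \<Rightarrow> real" and U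
  proof (cases "U = {}")
    case False
    have d: "0 \<le> enn2real (ediam d U)" "enn2real (ediam d U) \<le> 1" using that by (auto intro: enn2real_leI)
    show ?thesis
    proof (cases "p = 0")
      case True
      then show ?thesis using d False unfolding hausdorff_weight_1 by (simp add: hausdorff_weight_def C_def)
    next
      case p: False
      have "enn2real (ediam d U) = enn2real (ediam d U) powr 1" using d by simp
      also have "\<dots> \<le> enn2real (ediam d U) powr p" using d assms by (intro powr_mono') auto
      also have "\<dots> = C * (unit_ball_vol p / 2 powr p * enn2real (ediam d U) powr p)"
        using p unit_ball_vol_pos[OF assms(1)] by (simp add: C_def)
      finally show ?thesis
        unfolding hausdorff_weight_1 using p False C assms
        by (simp add: hausdorff_weight_def ennreal_mult[symmetric] ennreal_leI)
    qed
  qed simp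
  then show thesis using that C by blast
qed

lemma wnorm_ge_snd: "0 \<le> F \<Longrightarrow> F * norm (snd v) \<le> wnorm F v"
  unfolding wnorm_eq by (rule real_le_rsqrt) (simp add: power_mult_distrib)

context dissolving_metrics
begin

text \<open>Go out to distance \<open>\<rho>\<close> from the fibre, around, and back.\<close>

lemma fibre_dist_le:
  assumes c: "c = 0 \<or> c = pi" and r: "0 < \<rho>" "\<rho> < pi"
  shows "dlim (polar_point c 0 \<phi>) (polar_point c 0 \<phi>') \<le> 2 * \<rho> + profile \<beta> 0 (sin \<rho>) * \<bar>\<phi>' - \<phi>\<bar>"
proof -
  define c' where "c' = (if c = 0 then \<rho> else pi - \<rho>)"
  have c': "0 < c'" "c' < pi" "sin c' = sin \<rho>" "\<bar>c' - c\<bar> = \<rho>" "\<bar>c - c'\<bar> = \<rho>" "0 \<le> c" "c \<le> pi"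
    using c r by (auto simp: c'_def)
  have s: "0 < sin \<rho>" using r by (rule sin_gt_zero)
  have "dlim (polar_point c' 0 \<phi>) (polar_point c' 0 \<phi>')
      \<le> sqrt ((c' - c')\<^sup>2 + (sin \<rho>)\<^sup>2 * (0 - 0)\<^sup>2 + (profile \<beta> 0 (sin \<rho>))\<^sup>2 * (\<phi>' - \<phi>)\<^sup>2)"
    using c' s by (intro dlim_polar_le) auto
  also have "\<dots> = profile \<beta> 0 (sin \<rho>) * \<bar>\<phi>' - \<phi>\<bar>"
    using profile_ge[of 0 "sin \<rho>" \<beta>] s \<beta> by (simp add: real_sqrt_mult)
  finally have 1: "dlim (polar_point c' 0 \<phi>) (polar_point c' 0 \<phi>') \<le> profile \<beta> 0 (sin \<rho>) * \<bar>\<phi>' - \<phi>\<bar>" .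
  have 2: "dlim (polar_point c 0 \<phi>) (polar_point c' 0 \<phi>) \<le> \<rho>" "dlim (polar_point c' 0 \<phi>') (polar_point c 0 \<phi>') \<le> \<rho>"
    using dlim_radial_le[of c c' 0 \<phi>] dlim_radial_le[of c' c 0 \<phi>'] c' by auto
  have "dlim (polar_point c 0 \<phi>) (polar_point c 0 \<phi>') \<le> dlim (polar_point c 0 \<phi>) (polar_point c' 0 \<phi>) + dlim (polar_point c' 0 \<phi>) (polar_point c 0 \<phi>')"
    by (intro dlim_triangle polar_point_in)
  also have "dlim (polar_point c' 0 \<phi>) (polar_point c 0 \<phi>') \<le> dlim (polar_point c' 0 \<phi>) (polar_point c' 0 \<phi>') + dlim (polar_point c' 0 \<phi>') (polar_point c 0 \<phi>')"
    by (intro dlim_triangle polar_point_in)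
  finally show ?thesis using 1 2 by linarith
qed

text \<open>Keep only the circle component of the chord in \<open>dlim_lower_bound\<close>.\<close>

lemma fibre_dist_ge:
  assumes pq: "p \<in> singular_set" "q \<in> S2xS1" and l: "dlim p q < l" "l \<le> 1"
  shows "profile \<beta> 0 l * norm (snd q - snd p) \<le> dlim p q"
proof -
  have p: "p \<in> S2xS1" "axis_dist p = 0" using pq(1) by (auto simp: singular_set_eq)
  have "0 < l" using l(1) dlim_nonneg[of p q] by linarith
  then have "0 \<le> profile \<beta> 0 l" using profile_ge[of 0 l \<beta>] \<beta> l by auto
  then show ?thesis
    using dlim_lower_bound[OF p(1) pq(2) l] wnorm_ge_snd[of "profile \<beta> 0 l" "q - p"] p(2) by simp
qed

lemma fibre_in_singular_set: "c = 0 \<or> c = pi \<Longrightarrow> polar_point c \<theta> \<phi> \<in> singular_set"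
  using polar_point_in[of c \<theta> \<phi>] axis_dist_polar_point[of c \<theta> \<phi>] by (auto simp: singular_set_eq)

lemma singular_set_fibres:
  "singular_set = polar_point 0 0 ` {0..2 * pi} \<union> polar_point pi 0 ` {0..2 * pi}"
proof (intro equalityI subsetI)
  fix p assume p: "p \<in> singular_set"
  then have "p \<in> S2xS1" by (simp add: singular_set_def)
  then obtain \<theta> \<phi> where t: "p = polar_point (polar_r p) \<theta> \<phi>" "0 \<le> \<phi>" "\<phi> < 2 * pi"
    using S2xS1_obtain_polar_2pi by blast
  have "polar_point (polar_r p) \<theta> \<phi> = polar_point (polar_r p) 0 \<phi>"
    using p by (auto simp: singular_set_def polar_point_def)
  then have p2: "p = polar_point (polar_r p) 0 \<phi>" using t by simp
  have "\<phi> \<in> {0..2 * pi}" using t by simp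
  moreover have "polar_r p = 0 \<or> polar_r p = pi" using p by (simp add: singular_set_def)
  ultimately show "p \<in> polar_point 0 0 ` {0..2 * pi} \<union> polar_point pi 0 ` {0..2 * pi}"
    using p2 by (metis UnI1 UnI2 imageI)
qed (auto simp: fibre_in_singular_set)

text \<open>The fibre is the union of \<open>n\<close> arcs of angle \<open>2 * pi / n\<close>. With
  \<open>\<rho> = 1 / n\<close> in \<open>fibre_dist_le\<close> their diameter is at most \<open>h
  n\<close>, which is of order \<open>ln n / n\<close>, so \<open>n * h n powr p\<close> tends to
  0 for \<open>p > 1\<close>.\<close>

lemma fibre_premeasure_zero:
  assumes p: "1 < p" and \<delta>: "0 < \<delta>" and c: "c = 0 \<or> c = pi"
  shows "hausdorff_premeasure S2xS1 dlim p \<delta> (polar_point c 0 ` {0..2 * pi}) = 0"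
proof -
  let ?H = "hausdorff_premeasure S2xS1 dlim p \<delta> (polar_point c 0 ` {0..2 * pi})"
  define h where "h = (\<lambda>n::nat. 2 * (1 / real n) + profile \<beta> 0 (sin (1 / real n)) * (2 * pi / real n))"
  have h0: "h \<longlonglongrightarrow> 0" unfolding h_def profile_def by real_asymp
  have hp: "(\<lambda>n. real n * (unit_ball_vol p / 2 powr p * h n powr p)) \<longlonglongrightarrow> 0"
    unfolding h_def profile_def using p by real_asymp
  have bound: "?H \<le> ennreal (real n * (unit_ball_vol p / 2 powr p * h n powr p))" if n: "0 < n" "h n \<le> \<delta>" for n
  proof -
    define U where "U = (\<lambda>i. if i < n then polar_point c 0 ` {2 * pi * real i / real n..2 * pi * real (Suc i) / real n} else {})"
    have hn: "0 \<le> h n"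
    proof -
      have "1 / real n < pi" using n pi_gt3 divide_le_eq_1[of 1 "real n"] by linarith
      then have "0 < sin (1 / real n)" using n by (intro sin_gt_zero) auto
      then show ?thesis using profile_ge[of 0 "sin (1 / real n)" \<beta>] \<beta> by (simp add: h_def)
    qed
    have diam: "ediam dlim (U i) \<le> ennreal (h n)" for i
    proof (rule ediam_leI)
      fix x y assume "x \<in> U i" "y \<in> U i"
      then obtain s t where st: "x = polar_point c 0 s" "y = polar_point c 0 t" "i < n"
        "2 * pi * real i / real n \<le> s" "s \<le> 2 * pi * real (Suc i) / real n"
        "2 * pi * real i / real n \<le> t" "t \<le> 2 * pi * real (Suc i) / real n"
        by (auto simp: U_def split: if_splits)
      have "2 * pi * real (Suc i) / real n - 2 * pi * real i / real n = 2 * pi / real n"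
        by (simp add: diff_divide_distrib[symmetric] algebra_simps)
      then have ts: "\<bar>t - s\<bar> \<le> 2 * pi / real n" using st by linarith
      have n1: "1 / real n < pi" using n pi_gt3 divide_le_eq_1[of 1 "real n"] by linarith
      then have "0 < sin (1 / real n)" using n by (intro sin_gt_zero) auto
      then have P: "0 \<le> profile \<beta> 0 (sin (1 / real n))" using profile_ge[of 0 "sin (1 / real n)" \<beta>] \<beta> by simp
      have "dlim x y \<le> 2 * (1 / real n) + profile \<beta> 0 (sin (1 / real n)) * \<bar>t - s\<bar>"
        unfolding st(1,2) using n n1 by (intro fibre_dist_le[OF c]) auto
      also have "\<dots> \<le> h n" unfolding h_def using ts P by (intro add_left_mono mult_left_mono)
      finally show "dlim x y \<le> h n" .
    qed
    have "?H \<le> (\<Sum>i. hausdorff_weight dlim p (U i))"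
    proof (rule hausdorff_premeasure_le)
      show "polar_point c 0 ` {0..2 * pi} \<subseteq> (\<Union>i. U i)"
      proof (rule image_subsetI)
        fix t :: real assume t: "t \<in> {0..2 * pi}"
        define x where "x = t * real n / (2 * pi)"
        have x: "0 \<le> x" "x \<le> real n" using t n by (auto simp: x_def field_simps)
        have tx: "t = 2 * pi * x / real n" using n by (simp add: x_def)
        show "polar_point c 0 t \<in> (\<Union>i. U i)"
        \<comment> \<open>The end point of the circle belongs to the last arc, the arcs being
        indexed by the integer part of \<open>x\<close>.\<close>
        proof (cases "x = real n")
          case True
          then have "polar_point c 0 t \<in> U (n - 1)" using n tx by (auto simp: U_def field_simps of_nat_diff)
          then show ?thesis by blast
        next
          case False
          define i where "i = nat \<lfloor>x\<rfloor>"
          have i: "real i \<le> x" "x \<le> real (Suc i)" "i < n" using x False by (auto simp: i_def) linarith+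
          then have "2 * pi * real i / real n \<le> t" "t \<le> 2 * pi * real (Suc i) / real n"
            unfolding tx using n by (auto intro!: divide_right_mono mult_left_mono)
          then have "polar_point c 0 t \<in> U i" using i(3) by (auto simp: U_def)
          then show ?thesis by blast
        qed
      qed
      show "U i \<subseteq> S2xS1" for i by (auto simp: U_def polar_point_in)
      show "ediam dlim (U i) \<le> ennreal \<delta>" for i using diam[of i] n(2) by (meson ennreal_leI order_trans)
    qed
    also have "\<dots> = (\<Sum>i<n. hausdorff_weight dlim p (U i))"
      by (rule suminf_finite) (auto simp: U_def)
    also have "\<dots> \<le> (\<Sum>i<n. ennreal (unit_ball_vol p / 2 powr p * h n powr p))"
      using diam hn p by (intro sum_mono hausdorff_weight_le) auto
    also have "\<dots> = ennreal (real n * (unit_ball_vol p / 2 powr p * h n powr p))"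
      using p by (subst sum_ennreal) auto
    finally show ?thesis .
  qed
  have "eventually (\<lambda>n. h n \<le> \<delta>) sequentially" using order_tendstoD(2)[OF h0 \<delta>] by (rule eventually_mono) simp
  then have "eventually (\<lambda>n. ?H \<le> ennreal (real n * (unit_ball_vol p / 2 powr p * h n powr p))) sequentially"
    using eventually_gt_at_top[of 0] by eventually_elim (use bound in blast)
  moreover have "(\<lambda>n. ennreal (real n * (unit_ball_vol p / 2 powr p * h n powr p))) \<longlonglongrightarrow> ennreal 0"
    using hp by (rule tendsto_ennrealI)
  ultimately have "?H \<le> ennreal 0" using tendsto_lowerbound sequentially_bot by blast
  then show ?thesis by simp
qed

lemma singular_premeasure_zero:
  assumes p: "1 < p" and \<delta>: "0 < \<delta>"
  shows "hausdorff_premeasure S2xS1 dlim p \<delta> singular_set = 0"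
  unfolding singular_set_fibres
  using hausdorff_premeasure_Un[of S2xS1 dlim p \<delta> "polar_point 0 0 ` {0..2 * pi}" "polar_point pi 0 ` {0..2 * pi}"]
    fibre_premeasure_zero[OF assms, of 0] fibre_premeasure_zero[OF assms, of pi] by simp

text \<open>Project the part of a covering set that lies in the singular set to the real axis by the
  real part of the circle coordinate. By \<open>fibre_dist_ge\<close> the projection of a set of
  diameter \<open>D \<le> l / 2\<close> lies in an interval of length \<open>2 * D / profile
  \<beta> 0 l\<close>, and these intervals cover \<open>[-1, 1]\<close>, which has length
  2.\<close>

lemma singular_premeasure_1_ge:
  assumes l: "0 < l" "l \<le> 1"
  shows "ennreal (profile \<beta> 0 l) \<le> hausdorff_premeasure S2xS1 dlim 1 (l / 2) singular_set"
  unfolding hausdorff_premeasure_def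
proof (rule Inf_greatest, clarify)
  fix U :: "nat \<Rightarrow> ((real^3) \<times> complex) set"
  assume cov: "singular_set \<subseteq> (\<Union>i. U i)" and U: "\<forall>i. U i \<subseteq> S2xS1 \<and> ediam dlim (U i) \<le> ennreal (l / 2)"
  let ?F = "profile \<beta> 0 l"
  have F: "0 < ?F" using profile_ge[of 0 l \<beta>] l \<beta> by auto
  define D where "D = (\<lambda>i. enn2real (ediam dlim (U i)))"
  have D0: "0 \<le> D i" for i by (simp add: D_def)
  define x where "x = (\<lambda>i. Re (snd (SOME p. p \<in> U i \<inter> singular_set)))"
  define I where "I = (\<lambda>i. {x i - D i / ?F..x i + D i / ?F})"
  have "{-1..1} \<subseteq> (\<Union>i. I i)"
  proof
    fix y :: real assume y: "y \<in> {-1..1}"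
    let ?p = "polar_point 0 0 (arccos y)"
    have pS: "?p \<in> singular_set" by (rule fibre_in_singular_set) simp
    then obtain i where i: "?p \<in> U i" using cov by auto
    define q where "q = (SOME p. p \<in> U i \<inter> singular_set)"
    have q: "q \<in> U i \<inter> singular_set" unfolding q_def by (rule someI[of _ ?p]) (use i pS in simp)
    have d: "dlim q ?p \<le> D i" unfolding D_def
      using U i q by (intro dist_le_hausdorff_diam[where \<delta> = "l / 2"]) auto
    have "D i \<le> l / 2" unfolding D_def using U l by (intro enn2real_leI) auto
    then have "dlim q ?p < l" using d l by linarith
    then have "?F * norm (snd ?p - snd q) \<le> dlim q ?p" using q polar_point_in l by (intro fibre_dist_ge) auto
    moreover have "\<bar>Re (snd ?p) - Re (snd q)\<bar> \<le> norm (snd ?p - snd q)"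
      using abs_Re_le_cmod[of "snd ?p - snd q"] by simp
    moreover have "Re (snd ?p) = y" using y by (simp add: polar_point_def)
    ultimately have "?F * \<bar>y - x i\<bar> \<le> D i" using d F unfolding x_def q_def[symmetric]
      by (metis (no_types, lifting) mult_left_mono less_imp_le order_trans)
    then have "\<bar>y - x i\<bar> \<le> D i / ?F" using F by (simp add: pos_le_divide_eq mult.commute)
    then have "y \<in> I i" unfolding I_def by (simp add: abs_le_iff)
    then show "y \<in> (\<Union>i. I i)" by blast
  qed
  then have "emeasure lborel {-1..1::real} \<le> emeasure lborel (\<Union>i. I i)"
    by (rule emeasure_mono) (auto simp: I_def)
  also have "\<dots> \<le> (\<Sum>i. emeasure lborel (I i))" by (rule emeasure_subadditive_countably) (auto simp: I_def)
  also have "(\<lambda>i. emeasure lborel (I i)) = (\<lambda>i. ennreal (2 / ?F) * ennreal (D i))"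
    using F D0 by (auto simp: I_def fun_eq_iff emeasure_lborel_Icc_eq ennreal_mult[symmetric])
  finally have "ennreal 2 \<le> ennreal (2 / ?F) * (\<Sum>i. ennreal (D i))" by (simp add: emeasure_lborel_Icc_eq)
  then have "ennreal (?F / 2) * ennreal 2 \<le> ennreal (?F / 2) * (ennreal (2 / ?F) * (\<Sum>i. ennreal (D i)))"
    by (rule mult_left_mono) simp
  also have "\<dots> = (\<Sum>i. ennreal (D i))"
    using F by (simp add: mult.assoc[symmetric] ennreal_mult[symmetric] del: ennreal_suminf_cmult)
  also have "ennreal (?F / 2) * ennreal 2 = ennreal ?F" using F by (subst ennreal_mult[symmetric]) auto
  finally show "ennreal ?F \<le> (\<Sum>i. hausdorff_weight dlim 1 (U i))"
    by (simp add: hausdorff_weight_1 D_def)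
qed

lemma profile_0_unbounded: "\<exists>l. 0 < l \<and> l \<le> 1 \<and> B \<le> profile \<beta> 0 l"
proof -
  define l where "l = exp (- max 0 B)"
  have "ln (1 / l\<^sup>2) = 2 * max 0 B"
    by (simp add: l_def ln_div ln_realpow)
  then have "B \<le> profile \<beta> 0 l" using \<beta> by (simp add: profile_def)
  then show ?thesis by (intro exI[of _ l]) (auto simp: l_def)
qed

lemma top_if_unbounded:
  assumes "\<And>B. \<exists>b. B \<le> b \<and> ennreal b \<le> x"
  shows "x = \<infinity>"
proof -
  have "x = top"
  proof (cases x)
    case (real r)
    obtain b where "r + 1 \<le> b" "ennreal b \<le> x" using assms by blast
    then show ?thesis using real by (simp add: ennreal_le_iff)
  qed simp
  then show ?thesis by simp
qed

lemma singular_measure_1: "hausdorff_measure S2xS1 dlim 1 singular_set = \<infinity>"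
proof (rule top_if_unbounded)
  fix B
  obtain l where l: "0 < l" "l \<le> 1" "B \<le> profile \<beta> 0 l" using profile_0_unbounded by auto
  have "ennreal (profile \<beta> 0 l) \<le> hausdorff_measure S2xS1 dlim 1 singular_set"
    unfolding hausdorff_measure_def
    using singular_premeasure_1_ge[OF l(1,2)] l(1) by (intro SUP_upper2[of "l / 2"]) auto
  then show "\<exists>b\<ge>B. ennreal b \<le> hausdorff_measure S2xS1 dlim 1 singular_set" using l(3) by auto
qed

text \<open>The upper bound holds since the measures of dimension above 1 vanish. If the measure of
  some dimension \<open>p < 1\<close> vanished, the one-dimensional premeasure at scale
  \<open>1/2\<close> would be at most 1, contradicting \<open>singular_premeasure_1_ge\<close>
  with \<open>l = 1\<close>, where the profile has the value \<open>\<beta>\<close>.\<close>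

lemma singular_dim: "hausdorff_dim S2xS1 dlim singular_set = 1"
proof (rule antisym)
  show "hausdorff_dim S2xS1 dlim singular_set \<le> 1"
  proof (rule ennreal_le_epsilon)
    fix e :: real assume e: "0 < e"
    have "hausdorff_measure S2xS1 dlim (1 + e) singular_set = 0"
      unfolding hausdorff_measure_def using singular_premeasure_zero[of "1 + e"] e
      by (auto intro!: antisym SUP_least)
    then have "hausdorff_dim S2xS1 dlim singular_set \<le> ennreal (1 + e)"
      unfolding hausdorff_dim_def using e by (intro Inf_lower CollectI exI[of _ "1 + e"] conjI refl) auto
    then show "hausdorff_dim S2xS1 dlim singular_set \<le> 1 + ennreal e" using e by simp
  qed
  show "1 \<le> hausdorff_dim S2xS1 dlim singular_set"
    unfolding hausdorff_dim_def
  proof (rule Inf_greatest, clarify)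
    fix p :: real assume p: "0 \<le> p" and H: "hausdorff_measure S2xS1 dlim p singular_set = 0"
    show "1 \<le> ennreal p"
    proof (rule ccontr)
      assume "\<not> 1 \<le> ennreal p"
      then have p1: "p \<le> 1" by (simp add: not_le)
      obtain C where C: "0 < C" "\<And>d U. ediam d U \<le> ennreal 1 \<Longrightarrow> hausdorff_weight d 1 U \<le> ennreal C * hausdorff_weight d p (U :: ((real^3) \<times> complex) set)"
        by (rule hausdorff_weight_1_le[OF p p1]) blast
      have "hausdorff_premeasure S2xS1 dlim p (1/2) singular_set \<le> hausdorff_measure S2xS1 dlim p singular_set"
        unfolding hausdorff_measure_def by (rule SUP_upper) simp
      then have "hausdorff_premeasure S2xS1 dlim p (1/2) singular_set < ennreal (1 / C)"
        using H C by simp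
      then obtain U :: "nat \<Rightarrow> _" where U: "singular_set \<subseteq> (\<Union>i. U i)" "\<And>i. U i \<subseteq> S2xS1" "\<And>i. ediam dlim (U i) \<le> ennreal (1/2)"
        "(\<Sum>i. hausdorff_weight dlim p (U i)) < ennreal (1 / C)"
        unfolding hausdorff_premeasure_def Inf_less_iff by auto
      have "ennreal (profile \<beta> 0 1) \<le> hausdorff_premeasure S2xS1 dlim 1 (1/2) singular_set"
        using singular_premeasure_1_ge[of 1] by simp
      also have "\<dots> \<le> (\<Sum>i. hausdorff_weight dlim 1 (U i))" by (rule hausdorff_premeasure_le[OF U(1-3)])
      also have "\<dots> \<le> (\<Sum>i. ennreal C * hausdorff_weight dlim p (U i))"
      proof (intro suminf_le C(2))
        show "ediam dlim (U i) \<le> ennreal 1" for i using U(3)[of i] ennreal_leI[of "1/2" 1] by (auto intro: order_trans)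
      qed auto
      also have "\<dots> = ennreal C * (\<Sum>i. hausdorff_weight dlim p (U i))" by simp
      also have "\<dots> \<le> ennreal C * ennreal (1 / C)" using U(4) by (intro mult_left_mono) auto
      also have "\<dots> = 1" using C(1) by (simp add: ennreal_mult[symmetric])
      finally have "profile \<beta> 0 1 \<le> 1" by simp
      then show False using \<beta> by (simp add: profile_def)
    qed
  qed
qed

text \<open>Divide half of the fibre into steps of distance below \<open>l\<close>. By
  \<open>fibre_dist_ge\<close> their total is at least \<open>profile \<beta> 0 l\<close> times
  the sum of the chords of the half circle, which is at least its diameter 2.\<close>

lemma fibre_length:
  assumes c: "c = 0 \<or> c = pi"
  shows "curve_length dlim 0 (2 * pi) (\<lambda>t. polar_point c 0 t) = \<infinity>"
proof (rule top_if_unbounded)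
  fix B
  obtain l where l: "0 < l" "l \<le> 1" "B \<le> profile \<beta> 0 l" using profile_0_unbounded by auto
  let ?F = "profile \<beta> 0 l"
  have F: "0 < ?F" using profile_ge[of 0 l \<beta>] l \<beta> by auto
  define \<rho> where "\<rho> = l / 8"
  have \<rho>: "0 < \<rho>" "\<rho> < pi" "2 * \<rho> \<le> l / 4" using l pi_gt3 by (auto simp: \<rho>_def)
  define P where "P = profile \<beta> 0 (sin \<rho>)"
  have P: "0 < P" using profile_ge[of 0 "sin \<rho>" \<beta>] sin_gt_zero[OF \<rho>(1,2)] \<beta> by (auto simp: P_def)
  obtain n where n: "4 * P * pi / l < real n" using reals_Archimedean2 by blast
  moreover have "0 < 4 * P * pi / l" using P l by (intro divide_pos_pos mult_pos_pos) auto
  ultimately have n0: "0 < n" by simp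
  have Pn: "P * (pi / real n) < l / 4" using n n0 l by (simp add: field_simps)
  \<comment> \<open>Equal steps along the half circle; the remaining half is one last
  step.\<close>
  define t where "t = (\<lambda>i. if i \<le> n then pi * real i / real n else 2 * pi)"
  let ?d = "\<lambda>i. dlim (polar_point c 0 (t i)) (polar_point c 0 (t (Suc i)))"
  have step: "?F * norm (cis (t (Suc i)) - cis (t i)) \<le> ?d i" if i: "i < n" for i
  proof -
    have "t (Suc i) - t i = pi / real n" using i n0 by (simp add: t_def field_simps)
    then have "?d i \<le> 2 * \<rho> + P * (pi / real n)"
      using fibre_dist_le[OF c \<rho>(1,2), of "t i" "t (Suc i)"] by (simp add: P_def)
    then have "?d i < l" using \<rho>(3) Pn l by linarith
    then show ?thesis
      using fibre_dist_ge[OF fibre_in_singular_set[OF c, of 0 "t i"] polar_point_in[of c 0 "t (Suc i)"] _ l(2)]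
      by (simp add: polar_point_def)
  qed
  have "2 * ?F = ?F * norm (cis (t n) - cis (t 0))"
    using n0 by (simp add: t_def)
  also have "cis (t n) - cis (t 0) = (\<Sum>i<n. cis (t (Suc i)) - cis (t i))"
    by (rule sum_lessThan_telescope[symmetric])
  also have "?F * norm \<dots> \<le> ?F * (\<Sum>i<n. norm (cis (t (Suc i)) - cis (t i)))"
    using F by (intro mult_left_mono norm_sum) auto
  also have "\<dots> \<le> (\<Sum>i<n. ?d i)" unfolding sum_distrib_left using step by (intro sum_mono) auto
  also have "\<dots> \<le> (\<Sum>i<Suc n. ?d i)" using dlim_nonneg by simp
  finally have "ennreal (2 * ?F) \<le> ennreal (\<Sum>i<Suc n. ?d i)" by (rule ennreal_leI)
  also have "\<dots> = (\<Sum>i<Suc n. ennreal (?d i))" by (rule sum_ennreal[symmetric]) (rule dlim_nonneg)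
  also have "\<dots> \<le> curve_length dlim 0 (2 * pi) (\<lambda>t. polar_point c 0 t)"
    unfolding curve_length_def
  proof (rule Sup_upper, intro CollectI exI conjI)
    show "t 0 = 0" "t (Suc n) = 2 * pi" by (auto simp: t_def)
    show "\<forall>i<Suc n. t i \<le> t (Suc i)"
    proof (intro allI impI)
      fix i assume "i < Suc n"
      show "t i \<le> t (Suc i)"
      proof (cases "i = n")
        case True then show ?thesis using n0 by (simp add: t_def)
      next
        case False
        then have "i < n" using \<open>i < Suc n\<close> by simp
        then show ?thesis using n0 by (simp add: t_def divide_right_mono)
      qed
    qed
  qed simp
  finally show "\<exists>b\<ge>B. ennreal b \<le> curve_length dlim 0 (2 * pi) (\<lambda>t. polar_point c 0 t)"
    using l(3) F by (intro exI[of _ "2 * ?F"]) auto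
qed

end

section \<open>The volume integral\<close>

lemma continuous_on_mult_ln: "continuous_on {0..} (\<lambda>u::real. u * ln u)"
proof (rule continuous_on_eq_continuous_within[THEN iffD2], rule ballI)
  fix u :: real assume u: "u \<in> {0..}"
  show "continuous (at u within {0..}) (\<lambda>u. u * ln u)"
  proof (cases "u = 0")
    case True
    have "((\<lambda>u::real. u * ln u) \<longlongrightarrow> 0) (at_right 0)" by real_asymp
    then show ?thesis unfolding True continuous_within by (simp add: at_within_Ici_at_right)
  next
    case False
    then show ?thesis using u by (intro continuous_intros) auto
  qed
qed

text \<open>An antiderivative of \<open>vol_density\<close>, found by substituting \<open>u = cos
  r\<close> and splitting \<open>ln (sin\<^sup>2 r)\<close> into \<open>ln (1 + u) + ln (1 -
  u)\<close>. The convention \<open>ln 0 = 0\<close> makes it continuous at the poles.\<close>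

definition vol_primitive :: "real \<Rightarrow> real \<Rightarrow> real" where
  "vol_primitive \<beta> r = - (\<beta> + 2) * cos r + (1 + cos r) * ln (1 + cos r) - (1 - cos r) * ln (1 - cos r)"

definition vol_density :: "real \<Rightarrow> real \<Rightarrow> real" where
  "vol_density \<beta> r = sin r * profile \<beta> 0 (sin r)"

lemma continuous_on_vol_primitive: "continuous_on UNIV (vol_primitive \<beta>)"
proof -
  have "0 \<le> 1 + cos r" for r :: real using cos_ge_minus_one[of r] by linarith
  then have "continuous_on UNIV (\<lambda>r. (1 + cos r) * ln (1 + cos r) :: real)"
    by (intro continuous_on_compose2[OF continuous_on_mult_ln, of UNIV "\<lambda>r. 1 + cos r"]) (auto intro!: continuous_intros)
  moreover have "continuous_on UNIV (\<lambda>r. (1 - cos r) * ln (1 - cos r) :: real)"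
    by (rule continuous_on_compose2[OF continuous_on_mult_ln]) (auto intro!: continuous_intros)
  ultimately show ?thesis unfolding vol_primitive_def
    by (intro continuous_on_add[OF continuous_on_mult[OF continuous_on_const continuous_on_cos[OF continuous_on_id]]]
        continuous_on_diff)
qed

lemma vol_primitive_deriv:
  assumes "0 < r" "r < pi"
  shows "(vol_primitive \<beta> has_real_derivative vol_density \<beta> r) (at r)"
proof -
  have s: "0 < sin r" using assms by (rule sin_gt_zero)
  have c: "cos r < 1" "- 1 < cos r"
    using cos_monotone_0_pi[of 0 r] cos_monotone_0_pi[of r pi] assms by auto
  have "ln (1 / (sin r)\<^sup>2) = - ln ((1 + cos r) * (1 - cos r))"
  proof -
    have "(sin r)\<^sup>2 = (1 + cos r) * (1 - cos r)" by (simp add: sin_squared_eq power2_eq_square algebra_simps)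
    moreover have "ln (1 / (sin r)\<^sup>2) = - ln ((sin r)\<^sup>2)" using s by (simp add: ln_div)
    ultimately show ?thesis by simp
  qed
  also have "\<dots> = - (ln (1 + cos r) + ln (1 - cos r))" using c by (subst ln_mult) auto
  finally have p: "profile \<beta> 0 (sin r) = \<beta> - ln (1 + cos r) - ln (1 - cos r)" by (simp add: profile_def)
  show ?thesis unfolding vol_primitive_def[abs_def] vol_density_def p
  proof -
    have l: "((\<lambda>r. ln (1 + cos r)) has_real_derivative (- sin r / (1 + cos r))) (at r)"
      "((\<lambda>r. ln (1 - cos r)) has_real_derivative (sin r / (1 - cos r))) (at r)"
      using c by (auto intro!: derivative_eq_intros simp: divide_inverse)
    have d: "((\<lambda>r. 1 + cos r) has_real_derivative - sin r) (at r)" "((\<lambda>r. 1 - cos r) has_real_derivative sin r) (at r)"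
      "((\<lambda>r. - (\<beta> + 2) * cos r) has_real_derivative - (\<beta> + 2) * - sin r) (at r)"
      by (auto intro!: derivative_eq_intros)
    show "((\<lambda>r. - (\<beta> + 2) * cos r + (1 + cos r) * ln (1 + cos r) - (1 - cos r) * ln (1 - cos r))
        has_real_derivative sin r * (\<beta> - ln (1 + cos r) - ln (1 - cos r))) (at r)"
      using DERIV_diff[OF DERIV_add[OF d(3) DERIV_mult[OF d(1) l(1)]] DERIV_mult[OF d(2) l(2)]]
    proof (rule DERIV_cong)
      have e: "- sin r / (1 + cos r) * (1 + cos r) = - sin r" "sin r / (1 - cos r) * (1 - cos r) = sin r" using c by auto
      show "- (\<beta> + 2) * - sin r + (- sin r * ln (1 + cos r) + - sin r / (1 + cos r) * (1 + cos r))
         - (sin r * ln (1 - cos r) + sin r / (1 - cos r) * (1 - cos r)) = sin r * (\<beta> - ln (1 + cos r) - ln (1 - cos r))"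
        unfolding e by (simp add: algebra_simps)
    qed
  qed
qed

lemma vol_primitive_total: "vol_primitive \<beta> pi - vol_primitive \<beta> 0 = 2 * \<beta> + 4 - 2 * ln 4"
proof -
  have "ln (4::real) = 2 * ln 2" using ln_realpow[of 2 2] by simp
  then show ?thesis by (simp add: vol_primitive_def)
qed

section \<open>Lower bounds for chords\<close>

text \<open>A small chord forces a small angle when angles near \<open>2 * pi\<close> are excluded,
  and a small angle is almost equal to its chord.\<close>

lemma small_angle:
  fixes \<eta> \<kappa> :: real
  assumes \<eta>: "0 < \<eta>" "\<eta> < pi / 2" and \<kappa>: "\<kappa> < 1"
  obtains \<tau> where "0 < \<tau>" "\<And>x. \<bar>x\<bar> \<le> 2 * pi - 2 * \<eta> \<Longrightarrow> 2 * \<bar>sin (x / 2)\<bar> \<le> \<tau> \<Longrightarrow> \<kappa> * \<bar>x\<bar> \<le> 2 * \<bar>sin (x / 2)\<bar>"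
proof -
  have "((\<lambda>y::real. sin y / y) \<longlongrightarrow> 1) (at_right 0)" by real_asymp
  then have "eventually (\<lambda>y. \<kappa> < sin y / y) (at_right 0)" using \<kappa> by (intro order_tendstoD)
  then obtain b where b: "0 < b" "\<And>y. 0 < y \<Longrightarrow> y < b \<Longrightarrow> \<kappa> < sin y / y"
    unfolding eventually_at_right_field by auto
  define y0 where "y0 = min (b / 2) (pi / 2)"
  have y0: "0 < y0" "y0 < b" "y0 \<le> pi / 2" using b by (auto simp: y0_def)
  \<comment> \<open>The sine is at least \<open>m\<close> on \<open>[y0, pi - \<eta>]\<close>, so
  a smaller value forces the half angle below \<open>y0\<close>.\<close>
  define m where "m = min (sin y0) (sin \<eta>)"
  have m: "0 < m" using sin_gt_zero[of y0] sin_gt_zero[of \<eta>] y0 \<eta> by (simp add: m_def)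
  show thesis
  proof (rule that[of m])
    fix x assume x: "\<bar>x\<bar> \<le> 2 * pi - 2 * \<eta>" "2 * \<bar>sin (x / 2)\<bar> \<le> m"
    define y where "y = \<bar>x\<bar> / 2"
    have y: "0 \<le> y" "y \<le> pi - \<eta>" using x by (auto simp: y_def)
    have sy: "\<bar>sin (x / 2)\<bar> = sin y" using sin_ge_zero[of y] y \<eta> by (cases "0 \<le> x") (auto simp: y_def abs_if)
    have "y < y0"
    proof (rule ccontr)
      assume "\<not> y < y0"
      then have "m \<le> sin y"
      proof (cases "y \<le> pi / 2")
        case True
        then show ?thesis using sin_monotone_2pi_le[of y0 y] \<open>\<not> y < y0\<close> y0 by (simp add: m_def)
      next
        case False
        then have "sin \<eta> \<le> sin (pi - y)" using y \<eta> by (intro sin_monotone_2pi_le) auto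
        then show ?thesis by (simp add: m_def)
      qed
      then show False using x(2) m sy by simp
    qed
    show "\<kappa> * \<bar>x\<bar> \<le> 2 * \<bar>sin (x / 2)\<bar>"
    proof (cases "y = 0")
      case False
      then have "\<kappa> < sin y / y" using b(2)[of y] y \<open>y < y0\<close> y0 by simp
      then have "\<kappa> * y \<le> sin y" using False y by (simp add: field_simps)
      then show ?thesis unfolding sy by (simp add: y_def)
    qed (use y_def in simp)
  qed (rule m)
qed

lemma one_minus_cos: "1 - cos x = 2 * (sin (x / 2))\<^sup>2" for x :: real
  using cos_double_sin[of "x / 2"] by simp

lemma chord_polar:
  "(wnorm F (polar_point r' \<theta>' \<phi>' - polar_point r \<theta> \<phi>))\<^sup>2
    = 4 * (sin ((r' - r) / 2))\<^sup>2 + 4 * (sin r * sin r') * (sin ((\<theta>' - \<theta>) / 2))\<^sup>2 + F\<^sup>2 * (4 * (sin ((\<phi>' - \<phi>) / 2))\<^sup>2)"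
proof -
  have 1: "(norm (fst (polar_point r' \<theta>' \<phi>' - polar_point r \<theta> \<phi>)))\<^sup>2
      = (sin r' * cos \<theta>' - sin r * cos \<theta>)\<^sup>2 + (sin r' * sin \<theta>' - sin r * sin \<theta>)\<^sup>2 + (cos r' - cos r)\<^sup>2"
    by (simp add: polar_point_def norm_vec_def L2_set_def sum_3)
  also have "\<dots> = (sin r')\<^sup>2 * ((cos \<theta>')\<^sup>2 + (sin \<theta>')\<^sup>2) + (sin r)\<^sup>2 * ((cos \<theta>)\<^sup>2 + (sin \<theta>)\<^sup>2)
      + (cos r')\<^sup>2 + (cos r)\<^sup>2 - 2 * sin r * sin r' * (cos \<theta>' * cos \<theta> + sin \<theta>' * sin \<theta>) - 2 * cos r * cos r'"
    by algebra
  also have "\<dots> = 2 * (1 - (cos r' * cos r + sin r' * sin r)) + 2 * (sin r * sin r') * (1 - (cos \<theta>' * cos \<theta> + sin \<theta>' * sin \<theta>))"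
  proof -
    have "(sin x)\<^sup>2 + (cos x)\<^sup>2 = 1" for x :: real by simp
    from this[of r] this[of r'] this[of \<theta>] this[of \<theta>'] show ?thesis by algebra
  qed
  also have "\<dots> = 4 * (sin ((r' - r) / 2))\<^sup>2 + 4 * (sin r * sin r') * (sin ((\<theta>' - \<theta>) / 2))\<^sup>2"
    unfolding cos_diff[symmetric] one_minus_cos by simp
  finally have a: "(norm (fst (polar_point r' \<theta>' \<phi>' - polar_point r \<theta> \<phi>)))\<^sup>2
    = 4 * (sin ((r' - r) / 2))\<^sup>2 + 4 * (sin r * sin r') * (sin ((\<theta>' - \<theta>) / 2))\<^sup>2" .
  have "(norm (snd (polar_point r' \<theta>' \<phi>' - polar_point r \<theta> \<phi>)))\<^sup>2 = (cos \<phi>' - cos \<phi>)\<^sup>2 + (sin \<phi>' - sin \<phi>)\<^sup>2"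
    by (simp add: polar_point_def cmod_power2)
  also have "\<dots> = ((cos \<phi>')\<^sup>2 + (sin \<phi>')\<^sup>2) + ((cos \<phi>)\<^sup>2 + (sin \<phi>)\<^sup>2) - 2 * (cos \<phi>' * cos \<phi> + sin \<phi>' * sin \<phi>)"
    by algebra
  also have "\<dots> = 2 * (1 - cos (\<phi>' - \<phi>))" by (simp add: cos_diff)
  also have "\<dots> = 4 * (sin ((\<phi>' - \<phi>) / 2))\<^sup>2" unfolding one_minus_cos by simp
  finally have b: "(norm (snd (polar_point r' \<theta>' \<phi>' - polar_point r \<theta> \<phi>)))\<^sup>2 = 4 * (sin ((\<phi>' - \<phi>) / 2))\<^sup>2" .
  show ?thesis unfolding wnorm_eq a[symmetric] b[symmetric] by simp
qed

section \<open>Upper bound for the volume\<close>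

definition polar3 :: "real \<times> real \<times> real \<Rightarrow> (real^3) \<times> complex" where
  "polar3 a = polar_point (fst a) (fst (snd a)) (snd (snd a))"

context dissolving_metrics
begin

lemma vol_density_nonneg: "0 < r \<Longrightarrow> r < pi \<Longrightarrow> 0 \<le> vol_density \<beta> r"
  using profile_ge[of 0 "sin r" \<beta>] sin_gt_zero[of r] \<beta> by (simp add: vol_density_def)

lemma vol_primitive_mono:
  assumes "0 \<le> x" "x \<le> y" "y \<le> pi"
  shows "vol_primitive \<beta> x \<le> vol_primitive \<beta> y"
proof (rule DERIV_nonneg_imp_increasing_open[OF assms(2)])
  fix z assume "x < z" "z < y"
  then show "\<exists>d. (vol_primitive \<beta> has_real_derivative d) (at z) \<and> 0 \<le> d"
    using assms vol_primitive_deriv vol_density_nonneg by (intro exI[of _ "vol_density \<beta> z"]) auto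
qed (use continuous_on_vol_primitive continuous_on_subset in blast)

lemma emeasure_box3:
  assumes "r1 \<le> r2" "0 \<le> x" "0 \<le> y"
  shows "emeasure lborel ({r1..r2} \<times> {0..x} \<times> {0..y :: real}) = ennreal ((r2 - r1) * x * y)"
    "{r1..r2} \<times> {0..x} \<times> {0..y :: real} \<in> sets borel"
proof -
  have e: "{r1..r2} \<times> {0..x} \<times> {0..y} = cbox (r1, 0, 0) (r2, x, y)"
    by (simp add: cbox_Pair_eq)
  show "{r1..r2} \<times> {0..x} \<times> {0..y :: real} \<in> sets borel" unfolding e by simp
  have "measure lborel (cbox (r1, 0, 0) (r2, x, y)) = (r2 - r1) * x * y"
    using assms by (simp add: content_Pair)
  then show "emeasure lborel ({r1..r2} \<times> {0..x} \<times> {0..y :: real}) = ennreal ((r2 - r1) * x * y)"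
    unfolding e using emeasure_eq_ennreal_measure[of lborel "cbox (r1, 0, 0) (r2, x, y)"]
      emeasure_lborel_cbox_finite[of "(r1, 0, 0)" "(r2, x, y)"] by (simp add: less_top)
qed

text \<open>With \<open>\<theta>\<close> rescaled by the largest sine and \<open>\<phi>\<close> by
  the largest value of the warping function on the slab, the polar chart is 1-Lipschitz.\<close>

lemma slab_premeasure_le:
  assumes r: "0 < r1" "r1 \<le> r2" "r2 < pi" and s: "0 < s" and \<delta>: "0 < \<delta>"
    and bd: "\<And>r. r1 \<le> r \<Longrightarrow> r \<le> r2 \<Longrightarrow> s \<le> sin r \<and> sin r \<le> S"
  shows "hausdorff_premeasure S2xS1 dlim 3 \<delta> (polar3 ` ({r1..r2} \<times> {0..2 * pi} \<times> {0..2 * pi}))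
    \<le> ennreal ((2 * pi)\<^sup>2 * ((r2 - r1) * (S * profile \<beta> 0 s)))"
proof -
  define F where "F = profile \<beta> 0 s"
  have "s \<le> sin r1" "sin r1 \<le> S" using bd[of r1] r by auto
  then have S: "s \<le> S" "s \<le> 1" using order_trans[OF _ sin_le_one] by auto
  have F: "2 \<le> F" using profile_ge[of 0 s \<beta>] s S \<beta> by (auto simp: F_def)
  let ?E = "{r1..r2} \<times> {0..2 * pi * S} \<times> {0..2 * pi * F}"
  let ?G = "\<lambda>a :: real \<times> real \<times> real. polar_point (fst a) (fst (snd a) / S) (snd (snd a) / F)"
  have pos: "0 < S" "0 < F" using S s F by auto
  have "polar3 ` ({r1..r2} \<times> {0..2 * pi} \<times> {0..2 * pi}) \<subseteq> ?G ` ?E"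
  proof (rule image_subsetI)
    fix a :: "real \<times> real \<times> real" assume a: "a \<in> {r1..r2} \<times> {0..2 * pi} \<times> {0..2 * pi}"
    have "polar3 a = ?G (fst a, fst (snd a) * S, snd (snd a) * F)" using pos by (simp add: polar3_def)
    moreover have "(fst a, fst (snd a) * S, snd (snd a) * F) \<in> ?E" using a pos by auto
    ultimately show "polar3 a \<in> ?G ` ?E" by blast
  qed
  then have "hausdorff_premeasure S2xS1 dlim 3 \<delta> (polar3 ` ({r1..r2} \<times> {0..2 * pi} \<times> {0..2 * pi}))
     \<le> hausdorff_premeasure S2xS1 dlim 3 \<delta> (?G ` ?E)" by (rule hausdorff_premeasure_mono)
  also have "\<dots> \<le> emeasure lebesgue ?E"
  proof -
    have "hausdorff_premeasure S2xS1 dlim (real DIM(real \<times> real \<times> real)) \<delta> (?G ` ?E) \<le> emeasure lebesgue ?E"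
    proof (rule hausdorff_premeasure_lipschitz_image[OF \<delta>])
      show "?E \<in> sets lebesgue" using emeasure_box3(2)[of r1 r2 "2 * pi * S" "2 * pi * F"] pos r by simp
      show "?G a \<in> S2xS1" for a by (rule polar_point_in)
      fix a b assume ab: "a \<in> ?E" "b \<in> ?E"
      have "dlim (?G a) (?G b) \<le> sqrt ((fst b - fst a)\<^sup>2 + S\<^sup>2 * (fst (snd b) / S - fst (snd a) / S)\<^sup>2
          + (profile \<beta> 0 s)\<^sup>2 * (snd (snd b) / F - snd (snd a) / F)\<^sup>2)"
        using ab r s bd by (intro dlim_polar_le) (auto simp: closed_segment_eq_real_ivl split: if_splits)
      also have "S\<^sup>2 * (fst (snd b) / S - fst (snd a) / S)\<^sup>2 = (fst (snd b) - fst (snd a))\<^sup>2"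
        using pos by (simp add: diff_divide_distrib[symmetric] power_divide)
      also have "(profile \<beta> 0 s)\<^sup>2 * (snd (snd b) / F - snd (snd a) / F)\<^sup>2 = (snd (snd b) - snd (snd a))\<^sup>2"
        using pos by (simp add: diff_divide_distrib[symmetric] power_divide F_def[symmetric])
      also have "sqrt ((fst b - fst a)\<^sup>2 + (fst (snd b) - fst (snd a))\<^sup>2 + (snd (snd b) - snd (snd a))\<^sup>2) = dist a b"
        by (simp add: dist_prod_def dist_real_def power2_commute add.assoc)
      finally show "dlim (?G a) (?G b) \<le> dist a b" .
    qed
    then show ?thesis by simp
  qed
  also have "\<dots> = ennreal ((r2 - r1) * (2 * pi * S) * (2 * pi * F))"
    using emeasure_box3[of r1 r2 "2 * pi * S" "2 * pi * F"] pos r by simp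
  also have "(r2 - r1) * (2 * pi * S) * (2 * pi * F) = (2 * pi)\<^sup>2 * ((r2 - r1) * (S * F))"
    by (simp add: power2_eq_square)
  finally show ?thesis unfolding F_def .
qed

text \<open>On a slab where the sine varies by the factor \<open>c\<close> at most, the volume of the
  rescaled box exceeds the Riemannian volume by the factor \<open>c\<^sup>2\<close> at most: one
  factor \<open>c\<close> for the sine, another for the profile, which grows by \<open>2 * ln
  c\<close> when its argument is divided by \<open>c\<close>, hence by the factor \<open>c\<close>
  at most as it is at least 2.\<close>

lemma thin_slab_premeasure_le:
  assumes r: "0 < r1" "r1 \<le> r2" "r2 < pi" and c: "1 < c" and s: "0 < s" "s * c \<le> 1" and \<delta>: "0 < \<delta>"
    and bd: "\<And>r. r1 \<le> r \<Longrightarrow> r \<le> r2 \<Longrightarrow> s \<le> sin r \<and> sin r \<le> s * c"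
  shows "hausdorff_premeasure S2xS1 dlim 3 \<delta> (polar3 ` ({r1..r2} \<times> {0..2 * pi} \<times> {0..2 * pi}))
    \<le> ennreal ((2 * pi * c)\<^sup>2 * (vol_primitive \<beta> r2 - vol_primitive \<beta> r1))"
proof -
  have F: "0 \<le> profile \<beta> 0 s" using profile_ge[of 0 s \<beta>] bd[of r1] r s sin_le_one[of r1] \<beta> by auto
  have dens: "s * c * profile \<beta> 0 s \<le> c\<^sup>2 * vol_density \<beta> r" if "r1 \<le> r" "r \<le> r2" for r
  proof -
    have b: "s \<le> sin r" "sin r \<le> s * c" using bd[OF that] by auto
    have p1: "profile \<beta> 0 (s * c) \<le> profile \<beta> 0 (sin r)" using b s by (intro profile_antimono) auto
    have "\<beta> \<le> profile \<beta> 0 (s * c)" using s c by (intro profile_ge) auto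
    then have p2: "2 * (c - 1) \<le> profile \<beta> 0 (s * c) * (c - 1)" using \<beta> c by (intro mult_right_mono) auto
    have "profile \<beta> 0 s = profile \<beta> 0 (s * c) + 2 * ln c"
      using s c by (simp add: profile_def ln_div ln_mult ln_realpow power_mult_distrib)
    also have "\<dots> \<le> profile \<beta> 0 (s * c) + 2 * (c - 1)" using ln_le_minus_one[of c] c by simp
    also have "\<dots> \<le> c * profile \<beta> 0 (s * c)" using p2 by (simp add: algebra_simps)
    also have "\<dots> \<le> c * profile \<beta> 0 (sin r)" using p1 c by (intro mult_left_mono) auto
    finally have "profile \<beta> 0 s \<le> c * profile \<beta> 0 (sin r)" .
    then have "(s * c) * profile \<beta> 0 s \<le> (sin r * c) * (c * profile \<beta> 0 (sin r))"
      using b s c F by (intro mult_mono mult_right_mono) auto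
    then show ?thesis by (simp add: vol_density_def power2_eq_square mult_ac)
  qed
  have "(r2 - r1) * (s * c * profile \<beta> 0 s) \<le> c\<^sup>2 * (vol_primitive \<beta> r2 - vol_primitive \<beta> r1)"
  proof (cases "r1 = r2")
    case False
    then obtain z where z: "r1 < z" "z < r2" "vol_primitive \<beta> r2 - vol_primitive \<beta> r1 = (r2 - r1) * vol_density \<beta> z"
      using MVT2[of r1 r2 "vol_primitive \<beta>" "vol_density \<beta>"] vol_primitive_deriv r by (metis less_le less_le_trans le_less_trans)
    have "(r2 - r1) * (s * c * profile \<beta> 0 s) \<le> (r2 - r1) * (c\<^sup>2 * vol_density \<beta> z)"
      using dens[of z] z r by (intro mult_left_mono) auto
    then show ?thesis using z(3) by (simp add: mult_ac)
  qed simp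
  then have "(2 * pi)\<^sup>2 * ((r2 - r1) * (s * c * profile \<beta> 0 s)) \<le> (2 * pi)\<^sup>2 * (c\<^sup>2 * (vol_primitive \<beta> r2 - vol_primitive \<beta> r1))"
    by (intro mult_left_mono) auto
  moreover have "(2 * pi)\<^sup>2 * (c\<^sup>2 * (vol_primitive \<beta> r2 - vol_primitive \<beta> r1)) = (2 * pi * c)\<^sup>2 * (vol_primitive \<beta> r2 - vol_primitive \<beta> r1)"
    by (simp add: power_mult_distrib)
  ultimately have "(2 * pi)\<^sup>2 * ((r2 - r1) * (s * c * profile \<beta> 0 s)) \<le> (2 * pi * c)\<^sup>2 * (vol_primitive \<beta> r2 - vol_primitive \<beta> r1)"
    by (rule ord_le_eq_trans)
  from order_trans[OF slab_premeasure_le[OF r s(1) \<delta> bd] ennreal_leI[OF this]] show ?thesis .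
qed

text \<open>The half of the sphere between a pole and the equator is the union of countably many
  slabs on which the sine lies in \<open>[c powi (- k - 1), c powi (- k)]\<close>. Their volumes
  form a telescoping sum. The function \<open>m\<close> is the identity for one hemisphere and the
  reflection \<open>r \<mapsto> pi - r\<close> for the other, where the primitive is traversed
  backwards.\<close>

lemma half_premeasure_le:
  assumes c: "1 < c" and \<delta>: "0 < \<delta>" and m: "m = (\<lambda>r. r) \<or> m = (\<lambda>r. pi - r)"
  shows "hausdorff_premeasure S2xS1 dlim 3 \<delta> (polar3 ` (m ` {0<..pi/2} \<times> {0..2 * pi} \<times> {0..2 * pi}))
    \<le> ennreal ((2 * pi * c)\<^sup>2 * \<bar>vol_primitive \<beta> (pi/2) - vol_primitive \<beta> (m 0)\<bar>)"
proof -
  define s where "s = (\<lambda>k::nat. (1 / c) ^ k)"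
  have s: "0 < s k" "s k \<le> 1" "s (Suc k) * c = s k" "s (Suc k) \<le> s k" for k
    using c by (auto simp: s_def power_le_one divide_simps)
  define A where "A = (\<lambda>k. arcsin (s k))"
  have A: "0 < A k" "A k \<le> pi / 2" "sin (A k) = s k" "A (Suc k) \<le> A k" for k
    using s[of k] s[of "Suc k"] arcsin_less_mono[of 0 "s k"] arcsin_le_mono[of "s (Suc k)" "s k"] arcsin_ubound[of "s k"]
    by (auto simp: A_def)
  have A0: "A 0 = pi / 2" by (simp add: A_def s_def)
  have Alim: "A \<longlonglongrightarrow> 0"
  proof -
    have "s \<longlonglongrightarrow> 0" unfolding s_def using c by (intro LIMSEQ_power_zero) auto
    moreover have "isCont arcsin 0" by (intro isCont_arcsin) auto
    ultimately have "(\<lambda>k. arcsin (s k)) \<longlonglongrightarrow> arcsin 0" by (rule isCont_tendsto_compose[rotated])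
    then show ?thesis by (simp add: A_def)
  qed
  let ?H = "\<lambda>X. hausdorff_premeasure S2xS1 dlim 3 \<delta> (polar3 ` (X \<times> {0..2 * pi} \<times> {0..2 * pi}))"
  let ?V = "vol_primitive \<beta>"
  have bd: "s (Suc k) \<le> sin r \<and> sin r \<le> s (Suc k) * c" if "A (Suc k) \<le> r" "r \<le> A k" for r k
    using that A[of k] A[of "Suc k"] sin_monotone_2pi_le[of "A (Suc k)" r] sin_monotone_2pi_le[of r "A k"] s(3)[of k]
    by auto
  have piece: "?H (m ` {A (Suc k)..A k}) \<le> ennreal ((2 * pi * c)\<^sup>2 * \<bar>?V (m (A k)) - ?V (m (A (Suc k)))\<bar>)
      \<and> 0 \<le> (if m = (\<lambda>r. r) then 1 else - 1) * (?V (m (A k)) - ?V (m (A (Suc k))))" for k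
  proof -
    have AA: "0 < A (Suc k)" "A (Suc k) \<le> A k" "A k < pi" using A[of k] A(1)[of "Suc k"] pi_gt_zero by auto
    have ss: "0 < s (Suc k)" "s (Suc k) * c \<le> 1" using s[of k] s(1)[of "Suc k"] by auto
    have ne: "(\<lambda>r::real. pi - r) \<noteq> (\<lambda>r. r)" by (metis add_diff_cancel_left' diff_zero pi_neq_zero)
    from m show ?thesis
    proof
      assume m: "m = (\<lambda>r. r)"
      have "?H {A (Suc k)..A k} \<le> ennreal ((2 * pi * c)\<^sup>2 * (?V (A k) - ?V (A (Suc k))))"
        by (rule thin_slab_premeasure_le[OF AA c ss \<delta> bd])
      then show ?thesis using vol_primitive_mono[of "A (Suc k)" "A k"] AA by (simp add: m)
    next
      assume m: "m = (\<lambda>r. pi - r)"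
      have im: "m ` {A (Suc k)..A k} = {pi - A k..pi - A (Suc k)}" unfolding m by (rule image_diff_atLeastAtMost)
      have "?H {pi - A k..pi - A (Suc k)} \<le> ennreal ((2 * pi * c)\<^sup>2 * (?V (pi - A (Suc k)) - ?V (pi - A k)))"
      proof (rule thin_slab_premeasure_le[where s = "s (Suc k)"])
        show "s (Suc k) \<le> sin r \<and> sin r \<le> s (Suc k) * c" if "pi - A k \<le> r" "r \<le> pi - A (Suc k)" for r
          using bd[of k "pi - r"] that by simp
      qed (use AA c ss \<delta> in auto)
      moreover have "?V (pi - A k) \<le> ?V (pi - A (Suc k))" using AA by (intro vol_primitive_mono) auto
      ultimately show ?thesis unfolding im unfolding m using ne
        by (cases "?V (pi - A k) = ?V (pi - A (Suc k))") (simp_all add: abs_if)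
    qed
  qed
  \<comment> \<open>The orientation of \<open>m\<close>.\<close>
  define sg where "sg = (if m = (\<lambda>r. r) then 1 else - 1 :: real)"
  have sg: "\<bar>?V (m (A k)) - ?V (m (A (Suc k)))\<bar> = sg * (?V (m (A k)) - ?V (m (A (Suc k))))" for k
    using piece[of k] by (auto simp: sg_def abs_if split: if_splits)
  have mA: "(\<lambda>k. ?V (m (A k))) \<longlonglongrightarrow> ?V (m 0)"
  proof -
    have "(\<lambda>k. m (A k)) \<longlonglongrightarrow> m 0" using m Alim by (auto intro!: tendsto_eq_intros)
    then show ?thesis
      using continuous_on_vol_primitive[of \<beta>] by (auto simp: continuous_on_eq_continuous_at intro: isCont_tendsto_compose)
  qed
  have "(\<lambda>k. ?V (m (A k)) - ?V (m (A (Suc k)))) sums (?V (m (A 0)) - ?V (m 0))"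
    by (rule telescope_sums'[OF mA])
  from sums_mult[OF this, of sg] have sm: "(\<lambda>k. \<bar>?V (m (A k)) - ?V (m (A (Suc k)))\<bar>) sums (sg * (?V (m (A 0)) - ?V (m 0)))"
    unfolding sg .
  have nn: "0 \<le> sg * (?V (m (A 0)) - ?V (m 0))" by (rule sums_le[OF _ sums_zero sm]) simp
  have mA0: "m (A 0) = pi / 2" using m A0 by auto
  have sgv: "sg * (?V (m (A 0)) - ?V (m 0)) = \<bar>?V (pi / 2) - ?V (m 0)\<bar>"
    using nn unfolding mA0 by (auto simp: sg_def abs_if split: if_splits)
  have cov: "{0<..pi/2} \<subseteq> (\<Union>k. {A (Suc k)..A k})"
  proof
    fix r :: real assume r: "r \<in> {0<..pi/2}"
    obtain n where "A n < r"
      using order_tendstoD(2)[OF Alim, of r] r by (auto dest: eventually_happens'[OF sequentially_bot])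
    define k where "k = (LEAST n. A n < r)"
    have k: "A k < r" unfolding k_def using \<open>A n < r\<close> by (rule LeastI)
    then have "k \<noteq> 0" using A0 r by (metis greaterThanAtMost_iff not_less)
    then obtain j where j: "k = Suc j" using not0_implies_Suc by blast
    have "\<not> A j < r" using not_less_Least[of j "\<lambda>n. A n < r"] j by (simp add: k_def)
    then show "r \<in> (\<Union>k. {A (Suc k)..A k})" using k j by (intro UN_I[of j]) auto
  qed
  have "polar3 ` (m ` {0<..pi/2} \<times> {0..2 * pi} \<times> {0..2 * pi}) \<subseteq> (\<Union>k. polar3 ` (m ` {A (Suc k)..A k} \<times> {0..2 * pi} \<times> {0..2 * pi}))"
    using cov by blast
  then have "?H (m ` {0<..pi/2}) \<le> hausdorff_premeasure S2xS1 dlim 3 \<delta> (\<Union>k. polar3 ` (m ` {A (Suc k)..A k} \<times> {0..2 * pi} \<times> {0..2 * pi}))"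
    by (rule hausdorff_premeasure_mono)
  also have "\<dots> \<le> (\<Sum>k. ?H (m ` {A (Suc k)..A k}))" by (rule hausdorff_premeasure_countable_subadditive)
  also have "\<dots> \<le> (\<Sum>k. ennreal ((2 * pi * c)\<^sup>2 * \<bar>?V (m (A k)) - ?V (m (A (Suc k)))\<bar>))"
    using piece by (intro suminf_le) auto
  also have "\<dots> = ennreal ((2 * pi * c)\<^sup>2 * (sg * (?V (m (A 0)) - ?V (m 0))))"
    using sums_mult[OF sm, of "(2 * pi * c)\<^sup>2"] by (intro suminf_ennreal_eq) auto
  finally show ?thesis unfolding sgv .
qed

text \<open>Both hemispheres together; the factor \<open>c\<close> of the slab decomposition tends to
  1.\<close>

lemma volume_upper_bound:
  assumes \<delta>: "0 < \<delta>" and sing0: "hausdorff_premeasure S2xS1 dlim 3 \<delta> singular_set = 0"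
  shows "hausdorff_premeasure S2xS1 dlim 3 \<delta> S2xS1 \<le> ennreal ((2 * pi)\<^sup>2 * (2 * \<beta> + 4 - 2 * ln 4))"
proof -
  let ?H = "hausdorff_premeasure S2xS1 dlim 3 \<delta>" and ?V = "vol_primitive \<beta>"
  let ?P = "\<lambda>m. polar3 ` (m ` {0<..pi/2} \<times> {0..2 * pi} \<times> {0..2 * pi})"
  have "S2xS1 \<subseteq> singular_set \<union> (?P (\<lambda>r. r) \<union> ?P (\<lambda>r. pi - r))"
  proof
    fix p assume p: "p \<in> S2xS1"
    show "p \<in> singular_set \<union> (?P (\<lambda>r. r) \<union> ?P (\<lambda>r. pi - r))"
    proof (cases "p \<in> singular_set")
      case False
      then have r: "0 < polar_r p" "polar_r p < pi" using p polar_r_regular[of p] by auto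
      obtain \<theta> \<phi> where t: "p = polar_point (polar_r p) \<theta> \<phi>" "0 \<le> \<theta>" "\<theta> < 2 * pi" "0 \<le> \<phi>" "\<phi> < 2 * pi"
        using S2xS1_obtain_polar_2pi[OF p] by blast
      have e: "p = polar3 (polar_r p, \<theta>, \<phi>)" using t(1) by (simp add: polar3_def)
      show ?thesis
      proof (cases "polar_r p \<le> pi / 2")
        case True
        then have "(polar_r p, \<theta>, \<phi>) \<in> (\<lambda>r. r) ` {0<..pi/2} \<times> {0..2 * pi} \<times> {0..2 * pi}" using r t by auto
        then show ?thesis using e by blast
      next
        case False
        then have "polar_r p = pi - (pi - polar_r p)" "pi - polar_r p \<in> {0<..pi/2}" using r by auto
        then have "polar_r p \<in> (\<lambda>r. pi - r) ` {0<..pi/2}" by (rule image_eqI)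
        then have "(polar_r p, \<theta>, \<phi>) \<in> (\<lambda>r. pi - r) ` {0<..pi/2} \<times> {0..2 * pi} \<times> {0..2 * pi}" using t by auto
        then show ?thesis using e by blast
      qed
    qed simp
  qed
  then have "?H S2xS1 \<le> ?H (singular_set \<union> (?P (\<lambda>r. r) \<union> ?P (\<lambda>r. pi - r)))" by (rule hausdorff_premeasure_mono)
  also have "\<dots> \<le> ?H singular_set + (?H (?P (\<lambda>r. r)) + ?H (?P (\<lambda>r. pi - r)))"
    by (meson hausdorff_premeasure_Un add_left_mono order_trans)
  finally have H: "?H S2xS1 \<le> ?H (?P (\<lambda>r. r)) + ?H (?P (\<lambda>r. pi - r))" using sing0 by simp
  have c: "?H S2xS1 \<le> ennreal ((2 * pi * c)\<^sup>2 * (?V pi - ?V 0))" if "1 < c" for c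
  proof -
    note H
    also have "?H (?P (\<lambda>r. r)) + ?H (?P (\<lambda>r. pi - r))
      \<le> ennreal ((2 * pi * c)\<^sup>2 * \<bar>?V (pi/2) - ?V 0\<bar>) + ennreal ((2 * pi * c)\<^sup>2 * \<bar>?V (pi/2) - ?V (pi - 0)\<bar>)"
      using half_premeasure_le[OF that \<delta>, of "\<lambda>r. r"] half_premeasure_le[OF that \<delta>, of "\<lambda>r. pi - r"]
      by (intro add_mono) auto
    also have "\<dots> = ennreal ((2 * pi * c)\<^sup>2 * (?V pi - ?V 0))"
    proof -
      have "\<bar>?V (pi/2) - ?V 0\<bar> = ?V (pi/2) - ?V 0" "\<bar>?V (pi/2) - ?V (pi - 0)\<bar> = ?V pi - ?V (pi/2)"
        "0 \<le> ?V (pi/2) - ?V 0" "0 \<le> ?V pi - ?V (pi/2)"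
        using vol_primitive_mono[of 0 "pi/2"] vol_primitive_mono[of "pi/2" pi] by auto
      moreover have "x * u + x * v = x * (u + v)" for x u v :: real by (simp add: distrib_left)
      ultimately show ?thesis by (simp only: ennreal_plus[symmetric] zero_le_power2 mult_nonneg_nonneg) simp
    qed
    finally show ?thesis .
  qed
  have "((\<lambda>c. (2 * pi * c)\<^sup>2 * (?V pi - ?V 0)) \<longlongrightarrow> (2 * pi * 1)\<^sup>2 * (?V pi - ?V 0)) (at_right 1)"
    by (intro tendsto_intros)
  then have "((\<lambda>c. ennreal ((2 * pi * c)\<^sup>2 * (?V pi - ?V 0))) \<longlongrightarrow> ennreal ((2 * pi * 1)\<^sup>2 * (?V pi - ?V 0))) (at_right 1)"
    by (rule tendsto_ennrealI)
  then have "?H S2xS1 \<le> ennreal ((2 * pi * 1)\<^sup>2 * (?V pi - ?V 0))"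
    by (rule tendsto_lowerbound) (use c in \<open>auto simp: eventually_at_right_field intro!: exI[of _ 2]\<close>)
  then show ?thesis by (simp only: vol_primitive_total mult_1_right)
qed

end

section \<open>Lower bound for the volume\<close>

lemma norm_diag3_sq: "(norm (diag3 s f v))\<^sup>2 = (fst v)\<^sup>2 + s\<^sup>2 * (fst (snd v))\<^sup>2 + f\<^sup>2 * (snd (snd v))\<^sup>2"
  by (cases v) (simp add: diag3_def norm_prod_def power_mult_distrib)

text \<open>The margin \<open>\<eta>\<close> keeps the chart away from the poles and makes it
  injective: no two angles differ by nearly \<open>2 * pi\<close>.\<close>

definition chart_box :: "real \<Rightarrow> (real \<times> real \<times> real) set" where
  "chart_box \<eta> = {\<eta>..pi - \<eta>} \<times> {\<eta>..2 * pi - \<eta>} \<times> {\<eta>..2 * pi - \<eta>}"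

lemma compact_chart_box: "compact (chart_box \<eta>)"
  unfolding chart_box_def by (intro compact_Times compact_Icc)

context dissolving_metrics
begin

text \<open>By \<open>chord_polar\<close> the chord controls the sines of the half coordinate
  differences, and \<open>small_angle\<close> turns these into the differences themselves, up to
  the factor \<open>\<kappa>\<close>.\<close>

lemma chart_distortion:
  assumes S: "0 < S" and F: "1 \<le> F" and \<kappa>: "0 < \<kappa>"
    and ab: "a \<in> chart_box \<eta>" "b \<in> chart_box \<eta>" and \<eta>: "0 < \<eta>"
    and sin: "S \<le> sin (fst a)" "S \<le> sin (fst b)"
    and small: "\<And>x. \<bar>x\<bar> \<le> 2 * pi - 2 * \<eta> \<Longrightarrow> 2 * \<bar>sin (x / 2)\<bar> \<le> \<tau> \<Longrightarrow> \<kappa> * \<bar>x\<bar> \<le> 2 * \<bar>sin (x / 2)\<bar>"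
    and d: "wnorm F (polar3 b - polar3 a) \<le> d" "d \<le> \<tau>" "d / S \<le> \<tau>"
  shows "norm (diag3 S F (b - a)) \<le> d / \<kappa>"
proof -
  define p where "p = 2 * \<bar>sin ((fst b - fst a) / 2)\<bar>"
  define q where "q = 2 * \<bar>sin ((fst (snd b) - fst (snd a)) / 2)\<bar>"
  define z where "z = 2 * \<bar>sin ((snd (snd b) - snd (snd a)) / 2)\<bar>"
  have pqz: "0 \<le> p" "0 \<le> q" "0 \<le> z" by (simp_all add: p_def q_def z_def)
  have d0: "0 \<le> d" using d(1) wnorm_nonneg[of F "polar3 b - polar3 a"] by linarith
  have "(wnorm F (polar3 b - polar3 a))\<^sup>2 = p\<^sup>2 + (sin (fst a) * sin (fst b)) * q\<^sup>2 + F\<^sup>2 * z\<^sup>2"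
    unfolding polar3_def chord_polar p_def q_def z_def by (simp add: power_mult_distrib)
  moreover have "(wnorm F (polar3 b - polar3 a))\<^sup>2 \<le> d\<^sup>2" using d(1) by (intro power_mono) auto
  moreover have "S\<^sup>2 * q\<^sup>2 \<le> (sin (fst a) * sin (fst b)) * q\<^sup>2"
    using mult_mono[OF sin(1) sin(2)] S sin by (intro mult_right_mono) (auto simp: power2_eq_square)
  ultimately have main: "p\<^sup>2 + S\<^sup>2 * q\<^sup>2 + F\<^sup>2 * z\<^sup>2 \<le> d\<^sup>2" by linarith
  have nn: "0 \<le> p\<^sup>2" "0 \<le> S\<^sup>2 * q\<^sup>2" "0 \<le> F\<^sup>2 * z\<^sup>2" by simp_all
  have "p\<^sup>2 \<le> d\<^sup>2" using main nn by linarith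
  then have p: "p \<le> \<tau>" using power2_le_imp_le[of p d] d0 d(2) by linarith
  have "(S * q)\<^sup>2 \<le> d\<^sup>2" unfolding power_mult_distrib using main nn by linarith
  then have "S * q \<le> d" using power2_le_imp_le[of "S * q" d] d0 by blast
  then have "q \<le> d / S" using S by (simp add: pos_le_divide_eq mult.commute)
  then have q: "q \<le> \<tau>" using d(3) by linarith
  have "(F * z)\<^sup>2 \<le> d\<^sup>2" unfolding power_mult_distrib using main nn by linarith
  then have "F * z \<le> d" using power2_le_imp_le[of "F * z" d] d0 by blast
  moreover have "1 * z \<le> F * z" using F pqz by (intro mult_right_mono) auto
  ultimately have z: "z \<le> \<tau>" using d(2) by linarith
  have range: "\<bar>fst b - fst a\<bar> \<le> 2 * pi - 2 * \<eta>" "\<bar>fst (snd b) - fst (snd a)\<bar> \<le> 2 * pi - 2 * \<eta>"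
      "\<bar>snd (snd b) - snd (snd a)\<bar> \<le> 2 * pi - 2 * \<eta>"
    using ab pi_gt_zero unfolding chart_box_def mem_Times_iff atLeastAtMost_iff abs_le_iff by linarith+
  have k: "\<kappa> * \<bar>fst b - fst a\<bar> \<le> p" "\<kappa> * \<bar>fst (snd b) - fst (snd a)\<bar> \<le> q" "\<kappa> * \<bar>snd (snd b) - snd (snd a)\<bar> \<le> z"
    using small[OF range(1)] small[OF range(2)] small[OF range(3)] p q z by (simp_all add: p_def q_def z_def)
  have sq: "\<kappa>\<^sup>2 * x\<^sup>2 \<le> y\<^sup>2" if "\<kappa> * \<bar>x\<bar> \<le> y" for x y
    using power_mono[OF that, of 2] \<kappa> by (simp add: power_mult_distrib)
  have "\<kappa>\<^sup>2 * (norm (diag3 S F (b - a)))\<^sup>2 = \<kappa>\<^sup>2 * (fst b - fst a)\<^sup>2 + S\<^sup>2 * (\<kappa>\<^sup>2 * (fst (snd b) - fst (snd a))\<^sup>2)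
     + F\<^sup>2 * (\<kappa>\<^sup>2 * (snd (snd b) - snd (snd a))\<^sup>2)"
    by (simp add: norm_diag3_sq algebra_simps)
  also have "\<dots> \<le> p\<^sup>2 + S\<^sup>2 * q\<^sup>2 + F\<^sup>2 * z\<^sup>2"
    using sq[OF k(1)] sq[OF k(2)] sq[OF k(3)] by (intro add_mono mult_left_mono) auto
  also have "\<dots> \<le> d\<^sup>2" by (rule main)
  finally have "(\<kappa> * norm (diag3 S F (b - a)))\<^sup>2 \<le> d\<^sup>2" by (simp add: power_mult_distrib)
  then have "\<kappa> * norm (diag3 S F (b - a)) \<le> d"
    using power2_le_imp_le[of "\<kappa> * norm (diag3 S F (b - a))" d] d0 by blast
  then show ?thesis using \<kappa> by (simp add: pos_le_divide_eq mult.commute)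
qed

lemma vol_density_measurable [measurable]: "vol_density \<beta> \<in> borel_measurable borel"
  unfolding vol_density_def profile_def by measurable

lemma vol_density_fst_measurable [measurable]:
  "(\<lambda>a :: real \<times> real \<times> real. vol_density \<beta> (fst a)) \<in> borel_measurable borel"
  by (rule measurable_compose[OF borel_measurable_continuous_onI vol_density_measurable]) (intro continuous_on_fst continuous_on_id)

text \<open>Let \<open>E\<close> be the part of \<open>U\<close> in the chart. The limit distance
  bounds the rescaled chord from below, so \<open>E\<close> has diameter at most \<open>d /
  \<kappa>\<close> after rescaling the axes by constants \<open>S\<close> and \<open>F\<close>,
  just below the sine and the warping function on \<open>E\<close>. The isodiametric inequality
  bounds \<open>S * F\<close> times the volume of \<open>E\<close>, and the volume density is only
  slightly larger than \<open>S * F\<close>. The closure \<open>C\<close> of \<open>E\<close>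
  takes the place of \<open>E\<close>, which need not be measurable.\<close>

lemma volume_le_hausdorff_weight:
  assumes c: "1 < c" and \<eta>: "0 < \<eta>" "\<eta> < 1"
  obtains \<delta> where "0 < \<delta>"
    "\<And>U. U \<subseteq> S2xS1 \<Longrightarrow> ediam dlim U \<le> ennreal \<delta> \<Longrightarrow>
      \<exists>C. compact C \<and> {a \<in> chart_box \<eta>. polar3 a \<in> U} \<subseteq> C \<and> C \<subseteq> chart_box \<eta> \<and>
        (\<integral>\<^sup>+a\<in>C. ennreal (vol_density \<beta> (fst a)) \<partial>lborel) \<le> ennreal c * hausdorff_weight dlim 3 U"
proof -
  \<comment> \<open>One factor \<open>sqrt c\<close> of the error is \<open>1 /
  \<kappa>\<^sup>3\<close>, from the distortion of the chart; the other one, below, is the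
  oscillation of the volume density.\<close>
  define \<kappa> where "\<kappa> = root 3 (1 / sqrt c)"
  have \<kappa>: "0 < \<kappa>" "\<kappa> < 1" "\<kappa> ^ 3 = 1 / sqrt c"
    using c by (auto simp: \<kappa>_def real_root_pow_pos)
  have \<eta>2: "\<eta> < pi / 2" using \<eta> pi_gt3 by linarith
  obtain \<tau> where \<tau>: "0 < \<tau>" "\<And>x. \<bar>x\<bar> \<le> 2 * pi - 2 * \<eta> \<Longrightarrow> 2 * \<bar>sin (x / 2)\<bar> \<le> \<tau> \<Longrightarrow> \<kappa> * \<bar>x\<bar> \<le> 2 * \<bar>sin (x / 2)\<bar>"
    using small_angle[OF \<eta>(1) \<eta>2 \<kappa>(2)] by metis
  define s0 where "s0 = sin \<eta>"
  have s0: "0 < s0" unfolding s0_def using \<eta> \<eta>2 by (intro sin_gt_zero) auto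
  have sc: "1 < sqrt c" using c by simp
  \<comment> \<open>A bound for the quotient of the volume density and \<open>S * F\<close> on a
  set of diameter \<open>x\<close>.\<close>
  let ?q = "\<lambda>x. (s0 + x) / (s0 - x) * (1 + 2 * ln ((s0 + 3 * x) / (s0 - x)))"
  have "(?q \<longlongrightarrow> 1) (at_right 0)" using s0 by real_asymp
  then have e1: "eventually (\<lambda>x. ?q x < sqrt c) (at_right 0)" using sc by (rule order_tendstoD(2))
  have "((\<lambda>x. x / (s0 - x)) \<longlongrightarrow> 0) (at_right 0)" using s0 by real_asymp
  then have e2: "eventually (\<lambda>x. x / (s0 - x) < \<tau>) (at_right 0)" using \<tau>(1) by (rule order_tendstoD(2))
  have e3: "eventually (\<lambda>x. x \<in> {0<..<min (s0 / 2) (min \<tau> (1/6))}) (at_right 0)"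
    using s0 \<tau>(1) by (intro eventually_at_right_real) auto
  obtain \<delta> where \<delta>: "?q \<delta> < sqrt c" "\<delta> / (s0 - \<delta>) < \<tau>" "\<delta> \<in> {0<..<min (s0 / 2) (min \<tau> (1/6))}"
    using eventually_happens'[OF trivial_limit_at_right_real eventually_conj[OF e1 eventually_conj[OF e2 e3]]] by auto
  then have \<delta>': "0 < \<delta>" "\<delta> < s0 / 2" "\<delta> < \<tau>" "\<delta> < 1/6" by auto
  show thesis
  proof (rule that[OF \<delta>'(1)])
    fix U assume U: "U \<subseteq> S2xS1" "ediam dlim U \<le> ennreal \<delta>"
    define E where "E = {a \<in> chart_box \<eta>. polar3 a \<in> U}"
    show "\<exists>C. compact C \<and> {a \<in> chart_box \<eta>. polar3 a \<in> U} \<subseteq> C \<and> C \<subseteq> chart_box \<eta> \<and>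
        (\<integral>\<^sup>+a\<in>C. ennreal (vol_density \<beta> (fst a)) \<partial>lborel) \<le> ennreal c * hausdorff_weight dlim 3 U"
    proof (cases "E = {}")
      case True
      then show ?thesis by (intro exI[of _ "{}"]) (simp add: E_def)
    next
      case False
      then obtain a0 where a0: "a0 \<in> E" by auto
      define d where "d = enn2real (ediam dlim U)"
      have d: "0 \<le> d" "d \<le> \<delta>" unfolding d_def using U(2) \<delta>' by (auto intro: enn2real_leI)
      define \<sigma> where "\<sigma> = sin (fst a0)"
      have sinE: "s0 \<le> sin (fst a)" "axis_dist (polar3 a) = sin (fst a)" if a: "a \<in> chart_box \<eta>" for a
      proof -
        have r: "\<eta> \<le> fst a" "fst a \<le> pi - \<eta>" using a by (auto simp: chart_box_def)
        show "s0 \<le> sin (fst a)"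
        proof (cases "fst a \<le> pi / 2")
          case True then show ?thesis unfolding s0_def using r \<eta> by (intro sin_monotone_2pi_le) auto
        next
          case False
          then have "s0 \<le> sin (pi - fst a)" unfolding s0_def using r \<eta> by (intro sin_monotone_2pi_le) auto
          then show ?thesis by simp
        qed
        show "axis_dist (polar3 a) = sin (fst a)" unfolding polar3_def using r \<eta> by (intro axis_dist_polar_point) auto
      qed
      have pS: "polar3 a \<in> S2xS1" for a by (simp add: polar3_def polar_point_in)
      have dE: "dlim (polar3 a) (polar3 b) \<le> d" if "a \<in> E" "b \<in> E" for a b
        unfolding d_def using that by (intro dist_le_hausdorff_diam[OF U(2)]) (auto simp: E_def)
      have \<sigma>E: "\<bar>sin (fst a) - \<sigma>\<bar> \<le> \<delta>" if "a \<in> E" for a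
        using axis_dist_lipschitz[of "polar3 a" "polar3 a0"] dist_le_dlim[OF pS pS, of a a0] dE[OF that a0] d
          sinE(2)[of a] sinE(2)[of a0] that a0 by (simp add: E_def \<sigma>_def)
      have \<sigma>: "s0 \<le> \<sigma>" "\<sigma> \<le> 1" using sinE(1)[of a0] a0 by (auto simp: E_def \<sigma>_def)
      define S where "S = \<sigma> - \<delta>"
      have S: "0 < S" "s0 - \<delta> \<le> S" using \<sigma> \<delta>' s0 by (auto simp: S_def)
      \<comment> \<open>Points of \<open>E\<close> have \<open>axis_dist\<close> at most
      \<open>\<sigma> + \<delta>\<close>, and \<open>dlim_lower_bound\<close> with \<open>l = 2 *
      \<delta>\<close> adds \<open>2 * \<delta>\<close>.\<close>
      define F where "F = profile \<beta> 0 (\<sigma> + 3 * \<delta>)"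
      have F: "1 \<le> F"
      proof -
        have "ln (3/2 :: real) \<le> 1/2" using ln_le_minus_one[of "3/2"] by simp
        moreover have "profile \<beta> 0 (3/2) = \<beta> - 2 * ln (3/2)"
          using ln_realpow[of "3/2" 2] by (simp add: profile_def ln_div power_divide)
        ultimately have "1 \<le> profile \<beta> 0 (3/2)" using \<beta> by simp
        also have "\<dots> \<le> F" unfolding F_def using \<sigma> \<delta>' s0 by (intro profile_antimono) auto
        finally show ?thesis .
      qed
      have diamE: "norm (diag3 S F (b - a)) \<le> d / \<kappa>" if ab: "a \<in> E" "b \<in> E" for a b
      proof (rule chart_distortion[OF S(1) F \<kappa>(1) _ _ \<eta>(1) _ _ \<tau>(2)])
        show "S \<le> sin (fst a)" "S \<le> sin (fst b)" using \<sigma>E[OF ab(1)] \<sigma>E[OF ab(2)] by (auto simp: S_def)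
        have "dlim (polar3 a) (polar3 b) < 2 * \<delta>" using dE[OF ab] d \<delta>' by linarith
        then have "wnorm (profile \<beta> 0 (axis_dist (polar3 a) + 2 * \<delta>)) (polar3 b - polar3 a) \<le> dlim (polar3 a) (polar3 b)"
          using \<delta>' by (intro dlim_lower_bound pS) auto
        moreover have "wnorm F (polar3 b - polar3 a) \<le> wnorm (profile \<beta> 0 (axis_dist (polar3 a) + 2 * \<delta>)) (polar3 b - polar3 a)"
        proof (rule wnorm_mono)
          have "axis_dist (polar3 a) = sin (fst a)" "s0 \<le> sin (fst a)" using ab sinE by (auto simp: E_def)
          then show "F \<le> profile \<beta> 0 (axis_dist (polar3 a) + 2 * \<delta>)"
            unfolding F_def using \<sigma>E[OF ab(1)] \<delta>' s0 by (intro profile_antimono) auto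
        qed (use F in simp)
        ultimately show "wnorm F (polar3 b - polar3 a) \<le> d" using dE[OF ab] by linarith
        show "d \<le> \<tau>" using d \<delta>' by linarith
        have "d / S \<le> \<delta> / (s0 - \<delta>)" using d S \<delta>' s0 by (intro frac_le) auto
        then show "d / S \<le> \<tau>" using \<delta>(2) by linarith
      qed (use ab in \<open>auto simp: E_def\<close>)
      define C where "C = closure E"
      have EK: "E \<subseteq> chart_box \<eta>" by (auto simp: E_def)
      have CK: "C \<subseteq> chart_box \<eta>"
        unfolding C_def by (rule closure_minimal[OF EK compact_imp_closed[OF compact_chart_box]])
      have C: "compact C" unfolding C_def
        using compact_closure bounded_subset[OF compact_imp_bounded[OF compact_chart_box] EK] by blast
      have diamC: "norm (diag3 S F (x - y)) \<le> d / \<kappa>" if "x \<in> C" "y \<in> C" for x y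
      proof -
        have "closed {z :: (real \<times> real \<times> real) \<times> (real \<times> real \<times> real). norm (diag3 S F (fst z - snd z)) \<le> d / \<kappa>}"
          by (intro closed_Collect_le continuous_on_norm continuous_on_const
              continuous_on_compose2[OF continuous_on_diag3[of UNIV]] continuous_intros) auto
        moreover have "E \<times> E \<subseteq> {z. norm (diag3 S F (fst z - snd z)) \<le> d / \<kappa>}" using diamE by auto
        ultimately have "closure (E \<times> E) \<subseteq> {z. norm (diag3 S F (fst z - snd z)) \<le> d / \<kappa>}" by (intro closure_minimal)
        then show ?thesis using that by (auto simp: closure_Times C_def)
      qed
      have iso: "S * F * measure lborel C \<le> unit_ball_vol 3 * (d / \<kappa> / 2) ^ 3"
        by (rule isodiametric_diag3[OF C S(1) _ _ diamC]) (use F d \<kappa> in auto)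
      define W where "W = (\<sigma> + \<delta>) * profile \<beta> 0 S"
      have PS: "0 \<le> profile \<beta> 0 S" using profile_ge[of 0 S \<beta>] S \<sigma> \<delta>' \<beta> by (auto simp: S_def)
      have W0: "0 \<le> W" using PS \<sigma> s0 \<delta>' by (simp add: W_def)
      have dens: "vol_density \<beta> (fst a) \<le> W" if "a \<in> C" for a
      proof -
        have "closed {a :: real \<times> real \<times> real. \<bar>sin (fst a) - \<sigma>\<bar> \<le> \<delta>}"
          by (intro closed_Collect_le continuous_intros)
        then have "C \<subseteq> {a. \<bar>sin (fst a) - \<sigma>\<bar> \<le> \<delta>}" unfolding C_def using \<sigma>E by (intro closure_minimal) auto
        then have b: "\<bar>sin (fst a) - \<sigma>\<bar> \<le> \<delta>" using that by auto
        have "0 < sin (fst a)" using b S by (auto simp: S_def)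
        moreover have "profile \<beta> 0 (sin (fst a)) \<le> profile \<beta> 0 S" using b S by (intro profile_antimono) (auto simp: S_def)
        moreover have "0 \<le> profile \<beta> 0 (sin (fst a))"
          using profile_ge[of 0 "sin (fst a)" \<beta>] \<open>0 < sin (fst a)\<close> \<beta> by simp
        ultimately show ?thesis unfolding vol_density_def W_def using b PS \<sigma> s0 \<delta>' by (intro mult_mono) auto
      qed
      have "(\<integral>\<^sup>+a\<in>C. ennreal (vol_density \<beta> (fst a)) \<partial>lborel) \<le> (\<integral>\<^sup>+a\<in>C. ennreal W \<partial>lborel)"
        using dens by (intro nn_integral_mono) (auto simp: ennreal_leI split: split_indicator)
      also have "\<dots> = ennreal W * emeasure lborel C" using borel_compact[OF C] by (simp add: nn_integral_cmult_indicator)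
      also have "emeasure lborel C = ennreal (measure lborel C)"
        using emeasure_compact_finite[OF C] by (intro emeasure_eq_ennreal_measure) (simp add: less_top)
      also have "ennreal W * ennreal (measure lborel C) = ennreal (W * measure lborel C)" using W0 by (simp add: ennreal_mult)
      also have "\<dots> \<le> ennreal (c * (unit_ball_vol 3 / 8 * d ^ 3))"
      proof (rule ennreal_leI)
        have r1: "(\<sigma> + \<delta>) / S \<le> (s0 + \<delta>) / (s0 - \<delta>)"
        proof -
          have "\<delta> * s0 \<le> \<delta> * \<sigma>" using \<sigma> \<delta>' by (intro mult_left_mono) auto
          then have "(\<sigma> + \<delta>) * (s0 - \<delta>) \<le> (s0 + \<delta>) * S" by (simp add: S_def algebra_simps)
          then show ?thesis using S \<delta>' s0 by (simp add: divide_simps mult.commute)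
        qed
        have r2: "profile \<beta> 0 S / F \<le> 1 + 2 * ln ((s0 + 3 * \<delta>) / (s0 - \<delta>))"
        proof -
          have "\<delta> * s0 \<le> \<delta> * \<sigma>" using \<sigma> \<delta>' by (intro mult_left_mono) auto
          then have "(\<sigma> + 3 * \<delta>) * (s0 - \<delta>) \<le> (s0 + 3 * \<delta>) * S" by (simp add: S_def algebra_simps)
          then have q: "(\<sigma> + 3 * \<delta>) / S \<le> (s0 + 3 * \<delta>) / (s0 - \<delta>)" using S \<delta>' s0 by (simp add: divide_simps mult.commute)
          have pos: "0 < \<sigma> + 3 * \<delta>" using \<sigma> s0 \<delta>' by linarith
          have "1 \<le> (s0 + 3 * \<delta>) / (s0 - \<delta>)" using \<delta>' s0 by (simp add: pos_le_divide_eq)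
          then have l0: "0 \<le> ln ((s0 + 3 * \<delta>) / (s0 - \<delta>))" by simp
          have "profile \<beta> 0 S = F + 2 * ln ((\<sigma> + 3 * \<delta>) / S)"
            using S pos by (simp add: F_def profile_def ln_div ln_realpow)
          also have "ln ((\<sigma> + 3 * \<delta>) / S) \<le> ln ((s0 + 3 * \<delta>) / (s0 - \<delta>))" using q pos S by (intro ln_mono) auto
          finally have "profile \<beta> 0 S \<le> F + 2 * ln ((s0 + 3 * \<delta>) / (s0 - \<delta>))" by simp
          also have "\<dots> \<le> F + F * (2 * ln ((s0 + 3 * \<delta>) / (s0 - \<delta>)))"
            using mult_right_mono[OF F, of "2 * ln ((s0 + 3 * \<delta>) / (s0 - \<delta>))"] l0 by simp
          finally show ?thesis using F by (simp add: pos_divide_le_eq algebra_simps)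
        qed
        have "W / (S * F) = (\<sigma> + \<delta>) / S * (profile \<beta> 0 S / F)" by (simp add: W_def)
        also have "\<dots> \<le> ?q \<delta>" using r1 r2 PS F S \<sigma> s0 \<delta>' by (intro mult_mono) auto
        also have "\<dots> \<le> sqrt c" using \<delta>(1) by simp
        finally have "W \<le> sqrt c * (S * F)" using S F by (simp add: pos_divide_le_eq)
        then have "W * measure lborel C \<le> sqrt c * (S * F) * measure lborel C" by (intro mult_right_mono) auto
        also have "\<dots> = sqrt c * (S * F * measure lborel C)" by simp
        also have "\<dots> \<le> sqrt c * (unit_ball_vol 3 * (d / \<kappa> / 2) ^ 3)" using iso c by (intro mult_left_mono) auto
        also have "(d / \<kappa> / 2) ^ 3 = d ^ 3 / 8 / \<kappa> ^ 3" by (simp add: power_divide)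
        also have "\<dots> = sqrt c * (d ^ 3 / 8)" unfolding \<kappa>(3) by simp
        also have "sqrt c * (unit_ball_vol 3 * (sqrt c * (d ^ 3 / 8))) = (sqrt c * sqrt c) * (unit_ball_vol 3 / 8 * d ^ 3)" by simp
        also have "sqrt c * sqrt c = c" using c by simp
        finally show "W * measure lborel C \<le> c * (unit_ball_vol 3 / 8 * d ^ 3)" .
      qed
      also have "\<dots> = ennreal c * hausdorff_weight dlim 3 U"
      proof -
        have "U \<noteq> {}" using a0 by (auto simp: E_def)
        moreover have "d powr 3 = d ^ 3" using d by (cases "d = 0") (simp_all add: powr_numeral)
        ultimately have hw: "hausdorff_weight dlim 3 U = ennreal (unit_ball_vol 3 / 8 * d ^ 3)"
          by (simp add: hausdorff_weight_def d_def[symmetric] powr_numeral)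
        show ?thesis unfolding hw by (rule ennreal_mult) (use c d in auto)
      qed
      finally have "(\<integral>\<^sup>+a\<in>C. ennreal (vol_density \<beta> (fst a)) \<partial>lborel) \<le> ennreal c * hausdorff_weight dlim 3 U" .
      then show ?thesis using C CK closure_subset[of E] unfolding E_def[symmetric] C_def[symmetric] by blast
    qed
  qed
qed

text \<open>Fubini and the primitive of the volume density.\<close>

lemma chart_box_volume:
  assumes \<eta>: "0 < \<eta>" "\<eta> < 1"
  shows "(\<integral>\<^sup>+a\<in>chart_box \<eta>. ennreal (vol_density \<beta> (fst a)) \<partial>lborel)
    = ennreal ((2 * pi - 2 * \<eta>)\<^sup>2 * (vol_primitive \<beta> (pi - \<eta>) - vol_primitive \<beta> \<eta>))"
proof -
  let ?B = "{\<eta>..2 * pi - \<eta>} \<times> {\<eta>..2 * pi - \<eta>} :: (real \<times> real) set"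
  have pi3: "\<eta> \<le> pi - \<eta>" "\<eta> \<le> 2 * pi - \<eta>" using \<eta> pi_gt3 by auto
  have eB: "?B = cbox (\<eta>, \<eta>) (2 * pi - \<eta>, 2 * pi - \<eta>)" by (simp add: cbox_Pair_eq)
  have B: "emeasure lborel ?B = ennreal ((2 * pi - 2 * \<eta>)\<^sup>2)"
  proof -
    have "measure lborel (cbox (\<eta>, \<eta>) (2 * pi - \<eta>, 2 * pi - \<eta>)) = (2 * pi - 2 * \<eta>)\<^sup>2"
      using pi3 by (simp add: content_Pair power2_eq_square)
    then show ?thesis unfolding eB
      using emeasure_eq_ennreal_measure[of lborel "cbox (\<eta>, \<eta>) (2 * pi - \<eta>, 2 * pi - \<eta>)"]
      emeasure_lborel_cbox_finite[of "(\<eta>, \<eta>)" "(2 * pi - \<eta>, 2 * pi - \<eta>)"] by (simp add: less_top)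
  qed
  have Bm [measurable]: "?B \<in> sets borel" unfolding eB by simp
  let ?f = "\<lambda>a :: real \<times> real \<times> real. ennreal (vol_density \<beta> (fst a)) * indicator (chart_box \<eta>) a"
  have Km [measurable]: "chart_box \<eta> \<in> sets borel" by (rule borel_compact[OF compact_chart_box])
  have "?f \<in> borel_measurable borel" by measurable
  then have fm: "?f \<in> borel_measurable (lborel \<Otimes>\<^sub>M lborel)" unfolding lborel_prod by simp
  have "(\<integral>\<^sup>+a. ?f a \<partial>lborel) = (\<integral>\<^sup>+x. (\<integral>\<^sup>+y. ?f (x, y) \<partial>lborel) \<partial>lborel)"
    using lborel.nn_integral_fst[OF fm] by (simp add: lborel_prod)
  also have "\<dots> = (\<integral>\<^sup>+x. ennreal ((2 * pi - 2 * \<eta>)\<^sup>2) * (ennreal (vol_density \<beta> x) * indicator {\<eta>..pi - \<eta>} x) \<partial>lborel)"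
  proof (rule nn_integral_cong)
    fix x
    have "?f (x, y) = (ennreal (vol_density \<beta> x) * indicator {\<eta>..pi - \<eta>} x) * indicator ?B y" for y
      by (auto simp: chart_box_def split: split_indicator)
    then have "(\<integral>\<^sup>+y. ?f (x, y) \<partial>lborel) = (ennreal (vol_density \<beta> x) * indicator {\<eta>..pi - \<eta>} x) * emeasure lborel ?B"
      by (simp add: nn_integral_cmult_indicator)
    then show "(\<integral>\<^sup>+y. ?f (x, y) \<partial>lborel) = ennreal ((2 * pi - 2 * \<eta>)\<^sup>2) * (ennreal (vol_density \<beta> x) * indicator {\<eta>..pi - \<eta>} x)"
      unfolding B by (simp add: mult.commute)
  qed
  also have "\<dots> = ennreal ((2 * pi - 2 * \<eta>)\<^sup>2) * (\<integral>\<^sup>+x. ennreal (vol_density \<beta> x) * indicator {\<eta>..pi - \<eta>} x \<partial>lborel)"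
    by (rule nn_integral_cmult) measurable
  also have "(\<integral>\<^sup>+x. ennreal (vol_density \<beta> x) * indicator {\<eta>..pi - \<eta>} x \<partial>lborel)
      = ennreal (vol_primitive \<beta> (pi - \<eta>) - vol_primitive \<beta> \<eta>)"
  proof (rule nn_integral_FTC_Icc)
    fix x assume x: "x \<in> {\<eta>..pi - \<eta>}"
    then show "DERIV (vol_primitive \<beta>) x :> vol_density \<beta> x" using \<eta> by (intro vol_primitive_deriv) auto
    show "0 \<le> vol_density \<beta> x" using x \<eta> by (intro vol_density_nonneg) auto
  qed (use pi3 in auto)
  finally show ?thesis by (simp add: ennreal_mult')
qed

text \<open>For every cover by sets of small diameter the closed sets of
  \<open>volume_le_hausdorff_weight\<close> cover the chart box, so their volumes add up to at
  least its volume; then the margin \<open>\<eta>\<close> tends to 0.\<close>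

lemma volume_lower_bound:
  "ennreal ((2 * pi)\<^sup>2 * (2 * \<beta> + 4 - 2 * ln 4)) \<le> hausdorff_measure S2xS1 dlim 3 S2xS1"
proof -
  let ?H = "hausdorff_measure S2xS1 dlim 3 S2xS1" and ?V = "vol_primitive \<beta>"
  let ?v = "\<lambda>\<eta>. (2 * pi - 2 * \<eta>)\<^sup>2 * (?V (pi - \<eta>) - ?V \<eta>)"
  have bound: "ennreal (?v \<eta> / (1 + \<eta>)) \<le> ?H" if \<eta>: "0 < \<eta>" "\<eta> < 1" for \<eta>
  proof -
    obtain \<delta> where \<delta>: "0 < \<delta>"
      "\<And>U. U \<subseteq> S2xS1 \<Longrightarrow> ediam dlim U \<le> ennreal \<delta> \<Longrightarrow>
        \<exists>C. compact C \<and> {a \<in> chart_box \<eta>. polar3 a \<in> U} \<subseteq> C \<and> C \<subseteq> chart_box \<eta> \<and>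
          (\<integral>\<^sup>+a\<in>C. ennreal (vol_density \<beta> (fst a)) \<partial>lborel) \<le> ennreal (1 + \<eta>) * hausdorff_weight dlim 3 U"
      using volume_le_hausdorff_weight[OF _ \<eta>, of "1 + \<eta>"] \<eta>(1) by auto
    have "ennreal (?v \<eta> / (1 + \<eta>)) \<le> hausdorff_premeasure S2xS1 dlim 3 \<delta> S2xS1"
      unfolding hausdorff_premeasure_def
    proof (rule Inf_greatest, clarify)
      fix U :: "nat \<Rightarrow> ((real^3) \<times> complex) set"
      assume cov: "S2xS1 \<subseteq> (\<Union>i. U i)" and U: "\<forall>i. U i \<subseteq> S2xS1 \<and> ediam dlim (U i) \<le> ennreal \<delta>"
      have "\<forall>i. \<exists>C. compact C \<and> {a \<in> chart_box \<eta>. polar3 a \<in> U i} \<subseteq> C \<and> C \<subseteq> chart_box \<eta> \<and>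
          (\<integral>\<^sup>+a\<in>C. ennreal (vol_density \<beta> (fst a)) \<partial>lborel) \<le> ennreal (1 + \<eta>) * hausdorff_weight dlim 3 (U i)"
        using \<delta>(2) U by blast
      from choice[OF this] obtain C where
        "\<forall>i. compact (C i) \<and> {a \<in> chart_box \<eta>. polar3 a \<in> U i} \<subseteq> C i \<and> C i \<subseteq> chart_box \<eta> \<and>
          (\<integral>\<^sup>+a\<in>C i. ennreal (vol_density \<beta> (fst a)) \<partial>lborel) \<le> ennreal (1 + \<eta>) * hausdorff_weight dlim 3 (U i)"
        by blast
      then have C: "\<And>i. compact (C i)" "\<And>i. {a \<in> chart_box \<eta>. polar3 a \<in> U i} \<subseteq> C i"
          "\<And>i. (\<integral>\<^sup>+a\<in>C i. ennreal (vol_density \<beta> (fst a)) \<partial>lborel) \<le> ennreal (1 + \<eta>) * hausdorff_weight dlim 3 (U i)"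
        by simp_all
      define \<mu> where "\<mu> = density lborel (\<lambda>a :: real \<times> real \<times> real. ennreal (vol_density \<beta> (fst a)))"
      have em: "emeasure \<mu> A = (\<integral>\<^sup>+a\<in>A. ennreal (vol_density \<beta> (fst a)) \<partial>lborel)" if "compact A" for A
        unfolding \<mu>_def using borel_compact[OF that] by (subst emeasure_density) simp_all
      have sets: "C i \<in> sets \<mu>" for i using borel_compact[OF C(1)] by (simp add: \<mu>_def)
      have "chart_box \<eta> \<subseteq> (\<Union>i. C i)"
      proof
        fix a assume a: "a \<in> chart_box \<eta>"
        have "polar3 a \<in> S2xS1" by (simp add: polar3_def polar_point_in)
        then obtain i where "polar3 a \<in> U i" using cov by auto
        then show "a \<in> (\<Union>i. C i)" using C(2) a by blast
      qed
      then have "emeasure \<mu> (chart_box \<eta>) \<le> emeasure \<mu> (\<Union>i. C i)"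
        using sets by (intro emeasure_mono) auto
      also have "\<dots> \<le> (\<Sum>i. emeasure \<mu> (C i))" using sets by (intro emeasure_subadditive_countably) auto
      also have "\<dots> \<le> (\<Sum>i. ennreal (1 + \<eta>) * hausdorff_weight dlim 3 (U i))"
        unfolding em[OF C(1)] by (intro suminf_le C(3)) auto
      also have "\<dots> = ennreal (1 + \<eta>) * (\<Sum>i. hausdorff_weight dlim 3 (U i))" by simp
      finally have "ennreal (?v \<eta>) \<le> ennreal (1 + \<eta>) * (\<Sum>i. hausdorff_weight dlim 3 (U i))"
        unfolding em[OF compact_chart_box] chart_box_volume[OF \<eta>] .
      then have "ennreal (1 / (1 + \<eta>)) * ennreal (?v \<eta>) \<le> ennreal (1 / (1 + \<eta>)) * (ennreal (1 + \<eta>) * (\<Sum>i. hausdorff_weight dlim 3 (U i)))"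
        by (rule mult_left_mono) simp
      also have "\<dots> = (\<Sum>i. hausdorff_weight dlim 3 (U i))"
      proof -
        have "ennreal (1 / (1 + \<eta>)) * ennreal (1 + \<eta>) = 1" using \<eta> by (subst ennreal_mult[symmetric]) auto
        then show ?thesis by (simp only: mult.assoc[symmetric] mult_1)
      qed
      also have "ennreal (1 / (1 + \<eta>)) * ennreal (?v \<eta>) = ennreal (?v \<eta> / (1 + \<eta>))"
        using \<eta> by (subst ennreal_mult'[symmetric]) auto
      finally show "ennreal (?v \<eta> / (1 + \<eta>)) \<le> (\<Sum>i. hausdorff_weight dlim 3 (U i))" .
    qed
    also have "\<dots> \<le> ?H" unfolding hausdorff_measure_def using \<delta>(1) by (intro SUP_upper) simp
    finally show ?thesis .
  qed
  have ct: "(?V \<longlongrightarrow> ?V x) (at x)" for x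
    using continuous_on_vol_primitive[of \<beta>] by (simp add: continuous_on_eq_continuous_at isCont_def)
  have "(?V \<longlongrightarrow> ?V 0) (at_right 0)" using ct filterlim_at_split by blast
  moreover have "((\<lambda>\<eta>. ?V (pi - \<eta>)) \<longlongrightarrow> ?V pi) (at_right 0)"
    by (rule isCont_tendsto_compose[of pi ?V]) (use ct in \<open>auto simp: isCont_def intro!: tendsto_eq_intros\<close>)
  ultimately have "((\<lambda>\<eta>. ?v \<eta> / (1 + \<eta>)) \<longlongrightarrow> (2 * pi - 2 * 0)\<^sup>2 * (?V pi - ?V 0) / (1 + 0)) (at_right 0)"
    by (intro tendsto_intros) auto
  then have "((\<lambda>\<eta>. ennreal (?v \<eta> / (1 + \<eta>))) \<longlongrightarrow> ennreal ((2 * pi - 2 * 0)\<^sup>2 * (?V pi - ?V 0) / (1 + 0))) (at_right 0)"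
    by (rule tendsto_ennrealI)
  then have "ennreal ((2 * pi - 2 * 0)\<^sup>2 * (?V pi - ?V 0) / (1 + 0)) \<le> ?H"
    by (rule tendsto_upperbound) (use bound in \<open>auto simp: eventually_at_right_field intro!: exI[of _ 1]\<close>)
  then show ?thesis by (simp add: vol_primitive_total)
qed

end

section \<open>The limit space\<close>

theorem theorem1p3:
  fixes \<beta> :: real and a :: "nat \<Rightarrow> real"
  assumes "\<beta> \<ge> 2"
    and "\<And>j. a j > 0"
    and "decseq a"
    and "a \<longlonglongrightarrow> 0"
  shows "\<exists>d :: (real^3) \<times> complex \<Rightarrow> (real^3) \<times> complex \<Rightarrow> real.
    Metric_space S2xS1 d \<and>
    \<comment> \<open>(1)\<close>
    uniform_limit (S2xS1 \<times> S2xS1)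
      (\<lambda>j (p, q). riem_dist S2xS1 (warped_metric (f_reg \<beta> (a j))) p q)
      (\<lambda>(p, q). d p q) sequentially \<and>
    (\<lambda>j. GH_dist S2xS1 (riem_dist S2xS1 (warped_metric (f_reg \<beta> (a j)))) S2xS1 d)
      \<longlonglongrightarrow> 0 \<and>
    \<comment> \<open>(2)\<close>
    is_metric_completion S2xS1 d
      (S2xS1 - singular_set)
      (riem_dist (S2xS1 - singular_set) (warped_metric (f_inf \<beta>))) \<and>
    \<comment> \<open>(3)\<close>
    compact_space (Metric_space.mtopology S2xS1 d) \<and>
    Metric_space.mtopology S2xS1 d homeomorphic_space
      Metric_space.mtopology S2xS1 (riem_dist S2xS1 (warped_metric (\<lambda>_. 1))) \<and>
    \<comment> \<open>(4)\<close>
    hausdorff_dim S2xS1 d singular_set = 1 \<and>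
    curve_length d 0 (2 * pi) (\<lambda>t. polar_point 0 0 t) = \<infinity> \<and>
    curve_length d 0 (2 * pi) (\<lambda>t. polar_point pi 0 t) = \<infinity> \<and>
    hausdorff_measure S2xS1 d 1 singular_set = \<infinity> \<and>
    \<comment> \<open>(5)\<close>
    hausdorff_measure S2xS1 d 3 S2xS1 = ennreal ((2 * pi)\<^sup>2 * (2 * \<beta> + 4 - 2 * ln 4))"
proof -
  interpret dissolving_metrics \<beta> by unfold_locales (rule assms(1))
  note apos = assms(2)
  \<comment> \<open>Together with \<open>dreg a \<le> dlim\<close> this is the uniform
  convergence.\<close>
  have approx: "\<exists>J. \<forall>j\<ge>J. \<forall>p q. dlim p q \<le> dreg (a j) p q + e" if e: "0 < e" for e
  proof -
    obtain \<alpha> where \<alpha>: "0 < \<alpha>" "\<And>b p q. 0 < b \<Longrightarrow> b \<le> \<alpha> \<Longrightarrow> dlim p q \<le> dreg b p q + e"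
      by (rule dlim_uniform[OF e]) blast
    have "eventually (\<lambda>j. a j < \<alpha>) sequentially" using assms(4) \<alpha>(1) by (rule order_tendstoD(2))
    then obtain J where "\<And>j. j \<ge> J \<Longrightarrow> a j < \<alpha>" unfolding eventually_sequentially by auto
    then show ?thesis using \<alpha>(2)[OF apos] less_imp_le by blast
  qed
  have 1: "uniform_limit (S2xS1 \<times> S2xS1) (\<lambda>j (p, q). dreg (a j) p q) (\<lambda>(p, q). dlim p q) sequentially"
  proof (rule uniform_limitI)
    fix e :: real assume "0 < e"
    then have "0 < e / 2" by simp
    then obtain J where J: "\<And>j p q. j \<ge> J \<Longrightarrow> dlim p q \<le> dreg (a j) p q + e / 2" using approx by blast
    have "dist (dreg (a j) p q) (dlim p q) < e" if "j \<ge> J" for j p q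
      using J[OF that, of p q] dreg_le_dlim[OF apos, of j p q] \<open>0 < e\<close> by (simp add: dist_real_def)
    then show "\<forall>\<^sub>F j in sequentially. \<forall>x\<in>S2xS1 \<times> S2xS1. dist (case x of (p, q) \<Rightarrow> dreg (a j) p q) (case x of (p, q) \<Rightarrow> dlim p q) < e"
      unfolding eventually_sequentially by (intro exI[of _ J]) auto
  qed
  have 2: "(\<lambda>j. GH_dist S2xS1 (dreg (a j)) S2xS1 dlim) \<longlonglongrightarrow> 0"
  proof (rule order_tendstoI)
    fix e :: ennreal assume "0 < e"
    then obtain x where x: "0 < x" "x < e" using dense by blast
    define r where "r = enn2real x"
    have "x < top" using x(2) top.not_eq_extremum by fastforce
    then have r: "0 < r" "ennreal r < e" using x by (simp_all add: r_def enn2real_positive_iff)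
    have "0 < 2 * r" using r by simp
    then obtain J where J: "\<And>j p q. j \<ge> J \<Longrightarrow> dlim p q \<le> dreg (a j) p q + 2 * r" using approx by blast
    have "GH_dist S2xS1 (dreg (a j)) S2xS1 dlim \<le> ennreal r" if "j \<ge> J" for j
      using J[OF that] dreg_le_dlim[OF apos] r(1)
      by (intro GH_dist_le_uniform reg_metric apos Metric_space_dlim) auto
    then show "\<forall>\<^sub>F j in sequentially. GH_dist S2xS1 (dreg (a j)) S2xS1 dlim < e"
      unfolding eventually_sequentially using le_less_trans[OF _ r(2)] by blast
  qed simp
  have compact: "compact_space (Metric_space.mtopology S2xS1 dlim)"
    unfolding mtopology_dlim using compact_S2xS1 by (simp add: compact_space_subtopology)
  have 3: "is_metric_completion S2xS1 dlim (S2xS1 - singular_set) dsing"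
    unfolding is_metric_completion_def
  proof (intro conjI exI)
    show "Metric_space (S2xS1 - singular_set) dsing" by (rule sing.Metric_space_dist)
    show "Metric_space S2xS1 dlim" by (rule Metric_space_dlim)
    show "Metric_space.mcomplete S2xS1 dlim"
      by (rule Metric_space.compact_space_imp_mcomplete[OF Metric_space_dlim compact])
    show "isometric_embedding (S2xS1 - singular_set) dsing S2xS1 dlim id"
      using dlim_eq_dsing by (auto simp: isometric_embedding_def)
    have "S2xS1 \<subseteq> closure (S2xS1 - singular_set)"
    proof
      fix p assume "p \<in> S2xS1"
      then show "p \<in> closure (S2xS1 - singular_set)"
        unfolding closure_approachable using regular_part_dense[of p] by (auto simp: dist_commute)
    qed
    then show "Metric_space.mtopology S2xS1 dlim closure_of id ` (S2xS1 - singular_set) = S2xS1"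
      unfolding mtopology_dlim by (auto simp: closure_of_subtopology Int_absorb1)
  qed
  \<comment> \<open>Both metrics induce the Euclidean subspace topology.\<close>
  have 4: "Metric_space.mtopology S2xS1 dlim homeomorphic_space
      Metric_space.mtopology S2xS1 (riem_dist S2xS1 (warped_metric (\<lambda>_. 1)))"
  proof -
    interpret P: warped_space S2xS1 "\<lambda>_. 1" by (rule warped_space_product)
    have "Metric_space.mtopology S2xS1 P.d = top_of_set S2xS1"
    proof (rule mtopology_eq_euclidean[OF P.Metric_space_dist P.dist_le_riem_dist])
      fix p e assume p: "p \<in> S2xS1" and e: "0 < (e :: real)"
      show "\<exists>\<tau>>0. \<forall>q\<in>S2xS1. dist p q < \<tau> \<longrightarrow> P.d p q < e"
      proof (intro exI[of _ "min (1/2) (e / 2)"] conjI ballI impI)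
        fix q assume "q \<in> S2xS1" "dist p q < min (1/2) (e / 2)"
        then show "P.d p q < e" using riem_dist_lipschitz[OF warped_space_product, of 1 p q] p by simp
      qed (use e in simp)
    qed
    then show ?thesis unfolding mtopology_dlim by (simp add: homeomorphic_space_refl)
  qed
  have 5: "hausdorff_measure S2xS1 dlim 3 S2xS1 = ennreal ((2 * pi)\<^sup>2 * (2 * \<beta> + 4 - 2 * ln 4))"
  proof (rule antisym[OF _ volume_lower_bound])
    show "hausdorff_measure S2xS1 dlim 3 S2xS1 \<le> ennreal ((2 * pi)\<^sup>2 * (2 * \<beta> + 4 - 2 * ln 4))"
      unfolding hausdorff_measure_def
      by (intro SUP_least volume_upper_bound singular_premeasure_zero) auto
  qed
  show ?thesis
    using Metric_space_dlim 1 2 3 compact 4 singular_dim fibre_length[of 0] fibre_length[of pi] singular_measure_1 5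
    unfolding dreg_def dsing_def by blast
qed

end
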